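(* The Garbulińska space $\mathcal K$ has a continuum of mutually non-conjugate equivalent almost transitive norms. That is, there is a family, of cardinality the continuum, of norms on $\mathcal K$, each equivalent to the given norm of $\mathcal K$ and almost transitive, such that no two distinct members of the family are conjugate.
   Context: "Isometry" of a Banach space means linear surjective isometry. A subspace of a Banach space is $c$-complemented if it is the range of a linear projection of norm at most $c$. A skeleton of a Banach space $X$ is a chain $(E_n)_{n\geq1}$ of finite dimensional subspaces, $E_n\subset E_{n+1}$, whose union is dense in $X$ and such that $E_n$ is $1$-complemented in $E_{n+1}$ for all $n$. An $\varepsilon$-isometry is a linear operator $T:Y\to Z$ (not necessarily surjective) with $(1+\varepsilon)^{-1}\|y\|\leq\|Ty\|\leq(1+\varepsilon)\|y\|$ for all $y\in Y$. A Banach space $X$ has property (G) if, given finite dimensional Banach spaces $E,F$, linear isometric embeddings $u:E\to X$ and $v:E\to F$ with $1$-complemented ranges, and $\varepsilon>0$, there is an $\varepsilon$-isometry $w:F\to X$ with $(1+\varepsilon)$-complemented range such that $u=wv$. The Garbulińska space $\mathcal K$ is the Banach space, unique up to linear isometry (Garbulińska-Węgrzyn), which has a skeleton and property (G). A norm $\|\cdot\|$ on a Banach space $X$ is almost transitive if for all $x,y\in X$ with $\|x\|=\|y\|=1$ and every $\varepsilon>0$ there is a surjective linear isometry $T$ of $(X,\|\cdot\|)$ with $\|y-Tx\|\leq\varepsilon$. Two equivalent norms $\|\cdot\|$ and $|\cdot|$ on a Banach space $X$ are conjugate if there is a bounded linear automorphism $T$ of $X$ with $\|x\|=|Tx|$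 for all $x\in X$. *)

theory Defs
  imports "HOL-Analysis.Analysis" "HOL-Analysis.Finite_Function_Topology"
begin

text \<open>
  A normed space is given either by a type of class \<open>real_normed_vector\<close>, with its whole
  carrier \<open>UNIV\<close> and its \<open>norm\<close>, or by a linear subspace \<open>V\<close> of a real vector space
  together with a function \<open>p\<close> whose restriction to \<open>V\<close> is a norm. Values of \<open>p\<close> outside
  \<open>V\<close> are irrelevant. Operators defined on \<open>V\<close> are represented by linear maps on the ambient
  vector space; this is no restriction, as every linear map on a subspace has a linear
  extension, and only the values on \<open>V\<close> are ever used.
\<close>

definition norm_on :: "'a::real_vector set \<Rightarrow> ('a \<Rightarrow> real) \<Rightarrow> bool" where
  "norm_on V p \<longleftrightarrow> subspace V \<and>
     (\<forall>x\<in>V. 0 \<le> p x) \<and>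
     (\<forall>x\<in>V. p x = 0 \<longleftrightarrow> x = 0) \<and>
     (\<forall>x\<in>V. \<forall>a. p (a *\<^sub>R x) = \<bar>a\<bar> * p x) \<and>
     (\<forall>x\<in>V. \<forall>y\<in>V. p (x + y) \<le> p x + p y)"

definition fin_dim_subspace :: "'a::real_vector set \<Rightarrow> bool" where
  "fin_dim_subspace V \<longleftrightarrow> (\<exists>B. finite B \<and> V = span B)"

text \<open>Finite dimensional normed spaces are automatically complete.\<close>

definition fin_dim_banach :: "'a::real_vector set \<Rightarrow> ('a \<Rightarrow> real) \<Rightarrow> bool" where
  "fin_dim_banach V p \<longleftrightarrow> fin_dim_subspace V \<and> norm_on V p"

text \<open>\<open>S\<close> is a \<open>c\<close>-complemented subspace of \<open>(V, p)\<close>.\<close>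

definition complemented_in ::
  "real \<Rightarrow> 'a::real_vector set \<Rightarrow> ('a \<Rightarrow> real) \<Rightarrow> 'a set \<Rightarrow> bool" where
  "complemented_in c V p S \<longleftrightarrow> S \<subseteq> V \<and>
     (\<exists>P. linear P \<and> P ` V = S \<and> (\<forall>x\<in>V. P (P x) = P x) \<and> (\<forall>x\<in>V. p (P x) \<le> c * p x))"

definition isometric_embedding ::
  "'a::real_vector set \<Rightarrow> ('a \<Rightarrow> real) \<Rightarrow> 'b::real_vector set \<Rightarrow> ('b \<Rightarrow> real) \<Rightarrow> ('a \<Rightarrow> 'b) \<Rightarrow> bool"
  where
  "isometric_embedding V p W q T \<longleftrightarrow> linear T \<and> T ` V \<subseteq> W \<and> (\<forall>x\<in>V. q (T x) = p x)"

definition eps_isometry ::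
  "real \<Rightarrow> 'a::real_vector set \<Rightarrow> ('a \<Rightarrow> real) \<Rightarrow> 'b::real_vector set \<Rightarrow> ('b \<Rightarrow> real) \<Rightarrow> ('a \<Rightarrow> 'b) \<Rightarrow> bool"
  where
  "eps_isometry \<epsilon> V p W q T \<longleftrightarrow> linear T \<and> T ` V \<subseteq> W \<and>
     (\<forall>x\<in>V. inverse (1 + \<epsilon>) * p x \<le> q (T x) \<and> q (T x) \<le> (1 + \<epsilon>) * p x)"

definition has_skeleton :: "'a::real_normed_vector itself \<Rightarrow> bool" where
  "has_skeleton TYPE('a) \<longleftrightarrow>
     (\<exists>E :: nat \<Rightarrow> 'a set.
        (\<forall>n. fin_dim_subspace (E n) \<and> E n \<subseteq> E (Suc n) \<and>
             complemented_in 1 (E (Suc n)) norm (E n)) \<and>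
        closure (\<Union>n. E n) = UNIV)"

text \<open>
  Up to linear isometry, the finite dimensional Banach spaces are exactly the finite dimensional
  subspaces of the real vector space \<open>nat \<Rightarrow>\<^sub>0 real\<close> of finitely supported sequences, each
  equipped with an arbitrary norm. The norm that the library puts on \<open>nat \<Rightarrow>\<^sub>0 real\<close> plays
  no role.
\<close>

definition property_G :: "'a::real_normed_vector itself \<Rightarrow> bool" where
  "property_G TYPE('a) \<longleftrightarrow>
     (\<forall>(E :: (nat \<Rightarrow>\<^sub>0 real) set) pE (F :: (nat \<Rightarrow>\<^sub>0 real) set) pF
        (u :: (nat \<Rightarrow>\<^sub>0 real) \<Rightarrow> 'a) v \<epsilon>.
        fin_dim_banach E pE \<longrightarrow> fin_dim_banach F pF \<longrightarrow>
        isometric_embedding E pE UNIV norm u \<longrightarrow> complemented_in 1 UNIV norm (u ` E) \<longrightarrow>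
        isometric_embedding E pE F pF v \<longrightarrow> complemented_in 1 F pF (v ` E) \<longrightarrow>
        0 < \<epsilon> \<longrightarrow>
        (\<exists>w. eps_isometry \<epsilon> F pF UNIV norm w \<and>
             complemented_in (1 + \<epsilon>) UNIV norm (w ` F) \<and>
             (\<forall>x\<in>E. u x = w (v x))))"

text \<open>
  The two properties that determine the Garbulinska space among real Banach spaces, up to
  linear isometry.
\<close>

definition garbulinska_space :: "'a::banach itself \<Rightarrow> bool" where
  "garbulinska_space TYPE('a) \<longleftrightarrow> has_skeleton TYPE('a) \<and> property_G TYPE('a)"

definition equivalent_norm :: "('a::real_normed_vector \<Rightarrow> real) \<Rightarrow> bool" where
  "equivalent_norm p \<longleftrightarrow> norm_on UNIV p \<and>
     (\<exists>c C. 0 < c \<and> 0 < C \<and> (\<forall>x. c * norm x \<le> p x \<and> p x \<le> C * norm x))"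

definition almost_transitive :: "('a::real_vector \<Rightarrow> real) \<Rightarrow> bool" where
  "almost_transitive p \<longleftrightarrow>
     (\<forall>x y. p x = 1 \<longrightarrow> p y = 1 \<longrightarrow>
        (\<forall>\<epsilon>>0. \<exists>T. linear T \<and> surj T \<and> (\<forall>z. p (T z) = p z) \<and> p (y - T x) \<le> \<epsilon>))"

definition conjugate_norms ::
  "('a::real_normed_vector \<Rightarrow> real) \<Rightarrow> ('a \<Rightarrow> real) \<Rightarrow> bool" where
  "conjugate_norms p q \<longleftrightarrow>
     (\<exists>T. bounded_linear T \<and> bij T \<and> bounded_linear (inv T) \<and> (\<forall>x. p x = q (T x)))"

end

theory Submission
  imports Defs
begin

text \<open>
  Let \<open>K\<close> be the Garbulinska space and \<open>1 < p < 2\<close>. A back-and-forth argument with property (G)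
  shows that \<open>K\<close> is almost transitive and that every space with a skeleton is isometric to a
  complemented subspace of \<open>K\<close>. The first fact makes \<open>L\<^sub>p([0, \<infinity>), K)\<close> almost transitive: after a
  piecewise linear change of variable a step function has constant norm on its support, and its
  values can then be moved by isometries of \<open>K\<close>. The second fact and a swindle show that
  \<open>L\<^sub>p([0, \<infinity>), K)\<close> is isomorphic to \<open>K\<close>, so its norm can be transported to \<open>K\<close>. This norm has a
  nontrivial projection \<open>P\<close> with \<open>\<parallel>x\<parallel>\<^sup>p = \<parallel>P x\<parallel>\<^sup>p + \<parallel>x - P x\<parallel>\<^sup>p\<close>, and no norm admits such projections
  for two different exponents in \<open>(1, 2)\<close>; hence different \<open>p\<close> give non-conjugate norms.
\<close>

section \<open>Finite dimensional normed spaces\<close>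

text \<open>The space of p-integrable functions is never formed. Step functions with their p-norm
  are an incomplete normed space; the isometries and projections found there are carried to K along
  an isomorphic embedding with dense range. On the half line a rescaled dilation is an isometry, so
  no total length has to be respected when cells are merged, and the unit intervals supply the
  infinitely many coordinates that the swindle shifts. Property (G) extends a given embedding only
  up to a factor \<open>1 + \<epsilon>\<close>. To steer the extension it is applied to amalgams,
  whose norm makes prescribed pairs of vectors close while both factors stay 1-complemented; the
  errors of successive amalgams are chosen geometric. The projection that detects p is restriction
  to \<open>[0, 1)\<close>. Exponents p < r exclude each other by orders of smallness:
  \<open>h powr p\<close> is compared with \<open>h powr 2\<close> and with \<open>h powr r\<close>
  as h tends to 0. The first comparison is why the exponents stay below 2.\<close>

definition lin_on :: "'a::real_vector set \<Rightarrow> ('a \<Rightarrow> 'b::real_vector) \<Rightarrow> bool" where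
  "lin_on S f \<longleftrightarrow> (\<forall>x\<in>S. \<forall>y\<in>S. f (x + y) = f x + f y) \<and> (\<forall>x\<in>S. \<forall>a. f (a *\<^sub>R x) = a *\<^sub>R f x)"

definition seminorm_on :: "'a::real_vector set \<Rightarrow> ('a \<Rightarrow> real) \<Rightarrow> bool" where
  "seminorm_on V p \<longleftrightarrow> subspace V \<and> (\<forall>x\<in>V. \<forall>a. p (a *\<^sub>R x) = \<bar>a\<bar> * p x) \<and>
     (\<forall>x\<in>V. \<forall>y\<in>V. p (x + y) \<le> p x + p y)"

lemma seminorm_onD:
  assumes "seminorm_on V p"
  shows "subspace V" "x \<in> V \<Longrightarrow> p (a *\<^sub>R x) = \<bar>a\<bar> * p x"
    "x \<in> V \<Longrightarrow> y \<in> V \<Longrightarrow> p (x + y) \<le> p x + p y" "p 0 = 0"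
    "x \<in> V \<Longrightarrow> p (- x) = p x" "x \<in> V \<Longrightarrow> 0 \<le> p x"
    "x \<in> V \<Longrightarrow> y \<in> V \<Longrightarrow> p (x - y) \<le> p x + p y"
    "x \<in> V \<Longrightarrow> y \<in> V \<Longrightarrow> p x \<le> p y + p (x - y)"
    "x \<in> V \<Longrightarrow> y \<in> V \<Longrightarrow> p (x - y) = p (y - x)"
proof -
  have V: "subspace V" and h: "\<And>x a. x \<in> V \<Longrightarrow> p (a *\<^sub>R x) = \<bar>a\<bar> * p x"
    and t: "\<And>x y. x \<in> V \<Longrightarrow> y \<in> V \<Longrightarrow> p (x + y) \<le> p x + p y"
    using assms by (auto simp: seminorm_on_def)
  show "subspace V" by fact
  show "x \<in> V \<Longrightarrow> p (a *\<^sub>R x) = \<bar>a\<bar> * p x" by fact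
  show "x \<in> V \<Longrightarrow> y \<in> V \<Longrightarrow> p (x + y) \<le> p x + p y" by fact
  show z: "p 0 = 0" using h[of 0 0] V by (simp add: subspace_0)
  have m: "p (- x) = p x" if "x \<in> V" for x using h[OF that, of "-1"] by simp
  then show "x \<in> V \<Longrightarrow> p (- x) = p x" .
  have "0 \<le> p x" if "x \<in> V" for x
    using t[OF that, of "- x"] that V z m[OF that] by (simp add: subspace_neg)
  then show "x \<in> V \<Longrightarrow> 0 \<le> p x" .
  show "x \<in> V \<Longrightarrow> y \<in> V \<Longrightarrow> p (x - y) \<le> p x + p y"
    using t[of x "- y"] V m by (simp add: subspace_neg)
  show "x \<in> V \<Longrightarrow> y \<in> V \<Longrightarrow> p x \<le> p y + p (x - y)"
    using t[of y "x - y"] V by (simp add: subspace_diff)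
  show "x \<in> V \<Longrightarrow> y \<in> V \<Longrightarrow> p (x - y) = p (y - x)"
    using m[of "x - y"] V by (simp add: subspace_diff)
qed

lemma norm_on_seminorm: "norm_on V p \<Longrightarrow> seminorm_on V p"
  by (auto simp: norm_on_def seminorm_on_def)

lemma norm_on_zero: "norm_on V p \<Longrightarrow> x \<in> V \<Longrightarrow> p x = 0 \<Longrightarrow> x = 0"
  by (auto simp: norm_on_def)

lemma norm_on_norm: "subspace V \<Longrightarrow> norm_on V norm"
  by (auto simp: norm_on_def norm_triangle_ineq)

lemma norm_on_subset: "norm_on V p \<Longrightarrow> subspace W \<Longrightarrow> W \<subseteq> V \<Longrightarrow> norm_on W p"
  by (auto simp: norm_on_def subset_iff)

lemma seminorm_on_norm: "seminorm_on UNIV norm"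
  by (simp add: norm_on_norm norm_on_seminorm)

section \<open>Extension of operators from a dense subspace\<close>

lemma lin_onI_linear: "linear f \<Longrightarrow> lin_on S f"
  by (auto simp: lin_on_def linear_add linear_scale)

text \<open>The bound makes \<open>f\<close> Cauchy along any sequence of \<open>D\<close> whose
  images under \<open>j\<close> approach \<open>y\<close>, and the limit does not depend on the
  sequence. A map \<open>j\<close> and a seminorm \<open>M\<close> cover subspaces of a normed
  space, with \<open>j\<close> the identity, as well as abstract spaces mapped into a Banach space.
  Linearity is claimed only on approximable points, as \<open>g\<close> is arbitrary
  elsewhere.\<close>

lemma extend_by_density:
  fixes j :: "'b::real_vector \<Rightarrow> 'd::real_vector" and f :: "'b \<Rightarrow> 'c::banach"
  assumes D: "subspace D" and lj: "linear j" and lf: "lin_on D f" and M: "seminorm_on UNIV M"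
    and bound: "\<And>v. v \<in> D \<Longrightarrow> norm (f v) \<le> C * M (j v)" and C: "0 \<le> C"
  obtains g where "\<And>v. v \<in> D \<Longrightarrow> g (j v) = f v"
    "lin_on {y. \<forall>e>0. \<exists>v\<in>D. M (y - j v) < e} g"
    "\<And>y. \<forall>e>0. \<exists>v\<in>D. M (y - j v) < e \<Longrightarrow> norm (g y) \<le> C * M y"
proof -
  note Mt = seminorm_onD[OF M, simplified]
  define A where "A = {y. \<forall>e>0. \<exists>v\<in>D. M (y - j v) < e}"
  have seq: "\<exists>s. (\<forall>n. s n \<in> D) \<and> (\<lambda>n. M (y - j (s n))) \<longlonglongrightarrow> 0" if "y \<in> A" for y
  proof -
    have "\<forall>n. \<exists>v. v \<in> D \<and> M (y - j v) < inverse (real (Suc n))"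
      using that by (auto simp: A_def Bex_def)
    then obtain s where s: "\<forall>n. s n \<in> D \<and> M (y - j (s n)) < inverse (real (Suc n))" by metis
    have "(\<lambda>n. M (y - j (s n))) \<longlonglongrightarrow> 0"
    proof (rule tendsto_sandwich[OF _ _ tendsto_const LIMSEQ_inverse_real_of_nat])
      show "\<forall>\<^sub>F n in sequentially. M (y - j (s n)) \<le> inverse (real (Suc n))"
        using s by (intro always_eventually allI) (meson less_imp_le)
    qed (simp add: Mt(6))
    with s show ?thesis by auto
  qed
  define s where "s y = (SOME s. (\<forall>n. s n \<in> D) \<and> (\<lambda>n. M (y - j (s n))) \<longlonglongrightarrow> 0)" for y
  have s: "\<And>n. s y n \<in> D" "(\<lambda>n. M (y - j (s y n))) \<longlonglongrightarrow> 0" if "y \<in> A" for y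
    using someI_ex[OF seq[OF that]] unfolding s_def by auto
  have fd: "norm (f v - f w) \<le> C * (M (y - j v) + M (y - j w))" if "v \<in> D" "w \<in> D" for v w y
  proof -
    have "f v - f w = f (v - w)"
    proof -
      have "f (v + (-1) *\<^sub>R w) = f v + (-1) *\<^sub>R f w"
        using lf that D unfolding lin_on_def by (metis subspace_scale)
      then show ?thesis by simp
    qed
    moreover have "M (j (v - w)) \<le> M (y - j v) + M (y - j w)"
      using Mt(7)[of "y - j w" "y - j v"] by (simp add: linear_diff[OF lj])
    ultimately show ?thesis
      using bound[of "v - w"] that D C by (simp add: subspace_diff) (meson order_trans mult_left_mono)
  qed
  have conv: "\<exists>l. (\<lambda>n. f (v n)) \<longlonglongrightarrow> l" if "\<And>n. v n \<in> D" "(\<lambda>n. M (y - j (v n))) \<longlonglongrightarrow> 0" for v y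
  proof -
    have "Cauchy (\<lambda>n. f (v n))"
    proof (rule metric_CauchyI)
      fix e :: real assume "0 < e"
      define e' where "e' = e / (2 * (C + 1))"
      have "0 < e'" using \<open>0 < e\<close> C by (simp add: e'_def)
      then obtain N where N: "\<And>n. n \<ge> N \<Longrightarrow> M (y - j (v n)) < e'"
        using \<open>(\<lambda>n. M (y - j (v n))) \<longlonglongrightarrow> 0\<close> Mt(6) by (fastforce simp: lim_sequentially dist_real_def)
      have "dist (f (v m)) (f (v n)) < e" if "m \<ge> N" "n \<ge> N" for m n
      proof -
        have "norm (f (v m) - f (v n)) \<le> C * (M (y - j (v m)) + M (y - j (v n)))"
          using fd \<open>\<And>n. v n \<in> D\<close> by blast
        also have "\<dots> \<le> C * (e' + e')"
          using N[OF that(1)] N[OF that(2)] C by (intro mult_left_mono) auto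
        also have "\<dots> < (C + 1) * (e' + e')" using \<open>0 < e'\<close> C by (intro mult_strict_right_mono) auto
        also have "\<dots> = 2 * (C + 1) * e'" by (simp add: algebra_simps)
        also have "\<dots> = e" using C by (simp add: e'_def)
        finally show ?thesis by (simp add: dist_norm)
      qed
      then show "\<exists>M. \<forall>m\<ge>M. \<forall>n\<ge>M. dist (f (v m)) (f (v n)) < e" by blast
    qed
    then show ?thesis using Cauchy_convergent convergent_def by blast
  qed
  define g where "g y = lim (\<lambda>n. f (s y n))" for y
  have g: "(\<lambda>n. f (v n)) \<longlonglongrightarrow> g y"
    if y: "y \<in> A" and v: "\<And>n. v n \<in> D" "(\<lambda>n. M (y - j (v n))) \<longlonglongrightarrow> 0" for v y
  proof -
    obtain l where l: "(\<lambda>n. f (s y n)) \<longlonglongrightarrow> l" using conv s[OF y] by blast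
    then have "g y = l" by (simp add: g_def limI)
    have "(\<lambda>n. C * (M (y - j (v n)) + M (y - j (s y n)))) \<longlonglongrightarrow> C * (0 + 0)"
      by (intro tendsto_intros v s y)
    then have "(\<lambda>n. C * (M (y - j (v n)) + M (y - j (s y n)))) \<longlonglongrightarrow> 0" by simp
    then have "(\<lambda>n. f (v n) - f (s y n)) \<longlonglongrightarrow> 0"
      by (rule Lim_null_comparison[rotated]) (use fd v s[OF y] in auto)
    from tendsto_add[OF this l] show ?thesis by (simp add: \<open>g y = l\<close>)
  qed
  have eps: "y \<in> A" if "\<And>n. v n \<in> D" "(\<lambda>n. M (y - j (v n))) \<longlonglongrightarrow> 0" for y v
  proof -
    have "\<exists>v\<in>D. M (y - j v) < e" if e: "0 < e" for e
    proof -
      obtain n where "M (y - j (v n)) < e"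
        using eventually_happens'[OF _ order_tendstoD(2)[OF \<open>(\<lambda>n. M (y - j (v n))) \<longlonglongrightarrow> 0\<close> e]] by auto
      then show ?thesis using \<open>\<And>n. v n \<in> D\<close> by blast
    qed
    then show ?thesis by (simp add: A_def)
  qed
  show ?thesis
  proof
    fix v assume v: "v \<in> D"
    have *: "(\<lambda>n::nat. M (j v - j v)) \<longlonglongrightarrow> 0" by (simp add: Mt)
    have "(\<lambda>n::nat. f v) \<longlonglongrightarrow> g (j v)"
      using g[OF eps[OF v *] v *] .
    then show "g (j v) = f v" using LIMSEQ_unique tendsto_const by blast
  next
    have "g (x + y) = g x + g y" if xy: "x \<in> A" "y \<in> A" for x y
    proof -
      have D': "s x n + s y n \<in> D" for n using s xy D by (simp add: subspace_add)
      have "(\<lambda>n. M (x + y - j (s x n + s y n))) \<longlonglongrightarrow> 0"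
      proof (rule tendsto_sandwich[OF _ _ tendsto_const])
        show "(\<lambda>n. M (x - j (s x n)) + M (y - j (s y n))) \<longlonglongrightarrow> 0"
          using tendsto_add[OF s(2)[OF xy(1)] s(2)[OF xy(2)]] by simp
        show "\<forall>\<^sub>F n in sequentially. M (x + y - j (s x n + s y n)) \<le> M (x - j (s x n)) + M (y - j (s y n))"
        proof (rule always_eventually, rule)
          fix n
          have "x + y - j (s x n + s y n) = (x - j (s x n)) + (y - j (s y n))"
            by (simp add: linear_add[OF lj])
          then show "M (x + y - j (s x n + s y n)) \<le> M (x - j (s x n)) + M (y - j (s y n))"
            using Mt(3) by metis
        qed
      qed (simp add: Mt)
      from g[OF eps[OF D' this] D' this]
      have "(\<lambda>n. f (s x n) + f (s y n)) \<longlonglongrightarrow> g (x + y)"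
        using lf s xy by (simp add: lin_on_def)
      moreover have "(\<lambda>n. f (s x n) + f (s y n)) \<longlonglongrightarrow> g x + g y"
        by (intro tendsto_add g s xy)
      ultimately show ?thesis using LIMSEQ_unique by blast
    qed
    moreover have "g (a *\<^sub>R x) = a *\<^sub>R g x" if x: "x \<in> A" for x a
    proof -
      have D': "a *\<^sub>R s x n \<in> D" for n using s x D by (simp add: subspace_scale)
      have "(\<lambda>n. M (a *\<^sub>R x - j (a *\<^sub>R s x n))) \<longlonglongrightarrow> 0"
        using tendsto_mult_left[OF s(2)[OF x], of "\<bar>a\<bar>"]
        by (simp add: linear_scale[OF lj] Mt(2) flip: scaleR_diff_right)
      from g[OF eps[OF D' this] D' this]
      have "(\<lambda>n. a *\<^sub>R f (s x n)) \<longlonglongrightarrow> g (a *\<^sub>R x)"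
        using lf s x by (simp add: lin_on_def)
      moreover have "(\<lambda>n. a *\<^sub>R f (s x n)) \<longlonglongrightarrow> a *\<^sub>R g x"
        by (intro tendsto_intros g s x)
      ultimately show ?thesis using LIMSEQ_unique by blast
    qed
    ultimately show "lin_on {y. \<forall>e>0. \<exists>v\<in>D. M (y - j v) < e} g"
      unfolding lin_on_def A_def[symmetric] by blast
  next
    fix y assume "\<forall>e>0. \<exists>v\<in>D. M (y - j v) < e"
    then have y: "y \<in> A" by (simp add: A_def)
    have "(\<lambda>n. C * (M y + M (y - j (s y n)))) \<longlonglongrightarrow> C * (M y + 0)"
      by (intro tendsto_intros s y)
    moreover have "norm (f (s y n)) \<le> C * (M y + M (y - j (s y n)))" for n
    proof -
      have "M (j (s y n)) \<le> M y + M (y - j (s y n))" using Mt(8)[of "j (s y n)" y] Mt(9) by metis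
      then show ?thesis using bound[OF s(1)[OF y, of n]] C by (meson mult_left_mono order_trans)
    qed
    ultimately show "norm (g y) \<le> C * M y"
      using LIMSEQ_le[OF tendsto_norm[OF g[OF y s[OF y]]]] by auto
  qed
qed

lemma fin_dim_basis:
  assumes "fin_dim_subspace V"
  obtains B where "finite B" "independent B" "V = span B"
proof -
  obtain B0 where B0: "finite B0" "V = span B0" using assms by (auto simp: fin_dim_subspace_def)
  obtain B where B: "B \<subseteq> B0" "independent B" "B0 \<subseteq> span B"
    using maximal_independent_subset by blast
  have "span B = span B0" using B by (simp add: span_mono span_minimal subset_antisym)
  then show ?thesis using that[of B] B B0 finite_subset[OF B(1) B0(1)] by simp
qed

lemma subspace_chain_Union:
  fixes V :: "nat \<Rightarrow> 'a::real_vector set"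
  assumes V: "\<And>n. subspace (V n)" and inc: "\<And>n. V n \<subseteq> V (Suc n)"
  shows "subspace (\<Union>n. V n)"
proof (rule subspaceI)
  show "0 \<in> (\<Union>n. V n)" using subspace_0[OF V] by blast
  fix x y c assume x: "x \<in> (\<Union>n. V n)"
  then obtain n where n: "x \<in> V n" by blast
  then show "c *\<^sub>R x \<in> (\<Union>n. V n)" using subspace_scale[OF V] by blast
  assume "y \<in> (\<Union>n. V n)"
  then obtain m where m: "y \<in> V m" by blast
  have "V n \<subseteq> V (max n m)" "V m \<subseteq> V (max n m)" by (simp_all add: lift_Suc_mono_le[of V, OF inc])
  then have "x + y \<in> V (max n m)" using n m by (intro subspace_add[OF V]) auto
  then show "x + y \<in> (\<Union>n. V n)" by blast
qed

lemma fin_dim_subspace_subspace: "fin_dim_subspace V \<Longrightarrow> subspace V"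
  by (auto simp: fin_dim_subspace_def)

section \<open>Coordinates, uniform estimates and invertibility in finite dimension\<close>

lemma norm_on_sum:
  assumes "seminorm_on V N" "finite B" "\<And>b. b \<in> B \<Longrightarrow> g b \<in> V"
  shows "N (\<Sum>b\<in>B. g b) \<le> (\<Sum>b\<in>B. N (g b))"
  using assms(2,3)
proof (induction B rule: finite_induct)
  case empty
  then show ?case using seminorm_onD(4)[OF assms(1)] by simp
next
  case (insert x F)
  have "N (g x + sum g F) \<le> N (g x) + N (sum g F)"
    using insert.prems by (intro seminorm_onD(3)[OF assms(1)])
      (auto intro!: subspace_sum[OF seminorm_onD(1)[OF assms(1)]])
  then show ?case using insert by (simp add: add_left_mono order_trans)
qed

text \<open>Induction on the basis. The new vector \<open>b0\<close> has positive distance to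
  \<open>span B\<close>: otherwise approximants from \<open>span B\<close> would have Cauchy
  coordinates by the induction hypothesis, and the limits of the coordinates would represent
  \<open>b0\<close>.\<close>

lemma coordinates_bounded:
  assumes "finite B" "independent B" "norm_on (span B) N"
  shows "\<exists>K>0. \<forall>c. \<forall>b\<in>B. \<bar>c b\<bar> \<le> K * N (\<Sum>x\<in>B. c x *\<^sub>R x)"
  using assms
proof (induction B rule: finite_induct)
  case empty
  then show ?case by (intro exI[of _ 1]) auto
next
  case (insert b0 B)
  have sub: "span B \<subseteq> span (insert b0 B)" by (simp add: span_mono subset_insertI)
  have nB: "norm_on (span B) N" using norm_on_subset[OF insert.prems(2) subspace_span sub] .
  note S = seminorm_onD[OF norm_on_seminorm[OF insert.prems(2)]]
  have iB: "independent B" "b0 \<notin> span B"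
    using insert.prems(1) insert.hyps(2) by (auto simp: independent_insert)
  obtain K where K: "K > 0" "\<And>c b. b \<in> B \<Longrightarrow> \<bar>c b\<bar> \<le> K * N (\<Sum>x\<in>B. c x *\<^sub>R x)"
    using insert.IH[OF iB(1) nB] by blast
  have b0: "b0 \<in> span (insert b0 B)" by (simp add: span_base)
  have inB: "(\<Sum>x\<in>B. c x *\<^sub>R x) \<in> span B" for c
    by (intro span_sum span_scale span_base)
  have inB': "(\<Sum>x\<in>B. c x *\<^sub>R x) \<in> span (insert b0 B)" for c using inB sub by blast
  have "\<exists>d>0. \<forall>c. d \<le> N (b0 - (\<Sum>x\<in>B. c x *\<^sub>R x))"
  proof (rule ccontr)
    assume "\<not> ?thesis"
    then have "\<forall>n. \<exists>c. N (b0 - (\<Sum>x\<in>B. c x *\<^sub>R x)) < inverse (real (Suc n))"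
      by (metis inverse_positive_iff_positive not_le of_nat_0_less_iff zero_less_Suc)
    then obtain c where c: "\<And>n. N (b0 - (\<Sum>x\<in>B. c n x *\<^sub>R x)) < inverse (real (Suc n))" by metis
    have Cau: "\<bar>c m b - c n b\<bar> \<le> K * (inverse (real (Suc m)) + inverse (real (Suc n)))" if "b \<in> B" for m n b
    proof -
      have "\<bar>c m b - c n b\<bar> \<le> K * N (\<Sum>x\<in>B. (c m x - c n x) *\<^sub>R x)"
        using K(2)[OF that, of "\<lambda>x. c m x - c n x"] by simp
      also have "(\<Sum>x\<in>B. (c m x - c n x) *\<^sub>R x) = (b0 - (\<Sum>x\<in>B. c n x *\<^sub>R x)) - (b0 - (\<Sum>x\<in>B. c m x *\<^sub>R x))"
        by (simp add: scaleR_diff_left sum_subtractf)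
      also have "N \<dots> \<le> inverse (real (Suc n)) + inverse (real (Suc m))"
        using S(7)[of "b0 - (\<Sum>x\<in>B. c n x *\<^sub>R x)" "b0 - (\<Sum>x\<in>B. c m x *\<^sub>R x)"] c[of n] c[of m]
          subspace_diff[OF S(1) b0 inB'] by auto
      finally show ?thesis using K(1) by (simp add: algebra_simps)
    qed
    have inv0: "(\<lambda>n. inverse (real (Suc n))) \<longlonglongrightarrow> 0" by (rule LIMSEQ_inverse_real_of_nat)
    have "convergent (\<lambda>n. c n b)" if "b \<in> B" for b
    proof (rule real_Cauchy_convergent, rule metric_CauchyI)
      fix e :: real assume "0 < e"
      then have "0 < e / (2 * K)" using K(1) by simp
      then obtain M where M: "\<And>n. n \<ge> M \<Longrightarrow> inverse (real (Suc n)) < e / (2 * K)"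
        using inv0 by (fastforce simp: lim_sequentially dist_real_def)
      have "dist (c m b) (c n b) < e" if "m \<ge> M" "n \<ge> M" for m n
      proof -
        have "K * (inverse (real (Suc m)) + inverse (real (Suc n))) < K * (e / (2 * K) + e / (2 * K))"
          using M[OF that(1)] M[OF that(2)] K(1) by (intro mult_strict_left_mono) auto
        also have "\<dots> = e" using K(1) by simp
        finally show ?thesis using Cau[OF \<open>b \<in> B\<close>, of m n] by (simp add: dist_real_def)
      qed
      then show "\<exists>M. \<forall>m\<ge>M. \<forall>n\<ge>M. dist (c m b) (c n b) < e" by blast
    qed
    then obtain l where l: "\<And>b. b \<in> B \<Longrightarrow> (\<lambda>n. c n b) \<longlonglongrightarrow> l b"
      unfolding convergent_def by metis
    have bd: "N (b0 - (\<Sum>x\<in>B. l x *\<^sub>R x)) \<le> inverse (real (Suc n)) + (\<Sum>x\<in>B. \<bar>c n x - l x\<bar> * N x)" for n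
    proof -
      have "b0 - (\<Sum>x\<in>B. l x *\<^sub>R x) = (b0 - (\<Sum>x\<in>B. c n x *\<^sub>R x)) + (\<Sum>x\<in>B. (c n x - l x) *\<^sub>R x)"
        by (simp add: scaleR_diff_left sum_subtractf)
      also have "N \<dots> \<le> N (b0 - (\<Sum>x\<in>B. c n x *\<^sub>R x)) + N (\<Sum>x\<in>B. (c n x - l x) *\<^sub>R x)"
        using inB' subspace_diff[OF S(1) b0 inB'] by (intro S(3)) auto
      also have "N (\<Sum>x\<in>B. (c n x - l x) *\<^sub>R x) \<le> (\<Sum>x\<in>B. N ((c n x - l x) *\<^sub>R x))"
        by (rule norm_on_sum[OF norm_on_seminorm[OF insert.prems(2)] insert.hyps(1)])
          (simp add: span_base span_scale)
      also have "\<dots> = (\<Sum>x\<in>B. \<bar>c n x - l x\<bar> * N x)"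
        by (intro sum.cong refl S(2)) (simp add: span_base)
      finally show ?thesis using c[of n] by linarith
    qed
    have "(\<lambda>n. inverse (real (Suc n)) + (\<Sum>x\<in>B. \<bar>c n x - l x\<bar> * N x)) \<longlonglongrightarrow> 0 + (\<Sum>x\<in>B. \<bar>l x - l x\<bar> * N x)"
      by (intro tendsto_intros inv0 l)
    then have "(\<lambda>n. inverse (real (Suc n)) + (\<Sum>x\<in>B. \<bar>c n x - l x\<bar> * N x)) \<longlonglongrightarrow> 0" by simp
    from LIMSEQ_le_const[OF this] bd have "N (b0 - (\<Sum>x\<in>B. l x *\<^sub>R x)) \<le> 0" by blast
    moreover have in': "b0 - (\<Sum>x\<in>B. l x *\<^sub>R x) \<in> span (insert b0 B)"
      using subspace_diff[OF S(1) b0 inB'] .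
    ultimately have "b0 - (\<Sum>x\<in>B. l x *\<^sub>R x) = 0"
      using S(6)[OF in'] norm_on_zero[OF insert.prems(2) in'] by linarith
    then show False using iB(2) inB[of l] by simp
  qed
  then obtain d where d: "d > 0" "\<And>c. d \<le> N (b0 - (\<Sum>x\<in>B. c x *\<^sub>R x))" by blast
  \<comment> \<open>The first entry serves the coefficient of \<open>b0\<close>, which is at most
    \<open>T / d\<close>. For the others, removing the \<open>b0\<close> term leaves a vector of
    norm at most \<open>(1 + N b0 / d) * T\<close>, to which the bound \<open>K\<close>
    applies.\<close>
  define K' where "K' = max (1 / d) (K * (1 + N b0 / d))"
  have N0: "0 \<le> N b0" using S(6) b0 by blast
  have "\<bar>c b\<bar> \<le> K' * N (\<Sum>x\<in>insert b0 B. c x *\<^sub>R x)" if b: "b \<in> insert b0 B" for c b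
  proof -
    define s where "s = (\<Sum>x\<in>B. c x *\<^sub>R x)"
    define T where "T = N (c b0 *\<^sub>R b0 + s)"
    have sin: "s \<in> span (insert b0 B)" unfolding s_def by (rule inB')
    have cb: "c b0 *\<^sub>R b0 \<in> span (insert b0 B)" by (simp add: b0 span_scale)
    have T0: "0 \<le> T" unfolding T_def by (intro S(6) subspace_add[OF S(1)] cb sin)
    have eq: "(\<Sum>x\<in>insert b0 B. c x *\<^sub>R x) = c b0 *\<^sub>R b0 + s"
      using insert.hyps by (simp add: s_def)
    have 1: "\<bar>c b0\<bar> * d \<le> T"
    proof (cases "c b0 = 0")
      case False
      have "b0 - (\<Sum>x\<in>B. (- c x / c b0) *\<^sub>R x) = inverse (c b0) *\<^sub>R (c b0 *\<^sub>R b0 + s)"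
        using False by (simp add: s_def scaleR_add_right scaleR_sum_right sum_negf divide_inverse mult.commute)
      then have "d \<le> \<bar>inverse (c b0)\<bar> * T"
        using d(2)[of "\<lambda>x. - c x / c b0"] S(2)[OF subspace_add[OF S(1) cb sin]] by (simp add: T_def)
      then show ?thesis using False by (simp add: field_simps abs_inverse)
    qed (use T0 in simp)
    have c0: "\<bar>c b0\<bar> \<le> T / d" using 1 d(1) by (simp add: field_simps)
    show ?thesis
    proof (cases "b = b0")
      case True
      have "1 / d * T \<le> K' * T" unfolding K'_def using T0 by (intro mult_right_mono) auto
      then have "T / d \<le> K' * T" by simp
      then show ?thesis using c0 True eq T_def by simp
    next
      case False
      then have "\<bar>c b\<bar> \<le> K * N s" using K(2) b by (auto simp: s_def)
      also have "N s \<le> T + \<bar>c b0\<bar> * N b0"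
        using S(7)[OF subspace_add[OF S(1) cb sin] cb] S(2)[OF b0] by (simp add: T_def)
      also have "\<dots> \<le> T + T / d * N b0" using c0 N0 by (intro add_left_mono mult_right_mono)
      also have "\<dots> = (1 + N b0 / d) * T" by (simp add: algebra_simps)
      finally have "\<bar>c b\<bar> \<le> K * (1 + N b0 / d) * T" using K(1) by (simp add: mult_left_mono mult.assoc)
      also have "\<dots> \<le> K' * T" unfolding K'_def using T0 by (intro mult_right_mono) auto
      finally show ?thesis using eq T_def by simp
    qed
  qed
  moreover have "K' > 0" unfolding K'_def using d(1) by (simp add: less_max_iff_disj)
  ultimately show ?case by blast
qed

text \<open>Vectors are controlled by their coordinates, so smallness on the finitely many basis
  vectors suffices. This makes the projections of a skeleton uniformly close to the identity on a
  finite dimensional space.\<close>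

lemma pointwise_null_imp_uniformly_small:
  assumes F: "fin_dim_subspace F" and N: "norm_on F N" and L: "\<And>m. linear (L m)"
    and null: "\<And>f. f \<in> F \<Longrightarrow> (\<lambda>m. L m f :: 'c::real_normed_vector) \<longlonglongrightarrow> 0" and "0 < \<eta>"
  shows "\<forall>\<^sub>F m in sequentially. \<forall>f\<in>F. norm (L m f) \<le> \<eta> * N f"
proof -
  obtain B where B: "finite B" "independent B" "F = span B" using fin_dim_basis[OF F] .
  obtain K where K: "K > 0" "\<And>c b. b \<in> B \<Longrightarrow> \<bar>c b\<bar> \<le> K * N (\<Sum>x\<in>B. c x *\<^sub>R x)"
    using coordinates_bounded[OF B(1,2)] N B(3) by blast
  have "(\<lambda>m. K * (\<Sum>b\<in>B. norm (L m b))) \<longlonglongrightarrow> K * (\<Sum>b\<in>B. norm (0::'c))"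
    using B by (intro tendsto_intros null) (auto simp: span_base)
  then have "\<forall>\<^sub>F m in sequentially. K * (\<Sum>b\<in>B. norm (L m b)) < \<eta>"
    using \<open>0 < \<eta>\<close> by (intro order_tendstoD(2)) auto
  then show ?thesis
  proof eventually_elim
    fix m assume m: "K * (\<Sum>b\<in>B. norm (L m b)) < \<eta>"
    show "\<forall>f\<in>F. norm (L m f) \<le> \<eta> * N f"
    proof
      fix f assume f: "f \<in> F"
      then obtain c where c: "f = (\<Sum>x\<in>B. c x *\<^sub>R x)" using B span_finite[OF B(1)] by auto
      have Nf: "0 \<le> N f" using N f by (simp add: norm_on_def)
      have "L m f = (\<Sum>x\<in>B. c x *\<^sub>R L m x)" by (simp add: c linear_sum[OF L] linear_scale[OF L])
      then have "norm (L m f) \<le> (\<Sum>x\<in>B. \<bar>c x\<bar> * norm (L m x))" by (simp add: sum_norm_le)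
      also have "\<dots> \<le> (\<Sum>x\<in>B. (K * N f) * norm (L m x))"
        using K(2)[of _ c] c by (intro sum_mono mult_right_mono) auto
      also have "\<dots> = (K * (\<Sum>b\<in>B. norm (L m b))) * N f" by (simp add: sum_distrib_left mult_ac)
      also have "\<dots> \<le> \<eta> * N f" using m Nf by (intro mult_right_mono) auto
      finally show "norm (L m f) \<le> \<eta> * N f" .
    qed
  qed
qed

text \<open>\<open>S\<close> is bounded below by \<open>1 - \<eta>\<close>, hence injective, and a
  dimension count makes it onto. The inverse is a linear map of the ambient space with range in
  \<open>F\<close>, so that it can be composed without regard to domains.\<close>

lemma near_identity_inverse:
  assumes F: "fin_dim_subspace F" and N: "norm_on F N" and S: "linear S" "S ` F \<subseteq> F"
    and near: "\<And>f. f \<in> F \<Longrightarrow> N (S f - f) \<le> \<eta> * N f" and \<eta>: "\<eta> < 1"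
  obtains S' where "linear S'" "range S' \<subseteq> F" "\<And>f. f \<in> F \<Longrightarrow> S' (S f) = f"
    "\<And>f. f \<in> F \<Longrightarrow> S (S' f) = f" "\<And>f. f \<in> F \<Longrightarrow> (1 - \<eta>) * N (S' f) \<le> N f"
proof -
  obtain B where B: "finite B" "independent B" "F = span B" using fin_dim_basis[OF F] .
  have sF: "subspace F" using B by simp
  note sn = seminorm_onD[OF norm_on_seminorm[OF N]]
  have low: "(1 - \<eta>) * N f \<le> N (S f)" if "f \<in> F" for f
    using near[OF that] sn(8)[of f "S f"] sn(9)[of f "S f"] that S(2) by (simp add: image_subset_iff algebra_simps)
  have inj: "inj_on S F"
  proof (subst linear_inj_on_iff_eq_0[OF S(1) sF], intro ballI impI)
    fix x assume x: "x \<in> F" "S x = 0"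
    then have "(1 - \<eta>) * N x \<le> 0" using low[of x] sn(4) by simp
    then have "N x \<le> 0" using \<eta> by (simp add: mult_le_0_iff)
    then show "x = 0" using norm_on_zero[OF N x(1)] sn(6)[OF x(1)] by simp
  qed
  obtain S' where S': "range S' \<subseteq> F" "linear S'" "\<And>f. f \<in> F \<Longrightarrow> S' (S f) = f"
    using linear_exists_left_inverse_on[OF S(1) sF inj] by auto
  have "F \<subseteq> S ` F"
  proof -
    have iSB: "independent (S ` B)"
      using linear_independent_injective_image[OF S(1) B(2)] inj B(3) by simp
    have cSB: "card (S ` B) = card B"
      using card_image[of S B] inj_on_subset[OF inj] B(3) span_superset by blast
    have "S ` B \<subseteq> span B" using S(2) B(3) span_superset[of B] by blast
    have "B \<subseteq> span (S ` B)"
    proof (rule ccontr)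
      assume "\<not> ?thesis"
      then obtain b where b: "b \<in> B" "b \<notin> span (S ` B)" by blast
      then have "independent (insert b (S ` B))" using iSB by (simp add: independent_insert)
      moreover have "insert b (S ` B) \<subseteq> span B"
        using b \<open>S ` B \<subseteq> span B\<close> span_base by auto
      ultimately have "card (insert b (S ` B)) \<le> card B" using independent_span_bound[OF B(1)] by blast
      moreover have "b \<notin> S ` B" using b(2) span_superset[of "S ` B"] by blast
      ultimately show False using cSB B(1) by simp
    qed
    then have "span B \<subseteq> span (S ` B)" by (simp add: span_minimal)
    also have "span (S ` B) = S ` F" using linear_span_image[OF S(1)] B(3) by simp
    finally show ?thesis using B(3) by simp
  qed
  then have SS': "S (S' f) = f" if f: "f \<in> F" for f
  proof -
    obtain x where "x \<in> F" "f = S x" using f \<open>F \<subseteq> S ` F\<close> by blast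
    then show ?thesis using S'(3) by simp
  qed
  show ?thesis
  proof (rule that[OF S'(2,1,3) SS'])
    show "(1 - \<eta>) * N (S' f) \<le> N f" if "f \<in> F" for f
      using low[of "S' f"] SS'[OF that] S'(1) by auto
  qed
qed

text \<open>One step of the Hahn-Banach theorem: the value \<open>a\<close> at \<open>b\<close> has
  to lie above all \<open>g s - norm (s - b)\<close> and below all
  \<open>norm (t + b) - g t\<close>, and the triangle inequality leaves room for it. The extension
  adds to \<open>g\<close> a multiple of a functional that is \<open>1\<close> at \<open>b\<close>
  and vanishes on \<open>S\<close>.\<close>

lemma extend_functional_step:
  fixes g :: "'a::real_normed_vector \<Rightarrow> real"
  assumes g: "linear g" and S: "subspace S" and le: "\<And>s. s \<in> S \<Longrightarrow> \<bar>g s\<bar> \<le> norm s"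
  obtains g' where "linear g'" "\<And>s. s \<in> S \<Longrightarrow> g' s = g s" "\<And>s. s \<in> span (insert b S) \<Longrightarrow> \<bar>g' s\<bar> \<le> norm s"
proof (cases "b \<in> S")
  case True
  then have "span (insert b S) = S" using S by (simp add: insert_absorb span_eq_iff)
  then show ?thesis using that[of g] g le by simp
next
  case False
  have le': "g s - norm (s - b) \<le> norm (t + b) - g t" if "s \<in> S" "t \<in> S" for s t
  proof -
    have "g s + g t \<le> norm (s + t)" using le[of "s + t"] that S by (simp add: subspace_add linear_add[OF g])
    also have "\<dots> \<le> norm (s - b) + norm (t + b)" using norm_triangle_ineq[of "s - b" "t + b"] by simp
    finally show ?thesis by simp
  qed
  define a where "a = (SUP s\<in>S. g s - norm (s - b))"
  have S0: "0 \<in> S" using S by (simp add: subspace_0)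
  have bdd: "bdd_above ((\<lambda>s. g s - norm (s - b)) ` S)"
    using le'[OF _ S0] by (auto simp: bdd_above_def)
  have a1: "g s - norm (s - b) \<le> a" if "s \<in> S" for s
    unfolding a_def using bdd that by (rule cSUP_upper[rotated])
  have a2: "a \<le> norm (t + b) - g t" if "t \<in> S" for t
    unfolding a_def using le' that S0 by (intro cSUP_least) auto
  obtain B where B: "B \<subseteq> S" "independent B" "S \<subseteq> span B" using maximal_independent_subset by blast
  have sB: "span B = S" using B S by (simp add: span_minimal subset_antisym)
  have "independent (insert b B)" using B(2) sB False by (simp add: independent_insert)
  then obtain h :: "'a \<Rightarrow> real" where h: "linear h" "\<forall>x\<in>insert b B. h x = (if x = b then 1 else 0)"
    using linear_independent_extend[of "insert b B" "\<lambda>x. if x = b then 1 else 0"] by blast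
  have hb: "h b = 1" using h by simp
  have hS: "h s = 0" if "s \<in> S" for s
  proof (rule linear_eq_0_on_span[OF h(1)])
    show "h x = 0" if "x \<in> B" for x using h(2) that B(1) False by auto
    show "s \<in> span B" using that sB by simp
  qed
  define g' where "g' x = g x + (a - g b) * h x" for x
  have lg': "linear g'" unfolding g'_def
    by (intro linear_compose_add g linear_compose_scale_right[of h "a - g b", simplified]) (rule h(1))
  show ?thesis
  proof (rule that[OF lg'])
    show "g' s = g s" if "s \<in> S" for s using hS[OF that] by (simp add: g'_def)
    fix x assume "x \<in> span (insert b S)"
    then obtain t where t: "x - t *\<^sub>R b \<in> span S" by (auto simp: span_insert)
    define s where "s = x - t *\<^sub>R b"
    have s: "s \<in> S" using t S by (simp add: s_def span_eq_iff[THEN iffD2])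
    have x: "x = s + t *\<^sub>R b" by (simp add: s_def)
    have gx: "g' x = g s + t * a"
      by (simp add: g'_def x linear_add[OF g] linear_add[OF h(1)] linear_scale[OF g] linear_scale[OF h(1)] hS[OF s] hb algebra_simps)
    \<comment> \<open>Division by \<open>t\<close> reduces both estimates to the two bounds on
      \<open>a\<close>; the absolute value and negative coefficients are reached through
      \<open>- s\<close> and \<open>- t\<close>.\<close>
    have pos: "g s + t * a \<le> norm (s + t *\<^sub>R b) \<and> g s - t * a \<le> norm (s - t *\<^sub>R b)" if t: "t > 0" and s: "s \<in> S" for t s
    proof
      have i: "(1/t) *\<^sub>R s \<in> S" using s S by (simp add: subspace_scale)
      have "t * a \<le> t * (norm ((1/t) *\<^sub>R s + b) - g ((1/t) *\<^sub>R s))" using a2[OF i] t by (intro mult_left_mono) auto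
      also have "\<dots> = norm (t *\<^sub>R ((1/t) *\<^sub>R s + b)) - g s" using t by (simp add: linear_scale[OF g] right_diff_distrib)
      finally show "g s + t * a \<le> norm (s + t *\<^sub>R b)" using t by (simp add: scaleR_add_right)
      have "t * (g ((1/t) *\<^sub>R s) - norm ((1/t) *\<^sub>R s - b)) \<le> t * a" using a1[OF i] t by (intro mult_left_mono) auto
      moreover have "t * (g ((1/t) *\<^sub>R s) - norm ((1/t) *\<^sub>R s - b)) = g s - norm (t *\<^sub>R ((1/t) *\<^sub>R s - b))"
        using t by (simp add: linear_scale[OF g] right_diff_distrib)
      ultimately show "g s - t * a \<le> norm (s - t *\<^sub>R b)" using t by (simp add: scaleR_diff_right)
    qed
    have ms: "- s \<in> S" using s S by (simp add: subspace_neg)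
    consider "t > 0" | "t = 0" | "t < 0" by linarith
    then show "\<bar>g' x\<bar> \<le> norm x"
    proof cases
      case 1
      have "norm (- s - t *\<^sub>R b) = norm x" using norm_minus_cancel[of x] by (simp add: x)
      then show ?thesis using pos[OF 1 s] pos[OF 1 ms] gx x by (simp add: linear_neg[OF g] abs_le_iff)
    next
      case 2
      then show ?thesis using gx x le[OF s] by simp
    next
      case 3
      then have t': "- t > 0" by simp
      have "norm (- s - t *\<^sub>R b) = norm x" using norm_minus_cancel[of x] by (simp add: x)
      then show ?thesis using pos[OF t' s] pos[OF t' ms] gx x by (simp add: linear_neg[OF g] abs_le_iff)
    qed
  qed
qed

text \<open>Finitely many one dimensional extensions, starting from the line through
  \<open>x0\<close>. The functionals yield the rank one contractions that start the back-and-forth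
  construction.\<close>

lemma norming_functional:
  fixes x0 :: "'a::real_normed_vector"
  assumes "fin_dim_subspace V" and x0: "x0 \<in> V"
  obtains g :: "'a \<Rightarrow> real" where "linear g" "g x0 = norm x0" "\<And>x. x \<in> V \<Longrightarrow> \<bar>g x\<bar> \<le> norm x"
proof -
  obtain B where B: "finite B" "V = span B" using assms(1) by (auto simp: fin_dim_subspace_def)
  have *: "\<exists>g::'a \<Rightarrow> real. linear g \<and> g x0 = norm x0 \<and> (\<forall>x\<in>span (insert x0 B). \<bar>g x\<bar> \<le> norm x)"
    using B(1)
  proof (induction B rule: finite_induct)
    case empty
    show ?case
    proof (cases "x0 = 0")
      case True
      then show ?thesis by (intro exI[of _ "\<lambda>x. 0"]) (auto simp: linear_zero)
    next
      case False
      then have "independent {x0}" by simp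
      then obtain g :: "'a \<Rightarrow> real" where g: "linear g" "g x0 = norm x0"
        using linear_independent_extend[of "{x0}" "\<lambda>_. norm x0"] by auto
      have "\<bar>g x\<bar> \<le> norm x" if x: "x \<in> span {x0}" for x
      proof -
        obtain k where "x = k *\<^sub>R x0" using x unfolding span_singleton by blast
        then show ?thesis by (simp add: linear_scale[OF g(1)] g(2) abs_mult)
      qed
      then show ?thesis using g by blast
    qed
  next
    case (insert b B)
    then obtain g :: "'a \<Rightarrow> real" where g: "linear g" "g x0 = norm x0" "\<And>x. x \<in> span (insert x0 B) \<Longrightarrow> \<bar>g x\<bar> \<le> norm x"
      by blast
    obtain g' where g': "linear g'" "\<And>s. s \<in> span (insert x0 B) \<Longrightarrow> g' s = g s"
      "\<And>s. s \<in> span (insert b (span (insert x0 B))) \<Longrightarrow> \<bar>g' s\<bar> \<le> norm s"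
      using extend_functional_step[OF g(1) subspace_span[of "insert x0 B"], where b=b] g(3) by blast
    have "span (insert x0 (insert b B)) \<subseteq> span (insert b (span (insert x0 B)))"
      by (rule span_mono) (auto simp: span_base)
    then show ?case using g' g(2) by (metis insertI1 span_base subsetD)
  qed
  have "insert x0 B \<subseteq> span B" "V \<subseteq> span (insert x0 B)" using x0 B(2) span_superset by (auto intro: span_mono[THEN subsetD])
  then show ?thesis using * that by blast
qed

lemma fin_dim_image: "linear f \<Longrightarrow> fin_dim_subspace V \<Longrightarrow> fin_dim_subspace (f ` V)"
  unfolding fin_dim_subspace_def using linear_span_image by (metis finite_imageI)

section \<open>Closed subspaces and extension by continuity\<close>

lemma dense_iff_norm:
  fixes D :: "'a::real_normed_vector set"
  shows "y \<in> closure D \<longleftrightarrow> (\<forall>e>0. \<exists>v\<in>D. norm (y - v) < e)"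
  by (simp add: closure_approachable dist_norm norm_minus_commute)

lemma closure_subspace:
  fixes D :: "'a::real_normed_vector set"
  assumes D: "subspace D"
  shows "subspace (closure D)"
proof (rule subspaceI)
  show "0 \<in> closure D" using subspace_0[OF D] closure_subset by blast
  fix x y and c :: real assume "x \<in> closure D"
  then obtain X where X: "\<And>n. X n \<in> D" "X \<longlonglongrightarrow> x" by (auto simp: closure_sequential)
  have "c *\<^sub>R X n \<in> D" for n using X(1) subspace_scale[OF D] by blast
  then show "c *\<^sub>R x \<in> closure D"
    using tendsto_scaleR[OF tendsto_const X(2), of c] unfolding closure_sequential
    by (intro exI[of _ "\<lambda>n. c *\<^sub>R X n"]) auto
  assume "y \<in> closure D"
  then obtain Y where Y: "\<And>n. Y n \<in> D" "Y \<longlonglongrightarrow> y" by (auto simp: closure_sequential)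
  have "X n + Y n \<in> D" for n using X(1) Y(1) subspace_add[OF D] by blast
  then show "x + y \<in> closure D"
    using tendsto_add[OF X(2) Y(2)] unfolding closure_sequential
    by (intro exI[of _ "\<lambda>n. X n + Y n"]) auto
qed

text \<open>The coordinate functionals extend to the closure by density, so the sum of coordinates
  times basis vectors becomes a bounded operator from the closure into \<open>V\<close>. It is the
  identity on \<open>V\<close>, hence on the closure.\<close>

lemma fin_dim_closed:
  fixes V :: "'a::real_normed_vector set"
  assumes V: "fin_dim_subspace V"
  shows "closed V"
proof -
  obtain B where B: "finite B" "independent B" "V = span B" using fin_dim_basis[OF V] .
  have sV: "subspace V" using B by simp
  obtain K where K: "K > 0" "\<And>c b. b \<in> B \<Longrightarrow> \<bar>c b\<bar> \<le> K * norm (\<Sum>x\<in>B. c x *\<^sub>R x)"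
    using coordinates_bounded[OF B(1,2) norm_on_norm] subspace_span by blast
  define f where "f b v = representation B v b" for b v
  have fv: "(\<Sum>b\<in>B. f b v *\<^sub>R b) = v" if "v \<in> V" for v
    using that B by (simp add: f_def sum_representation_eq)
  have bd: "norm (f b v) \<le> K * norm (id v)" if "v \<in> V" "b \<in> B" for v b
    using K(2)[OF that(2), of "\<lambda>b. f b v"] fv[OF that(1)] by simp
  have lf: "lin_on V (f b)" for b
    using B by (simp add: lin_on_def f_def representation_add representation_scale)
  have lid: "linear (id :: 'a \<Rightarrow> 'a)" by (simp add: linear_id)
  have "\<exists>g. (\<forall>v\<in>V. g v = f b v) \<and> lin_on (closure V) g \<and> (\<forall>y\<in>closure V. \<bar>g y\<bar> \<le> K * norm y)" if b: "b \<in> B" for b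
  proof -
    obtain g where "\<And>v. v \<in> V \<Longrightarrow> g (id v) = f b v"
      "lin_on {y. \<forall>e>0. \<exists>v\<in>V. norm (y - id v) < e} g"
      "\<And>y. \<forall>e>0. \<exists>v\<in>V. norm (y - id v) < e \<Longrightarrow> norm (g y) \<le> K * norm y"
      using extend_by_density[OF sV lid lf[of b] seminorm_on_norm bd[OF _ b] less_imp_le[OF K(1)]] by blast
    moreover have "{y. \<forall>e>0. \<exists>v\<in>V. norm (y - id v) < e} = closure V" using dense_iff_norm[of _ V] by auto
    ultimately show ?thesis using dense_iff_norm[of _ V] by (intro exI[of _ g]) auto
  qed
  then obtain g where g: "\<And>b v. b \<in> B \<Longrightarrow> v \<in> V \<Longrightarrow> g b v = f b v" "\<And>b. b \<in> B \<Longrightarrow> lin_on (closure V) (g b)"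
    "\<And>b y. b \<in> B \<Longrightarrow> y \<in> closure V \<Longrightarrow> \<bar>g b y\<bar> \<le> K * norm y" by metis
  have "y \<in> V" if y: "y \<in> closure V" for y
  proof -
    define G where "G y = (\<Sum>b\<in>B. g b y *\<^sub>R b)" for y
    have scl: "subspace (closure V)" using sV by (rule closure_subspace)
    define C where "C = (\<Sum>b\<in>B. K * norm b)"
    have C0: "0 \<le> C" using K(1) by (simp add: C_def sum_nonneg)
    have bdG: "norm (G z) \<le> C * norm z" if "z \<in> closure V" for z
    proof -
      have "norm (G z) \<le> (\<Sum>b\<in>B. norm (g b z *\<^sub>R b))" unfolding G_def by (rule norm_sum)
      also have "\<dots> \<le> (\<Sum>b\<in>B. (K * norm z) * norm b)"
        unfolding norm_scaleR by (intro sum_mono mult_right_mono g(3) that) auto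
      finally show ?thesis by (simp add: C_def sum_distrib_right sum_distrib_left mult_ac)
    qed
    have "norm (G y - y) \<le> 0 + e" if e: "0 < e" for e
    proof -
      have e': "0 < e / (C + 1)" using e C0 by simp
      obtain v where v: "v \<in> V" "norm (y - v) < e / (C + 1)"
        using y e' unfolding dense_iff_norm by blast
      have vc: "v \<in> closure V" using v closure_subset by blast
      have "G y = G (y - v) + v"
      proof -
        have "g b ((y - v) + v) = g b (y - v) + g b v" if "b \<in> B" for b
          using g(2)[OF that] vc subspace_diff[OF scl y vc] unfolding lin_on_def by blast
        then have "G ((y - v) + v) = G (y - v) + G v"
          unfolding G_def by (simp add: scaleR_add_left flip: sum.distrib cong: sum.cong)
        moreover have "G v = v" using fv[OF v(1)] g(1)[OF _ v(1)] by (simp add: G_def)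
        ultimately show ?thesis by simp
      qed
      then have "G y - y = G (y - v) - (y - v)" by (simp add: algebra_simps)
      then have "norm (G y - y) = norm (G (y - v) - (y - v))" by (rule arg_cong)
      also have "\<dots> \<le> C * norm (y - v) + norm (y - v)"
        using norm_triangle_ineq4[of "G (y - v)" "y - v"] bdG[OF subspace_diff[OF scl y vc]] by linarith
      also have "\<dots> = (C + 1) * norm (y - v)" by (simp add: algebra_simps)
      also have "\<dots> \<le> (C + 1) * (e / (C + 1))" using v C0 by (intro mult_left_mono) auto
      also have "\<dots> = e" using C0 by simp
      finally show ?thesis by simp
    qed
    then have "norm (G y - y) \<le> 0" by (rule field_le_epsilon)
    then have "G y = y" by simp
    moreover have "G y \<in> V" unfolding G_def B(3) by (intro span_sum span_scale span_base)
    ultimately show ?thesis by simp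
  qed
  then show ?thesis by (metis closure_subset closure_closed subset_antisym subsetI closed_closure)
qed

lemma bounded_linear_extension:
  fixes f :: "'a::real_normed_vector \<Rightarrow> 'c::banach"
  assumes D: "subspace D" "closure D = UNIV" and f: "lin_on D f"
    and bd: "\<And>x. x \<in> D \<Longrightarrow> norm (f x) \<le> C * norm x" and C: "0 \<le> C"
  obtains g where "bounded_linear g" "\<And>x. x \<in> D \<Longrightarrow> g x = f x" "\<And>x. norm (g x) \<le> C * norm x"
proof -
  have lid: "linear (id :: 'a \<Rightarrow> 'a)" by (simp add: linear_id)
  have bd': "norm (f x) \<le> C * norm (id x)" if "x \<in> D" for x using bd[OF that] by simp
  obtain g where g: "\<And>v. v \<in> D \<Longrightarrow> g (id v) = f v"
      "lin_on {y. \<forall>e>0. \<exists>v\<in>D. norm (y - id v) < e} g"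
      "\<And>y. \<forall>e>0. \<exists>v\<in>D. norm (y - id v) < e \<Longrightarrow> norm (g y) \<le> C * norm y"
    using extend_by_density[OF D(1) lid f seminorm_on_norm bd' C] by blast
  have all: "\<forall>e>0. \<exists>v\<in>D. norm (y - id v) < e" for y using dense_iff_norm[of y D] D by simp
  show ?thesis
  proof
    show "bounded_linear g"
      using g(2,3) all unfolding lin_on_def
      by (intro bounded_linear_intro[of _ C]) (auto simp: mult.commute)
    show "g x = f x" if "x \<in> D" for x using g(1)[OF that] by simp
    show "norm (g x) \<le> C * norm x" for x using g(3) all by blast
  qed
qed

section \<open>Skeletons and the extension property\<close>

text \<open>The working form of the hypotheses: each \<open>pr n\<close> is a contractive projection
  of the whole space, whereas a skeleton provides projections only from each member of the chain
  onto the preceding one.\<close>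

locale skeleton_space =
  fixes E :: "nat \<Rightarrow> 'a::banach set" and pr :: "nat \<Rightarrow> 'a \<Rightarrow> 'a"
  assumes fd: "fin_dim_subspace (E n)" and mono_Suc: "E n \<subseteq> E (Suc n)"
    and dense: "closure (\<Union>n. E n) = UNIV"
    and pr_bl: "bounded_linear (pr n)" and pr_in: "pr n x \<in> E n"
    and pr_id: "x \<in> E n \<Longrightarrow> pr n x = x" and pr_norm: "norm (pr n x) \<le> norm x"
    and property_G: "property_G TYPE('a)"
begin

lemma E_mono: "n \<le> m \<Longrightarrow> E n \<subseteq> E m"
  using mono_Suc by (rule lift_Suc_mono_le)

lemma E_subspace: "subspace (E n)"
  using fd fin_dim_subspace_subspace by blast

lemma pr_range: "range (pr n) = E n"
  using pr_in pr_id by (auto simp: image_iff) metis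

lemma pr_linear: "linear (pr n)"
  using pr_bl by (rule bounded_linear.linear)

lemma union_subspace: "subspace (\<Union>n. E n)"
  by (rule subspace_chain_Union[of E, OF E_subspace mono_Suc])

lemma pr_tendsto: "(\<lambda>m. pr m x) \<longlonglongrightarrow> x"
proof (rule metric_LIMSEQ_I)
  fix e :: real assume "0 < e"
  then obtain v n where v: "v \<in> E n" "norm (x - v) < e / 2"
    using dense dense_iff_norm[of x "\<Union>n. E n"] by (auto dest: spec[of _ "e / 2"])
  have "dist (pr m x) x < e" if "m \<ge> n" for m
  proof -
    have "pr m v = v" using pr_id E_mono[OF that] v by blast
    then have "pr m x - x = pr m (x - v) - (x - v)" by (simp add: linear_diff[OF pr_linear])
    then have "norm (pr m x - x) \<le> norm (pr m (x - v)) + norm (x - v)" using norm_triangle_ineq4 by metis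
    also have "\<dots> < e" using pr_norm[of m "x - v"] v by linarith
    finally show ?thesis by (simp add: dist_norm)
  qed
  then show "\<exists>no. \<forall>n\<ge>no. dist (pr n x) x < e" by blast
qed

end

text \<open>Composed projections of consecutive members map \<open>E (n + k)\<close> onto
  \<open>E n\<close>. They agree on common domains because each projection fixes its range, so they
  define one contraction on the union, which extends by density; its values stay in
  \<open>E n\<close> because \<open>E n\<close> is closed.\<close>

lemma has_skeleton_imp_skeleton_space:
  assumes "has_skeleton TYPE('a::banach)" "property_G TYPE('a::banach)"
  obtains E :: "nat \<Rightarrow> 'a::banach set" and pr where "skeleton_space E pr"
proof -
  obtain E :: "nat \<Rightarrow> 'a set" where E: "\<And>n. fin_dim_subspace (E n)" "\<And>n. E n \<subseteq> E (Suc n)"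
    "\<And>n. complemented_in 1 (E (Suc n)) norm (E n)" "closure (\<Union>n. E n) = UNIV"
    using assms(1) unfolding has_skeleton_def by blast
  have "\<forall>n. \<exists>P. linear P \<and> P ` E (Suc n) = E n \<and> (\<forall>x\<in>E (Suc n). P (P x) = P x) \<and> (\<forall>x\<in>E (Suc n). norm (P x) \<le> 1 * norm x)"
    using E(3) unfolding complemented_in_def by blast
  then obtain P where P: "\<And>n. linear (P n)" "\<And>n. P n ` E (Suc n) = E n"
    "\<And>n x. x \<in> E (Suc n) \<Longrightarrow> P n (P n x) = P n x" "\<And>n x. x \<in> E (Suc n) \<Longrightarrow> norm (P n x) \<le> norm x"
    by simp metis
  have sE: "subspace (E n)" for n using E(1) fin_dim_subspace_subspace by blast
  have Em: "n \<le> m \<Longrightarrow> E n \<subseteq> E m" for n m using E(2) by (rule lift_Suc_mono_le)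
  have Pid: "P n x = x" if "x \<in> E n" for n x
    using that P(2)[of n] P(3)[of _ n] by (metis imageE)
  \<comment> \<open>\<open>c n k\<close> composes \<open>P n\<close> up to
    \<open>P (n + k - 1)\<close>, the last one applied first; it is the identity for
    \<open>k = 0\<close>.\<close>
  define c where "c n k = rec_nat id (\<lambda>k f. f \<circ> P (n + k)) k" for n k
  have c0: "c n 0 = id" and cS: "c n (Suc k) = c n k \<circ> P (n + k)" for n k by (simp_all add: c_def)
  have cl: "linear (c n k)" for n k
  proof (induction k)
    case 0
    show ?case unfolding c0 by (rule linear_id)
  next
    case (Suc k)
    show ?case unfolding cS by (rule linear_compose[OF P(1) Suc])
  qed
  have cE: "c n k x \<in> E n \<and> norm (c n k x) \<le> norm x" if "x \<in> E (n + k)" for n k x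
    using that
  proof (induction k arbitrary: x)
    case (Suc k)
    have "P (n + k) x \<in> E (n + k)" "norm (P (n + k) x) \<le> norm x" using Suc.prems P(2,4) by auto
    then show ?case using Suc.IH[of "P (n + k) x"] by (auto simp: cS)
  qed (simp add: c0)
  have cc: "c n l x = c n k x" if "x \<in> E (n + k)" "k \<le> l" for n k l x
    using that(2)
  proof (induction l rule: dec_induct)
    case (step l)
    have "x \<in> E (n + l)" using that(1) Em[of "n + k" "n + l"] step by auto
    then show ?case using step by (simp add: cS Pid)
  qed simp
  have "skeleton_space E pr \<Longrightarrow> thesis" for pr using that by blast
  moreover have "\<exists>g. bounded_linear g \<and> (\<forall>x. g x \<in> E n) \<and> (\<forall>x\<in>E n. g x = x) \<and> (\<forall>x. norm (g x) \<le> norm x)" for n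
  proof -
    let ?U = "\<Union>n. E n"
    \<comment> \<open>By \<open>cc\<close> every \<open>k\<close> with \<open>x\<close> in
      \<open>E (n + k)\<close> gives the same value; the least one is merely a choice.\<close>
    define f where "f x = c n (LEAST k. x \<in> E (n + k)) x" for x
    have ex: "\<exists>k. x \<in> E (n + k)" if "x \<in> ?U" for x
      using that Em by (metis UN_iff le_add2 subsetD)
    have f: "f x = c n k x" if "x \<in> E (n + k)" for x k
      unfolding f_def using cc[of x n _ k] that by (metis (mono_tags, lifting) LeastI Least_le)
    have sU: "subspace ?U" by (rule subspace_chain_Union[of E, OF sE E(2)])
    have lf: "lin_on ?U f"
      unfolding lin_on_def
    proof (intro conjI ballI allI)
      fix x assume "x \<in> ?U"
      then obtain k where k: "x \<in> E (n + k)" using ex by blast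
      show "f (a *\<^sub>R x) = a *\<^sub>R f x" for a
        using f[OF k] f[OF subspace_scale[OF sE k]] by (simp add: linear_scale[OF cl])
      fix y assume "y \<in> ?U"
      then obtain l where l: "y \<in> E (n + l)" using ex by blast
      have xy: "x \<in> E (n + max k l)" "y \<in> E (n + max k l)"
        using k l Em[of "n + k" "n + max k l"] Em[of "n + l" "n + max k l"] by auto
      then show "f (x + y) = f x + f y"
        using f[OF xy(1)] f[OF xy(2)] f[OF subspace_add[OF sE xy]] by (simp add: linear_add[OF cl])
    qed
    have "norm (f x) \<le> 1 * norm x" if "x \<in> ?U" for x using ex[OF that] f cE by auto
    from bounded_linear_extension[OF sU E(4) lf this] obtain g where
      g: "bounded_linear g" "\<And>x. x \<in> ?U \<Longrightarrow> g x = f x" "\<And>x. norm (g x) \<le> 1 * norm x" by auto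
    have gU: "g x \<in> E n" if "x \<in> ?U" for x using ex[OF that] f cE g(2)[OF that] by auto
    have "g ` closure ?U \<subseteq> closure (g ` ?U)"
      by (rule continuous_image_closure_subset[of UNIV])
        (auto intro: linear_continuous_on[OF g(1)])
    also have "\<dots> \<subseteq> E n" using gU by (intro closure_minimal fin_dim_closed[OF E(1)]) auto
    finally have "g x \<in> E n" for x using E(4) by auto
    moreover have "g x = x" if "x \<in> E n" for x
      using g(2)[of x] f[of x 0] that by (auto simp: c0)
    ultimately show ?thesis using g(1,3) by auto
  qed
  then obtain pr where pr: "\<And>n. bounded_linear (pr n)" "\<And>n x. pr n x \<in> E n"
    "\<And>n x. x \<in> E n \<Longrightarrow> pr n x = x" "\<And>n x. norm (pr n x) \<le> norm x" by metis
  have "skeleton_space E pr" by (rule skeleton_space.intro) (use E assms(2) pr in auto)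
  then show ?thesis using that by blast
qed

section \<open>Property (G) for finite dimensional spaces of any type\<close>

lemma lookup_scaleR_poly: "Poly_Mapping.lookup (r *\<^sub>R f) i = r *\<^sub>R Poly_Mapping.lookup f i"
  for f :: "'k \<Rightarrow>\<^sub>0 'b::real_vector"
proof -
  have "finite {i. r *\<^sub>R Poly_Mapping.lookup f i \<noteq> 0}"
    by (rule finite_subset[OF _ finite_lookup[of f]]) auto
  then show ?thesis by (simp add: scaleR_poly_mapping_def)
qed

text \<open>Property (G) speaks of subspaces of \<open>nat \<Rightarrow>\<^sub>0 real\<close>; a
  finite dimensional space in any other vector space is copied there by numbering a basis, and the
  left inverse \<open>\<kappa>\<close> carries norms and operators over.\<close>

lemma encode_fin_dim:
  fixes H :: "'b::real_vector set"
  assumes "fin_dim_subspace H"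
  obtains \<iota> :: "'b \<Rightarrow> (nat \<Rightarrow>\<^sub>0 real)" and \<kappa> where "linear \<iota>" "linear \<kappa>" "\<And>h. h \<in> H \<Longrightarrow> \<kappa> (\<iota> h) = h"
proof -
  obtain B where B: "finite B" "independent B" "H = span B" using fin_dim_basis[OF assms] .
  obtain b where b: "bij_betw b {0..<card B} B" using ex_bij_betw_nat_finite[OF B(1)] by blast
  define idx where "idx = inv_into {0..<card B} b"
  have idx: "idx x < card B" "b (idx x) = x" if "x \<in> B" for x
    using that b bij_betw_inv_into[OF b] by (auto simp: idx_def bij_betw_inv_into_right[OF b] bij_betw_def)
  define \<kappa> where "\<kappa> f = (\<Sum>i<card B. Poly_Mapping.lookup f i *\<^sub>R b i)" for f :: "nat \<Rightarrow>\<^sub>0 real"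
  have l\<kappa>: "linear \<kappa>"
    by (rule linearI) (simp_all add: \<kappa>_def lookup_add lookup_scaleR_poly scaleR_add_left sum.distrib scaleR_sum_right)
  obtain \<iota> where \<iota>: "linear \<iota>" "\<And>x. x \<in> B \<Longrightarrow> \<iota> x = Poly_Mapping.single (idx x) (1::real)"
    using linear_independent_extend[OF B(2), of "\<lambda>x. Poly_Mapping.single (idx x) (1::real)"] by blast
  have "\<kappa> (\<iota> x) = x" if "x \<in> B" for x
  proof -
    have "\<kappa> (\<iota> x) = (\<Sum>i<card B. (if i = idx x then b i else 0))"
      unfolding \<kappa>_def \<iota>(2)[OF that] by (intro sum.cong refl) (auto simp: lookup_single when_def)
    also have "\<dots> = x" using idx[OF that] by simp
    finally show ?thesis .
  qed
  then have *: "(\<kappa> \<circ> \<iota>) h = id h" if "h \<in> H" for h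
    using that B(3) by - (rule linear_eq_on[OF linear_compose[OF \<iota>(1) l\<kappa>] linear_id, of _ B], auto)
  show ?thesis
  proof (rule that[OF \<iota>(1) l\<kappa>])
    show "\<kappa> (\<iota> h) = h" if "h \<in> H" for h using *[OF that] by simp
  qed
qed

context skeleton_space
begin

text \<open>
  Property (G) provides \<open>w\<close> with values in the whole space; composing it with \<open>pr m\<close> for a
  large \<open>m\<close> moves its range into the skeleton without changing it on \<open>E n\<close>, at the price of
  correcting the projection by the inverse of an operator close to the identity.
\<close>

lemma extension:
  fixes H :: "'b::real_vector set"
  assumes H: "fin_dim_subspace H" and p: "norm_on H p" and v: "linear v" "v ` E n \<subseteq> H"
    and viso: "\<And>x. x \<in> E n \<Longrightarrow> p (v x) = norm x"
    and compl: "complemented_in 1 H p (v ` E n)" and \<epsilon>: "0 < \<epsilon>"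
  obtains m \<psi> R where "n \<le> m" "linear \<psi>" "linear R" "\<psi> ` H \<subseteq> E m" "\<And>x. R x \<in> H"
    "\<And>h. h \<in> H \<Longrightarrow> R (\<psi> h) = h" "\<And>h. h \<in> H \<Longrightarrow> norm (\<psi> h) \<le> (1 + \<epsilon>) * p h"
    "\<And>x. p (R x) \<le> (1 + \<epsilon>) * norm x" "\<And>x. x \<in> E n \<Longrightarrow> \<psi> (v x) = x"
proof -
  obtain \<iota> :: "'b \<Rightarrow> (nat \<Rightarrow>\<^sub>0 real)" and \<kappa> where \<iota>: "linear \<iota>" and \<kappa>: "linear \<kappa>"
    and \<kappa>\<iota>: "\<And>h. h \<in> H \<Longrightarrow> \<kappa> (\<iota> h) = h"
    using encode_fin_dim[OF H] by blast
  note sn = seminorm_onD[OF norm_on_seminorm[OF p]]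
  have sH: "subspace H" by (rule sn)
  obtain vi where vi: "linear vi" "\<And>x. x \<in> E n \<Longrightarrow> vi (v x) = x"
  proof -
    have "inj_on v (E n)"
    proof (subst linear_inj_on_iff_eq_0[OF v(1) E_subspace], intro ballI impI)
      fix x assume "x \<in> E n" "v x = 0"
      then show "x = 0" using viso[of x] sn(4) by simp
    qed
    then show thesis using linear_exists_left_inverse_on[OF v(1) E_subspace] that by blast
  qed
  define F where "F = \<iota> ` H"
  define EE where "EE = \<iota> ` v ` E n"
  have EEF: "EE \<subseteq> F" using v(2) by (auto simp: EE_def F_def)
  have fdF: "fin_dim_subspace F" unfolding F_def by (rule fin_dim_image[OF \<iota> H])
  have fdE: "fin_dim_subspace EE" unfolding EE_def by (intro fin_dim_image \<iota> v fd)
  have \<iota>0: "x = 0" if "x \<in> H" "\<iota> x = 0" for x using \<kappa>\<iota>[OF that(1)] that(2) linear_0[OF \<kappa>] by simp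
  have nF: "norm_on F (p \<circ> \<kappa>)"
    using p fin_dim_subspace_subspace[OF fdF] sH unfolding norm_on_def F_def
    by (auto simp: \<kappa>\<iota> linear_add[OF \<kappa>] linear_scale[OF \<kappa>] linear_0[OF \<iota>] subspace_add subspace_scale dest: \<iota>0)
  have nE: "norm_on EE (p \<circ> \<kappa>)" by (rule norm_on_subset[OF nF fin_dim_subspace_subspace[OF fdE] EEF])
  \<comment> \<open>\<open>u\<close> undoes the copy and then \<open>v\<close>, so it maps the copy
    of the image of \<open>E n\<close> isometrically onto \<open>E n\<close>. Property (G) is
    applied to \<open>u\<close> and to the inclusion of that copy into the copy of
    \<open>H\<close>.\<close>
  define u where "u = vi \<circ> \<kappa>"
  have uE: "u (\<iota> (v x)) = x" if "x \<in> E n" for x using that v(2) vi(2) by (auto simp: u_def \<kappa>\<iota>)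
  have u1: "isometric_embedding EE (p \<circ> \<kappa>) UNIV norm u"
    unfolding isometric_embedding_def
    using uE viso v(2) by (auto simp: EE_def \<kappa>\<iota> u_def linear_compose \<kappa> vi(1) image_subset_iff)
  have uim: "u ` EE = E n" unfolding EE_def image_image using uE by auto
  have u2: "complemented_in 1 UNIV norm (u ` EE)"
    unfolding complemented_in_def uim
    using pr_linear pr_range pr_in pr_id pr_norm by (intro conjI exI[of _ "pr n"]) auto
  obtain P where P: "linear P" "P ` H = v ` E n" "\<And>x. x \<in> H \<Longrightarrow> P (P x) = P x" "\<And>x. x \<in> H \<Longrightarrow> p (P x) \<le> p x"
    using compl unfolding complemented_in_def by auto
  have PH: "P x \<in> H" if "x \<in> H" for x using that P(2) v(2) by blast
  have v1: "isometric_embedding EE (p \<circ> \<kappa>) F (p \<circ> \<kappa>) id"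
    using EEF by (auto simp: isometric_embedding_def linear_id)
  have v2: "complemented_in 1 F (p \<circ> \<kappa>) (id ` EE)"
    unfolding complemented_in_def
  proof (intro conjI exI[of _ "\<iota> \<circ> P \<circ> \<kappa>"])
    show "id ` EE \<subseteq> F" using EEF by simp
    show "linear (\<iota> \<circ> P \<circ> \<kappa>)" by (intro linear_compose \<kappa> \<iota> P)
    have "(\<iota> \<circ> P \<circ> \<kappa>) ` F = \<iota> ` P ` H" unfolding F_def image_image by (intro image_cong refl) (simp add: \<kappa>\<iota>)
    then show "(\<iota> \<circ> P \<circ> \<kappa>) ` F = id ` EE" by (simp add: P(2) EE_def)
    show "\<forall>x\<in>F. (\<iota> \<circ> P \<circ> \<kappa>) ((\<iota> \<circ> P \<circ> \<kappa>) x) = (\<iota> \<circ> P \<circ> \<kappa>) x"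
      by (auto simp: F_def \<kappa>\<iota> PH P(3))
    show "\<forall>x\<in>F. (p \<circ> \<kappa>) ((\<iota> \<circ> P \<circ> \<kappa>) x) \<le> 1 * (p \<circ> \<kappa>) x"
      by (auto simp: F_def \<kappa>\<iota> PH P(4))
  qed
  \<comment> \<open>Two factors \<open>1 + \<delta>\<close> cost at most
    \<open>3 * \<epsilon> / 4\<close>; the remaining quarter pays for the inverse of the operator
    close to the identity.\<close>
  define \<delta> where "\<delta> = min 1 (\<epsilon> / 4)"
  have \<delta>: "0 < \<delta>" "\<delta> \<le> 1" "\<delta> \<le> \<epsilon> / 4" using \<epsilon> by (auto simp: \<delta>_def)
  have \<delta>2: "(1 + \<delta>)\<^sup>2 \<le> 1 + 3 * \<epsilon> / 4" "(1 + \<delta>)\<^sup>2 \<le> 4"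
  proof -
    have "\<delta> * \<delta> \<le> 1 * \<delta>" using \<delta> by (intro mult_right_mono) auto
    moreover have "(1 + \<delta>)\<^sup>2 = 1 + 2 * \<delta> + \<delta> * \<delta>" by (simp add: power2_eq_square algebra_simps)
    ultimately show "(1 + \<delta>)\<^sup>2 \<le> 1 + 3 * \<epsilon> / 4" "(1 + \<delta>)\<^sup>2 \<le> 4"
      using \<delta> by linarith+
  qed
  obtain w where w: "eps_isometry \<delta> F (p \<circ> \<kappa>) UNIV norm w"
    "complemented_in (1 + \<delta>) UNIV norm (w ` F)" "\<And>x. x \<in> EE \<Longrightarrow> u x = w x"
    using property_G[unfolded property_G_def, rule_format, of EE "p \<circ> \<kappa>" F "p \<circ> \<kappa>" u id \<delta>]
      fdE fdF nE nF u1 u2 v1 v2 \<delta>(1) unfolding fin_dim_banach_def by auto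
  have lw: "linear w" and wlo: "\<And>f. f \<in> F \<Longrightarrow> p (\<kappa> f) \<le> (1 + \<delta>) * norm (w f)"
    and whi: "\<And>f. f \<in> F \<Longrightarrow> norm (w f) \<le> (1 + \<delta>) * p (\<kappa> f)"
    using w(1) \<delta>(1) unfolding eps_isometry_def by (auto simp: field_simps)
  have wv: "w (\<iota> (v x)) = x" if "x \<in> E n" for x
    using w(3)[of "\<iota> (v x)"] uE[OF that] that by (auto simp: EE_def)
  obtain wi where wi: "linear wi" "\<And>f. f \<in> F \<Longrightarrow> wi (w f) = f" "range wi \<subseteq> F"
  proof -
    have "inj_on w F"
    proof (subst linear_inj_on_iff_eq_0[OF lw fin_dim_subspace_subspace[OF fdF]], intro ballI impI)
      fix f assume f: "f \<in> F" "w f = 0"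
      then have "p (\<kappa> f) \<le> 0" using wlo[OF f(1)] by simp
      then have "(p \<circ> \<kappa>) f = 0" using nF f(1) by (simp add: norm_on_def) (metis order_antisym)
      then show "f = 0" using norm_on_zero[OF nF f(1)] by simp
    qed
    then show thesis
      using linear_exists_left_inverse_on[OF lw fin_dim_subspace_subspace[OF fdF]] that by blast
  qed
  obtain Q where Q: "linear Q" "range Q = w ` F" "\<And>x. Q (Q x) = Q x" "\<And>x. norm (Q x) \<le> (1 + \<delta>) * norm x"
    using w(2) unfolding complemented_in_def by auto
  \<comment> \<open>An almost contractive left inverse of \<open>w \<circ> \<iota>\<close>: project
    onto the range of \<open>w\<close>, invert \<open>w\<close>, and decode.\<close>
  define R0 where "R0 = \<kappa> \<circ> wi \<circ> Q"
  have lR0: "linear R0" unfolding R0_def by (intro linear_compose \<kappa> wi Q)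
  have R0H: "R0 x \<in> H" for x
  proof -
    have "wi (Q x) \<in> F" using wi(3) by blast
    then show ?thesis by (auto simp: R0_def F_def \<kappa>\<iota>)
  qed
  have R0w: "R0 (w (\<iota> h)) = h" if "h \<in> H" for h
  proof -
    have "w (\<iota> h) \<in> range Q" using that Q(2) by (auto simp: F_def)
    then have "Q (w (\<iota> h)) = w (\<iota> h)" using Q(3) by auto
    then show ?thesis using that wi(2) by (simp add: R0_def F_def \<kappa>\<iota>)
  qed
  have R0n: "p (R0 x) \<le> (1 + \<delta>)\<^sup>2 * norm x" for x
  proof -
    obtain f where f: "f \<in> F" "Q x = w f" using Q(2) by blast
    have "p (R0 x) = p (\<kappa> f)" by (simp add: R0_def f wi(2))
    also have "\<dots> \<le> (1 + \<delta>) * norm (Q x)" using wlo[OF f(1)] f(2) by simp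
    also have "\<dots> \<le> (1 + \<delta>) * ((1 + \<delta>) * norm x)" using Q(4) \<delta> by (intro mult_left_mono) auto
    finally show ?thesis by (simp add: power2_eq_square mult.assoc)
  qed
  \<comment> \<open>Chosen so that \<open>(1 - \<theta>) * (1 + \<epsilon>)\<close> equals
    \<open>1 + 3 * \<epsilon> / 4\<close>, the available bound for the square of
    \<open>1 + \<delta>\<close>.\<close>
  define \<theta> where "\<theta> = \<epsilon> / (4 * (1 + \<epsilon>))"
  have \<theta>: "0 < \<theta>" "\<theta> < 1" using \<epsilon> by (auto simp: \<theta>_def field_simps)
  have \<theta>2: "(1 - \<theta>) * (1 + \<epsilon>) = 1 + 3 * \<epsilon> / 4" using \<epsilon> by (simp add: \<theta>_def field_simps)
  define L where "L m h = pr m (w (\<iota> h)) - w (\<iota> h)" for m h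
  have lL: "linear (L m)" for m
    unfolding L_def using linear_compose_sub[OF linear_compose[OF linear_compose[OF \<iota> lw] pr_linear[of m]] linear_compose[OF \<iota> lw]]
    by (simp add: o_def)
  have "(\<lambda>m. L m h) \<longlonglongrightarrow> 0" for h
    unfolding L_def using LIM_zero[OF pr_tendsto] .
  from pointwise_null_imp_uniformly_small[OF H p lL this, of "\<theta> / 4"] \<theta>
  have "\<forall>\<^sub>F m in sequentially. \<forall>h\<in>H. norm (L m h) \<le> \<theta> / 4 * p h" by simp
  then obtain M where M: "\<And>m h. m \<ge> M \<Longrightarrow> h \<in> H \<Longrightarrow> norm (L m h) \<le> \<theta> / 4 * p h"
    unfolding eventually_sequentially by blast
  define m where "m = max M n"
  define \<psi> where "\<psi> = pr m \<circ> w \<circ> \<iota>"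
  have l\<psi>: "linear \<psi>" unfolding \<psi>_def by (intro linear_compose pr_linear lw \<iota>)
  define S where "S = R0 \<circ> \<psi>"
  have lS: "linear S" unfolding S_def by (intro linear_compose l\<psi> lR0)
  have SH: "S ` H \<subseteq> H" using R0H by (auto simp: S_def)
  have near: "p (S h - h) \<le> \<theta> * p h" if h: "h \<in> H" for h
  proof -
    have "S h - h = R0 (L m h)" using R0w[OF h] by (simp add: S_def \<psi>_def L_def linear_diff[OF lR0])
    then have "p (S h - h) \<le> (1 + \<delta>)\<^sup>2 * norm (L m h)" using R0n by simp
    also have "\<dots> \<le> 4 * (\<theta> / 4 * p h)" using \<delta>2 M[OF _ h, of m] by (intro mult_mono) (auto simp: m_def)
    finally show ?thesis by simp
  qed
  obtain S' where S': "linear S'" "range S' \<subseteq> H" "\<And>f. f \<in> H \<Longrightarrow> S' (S f) = f"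
    "\<And>f. f \<in> H \<Longrightarrow> (1 - \<theta>) * p (S' f) \<le> p f"
    by (rule near_identity_inverse[OF H p lS SH, of \<theta>]) (use near \<theta>(2) in auto)
  show ?thesis
  proof
    show "n \<le> m" by (simp add: m_def)
    show "linear \<psi>" by fact
    show "linear (S' \<circ> R0)" by (intro linear_compose S' lR0)
    show "\<psi> ` H \<subseteq> E m" using pr_in by (auto simp: \<psi>_def)
    show "(S' \<circ> R0) x \<in> H" for x using S'(2) by auto
    show "(S' \<circ> R0) (\<psi> h) = h" if "h \<in> H" for h using S'(3)[OF that] by (simp add: S_def)
    show "norm (\<psi> h) \<le> (1 + \<epsilon>) * p h" if "h \<in> H" for h
    proof -
      have "norm (\<psi> h) \<le> norm (w (\<iota> h))" using pr_norm by (simp add: \<psi>_def)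
      also have "\<dots> \<le> (1 + \<delta>) * p h" using whi[of "\<iota> h"] that by (simp add: F_def \<kappa>\<iota>)
      also have "\<dots> \<le> (1 + \<epsilon>) * p h" using \<delta> \<epsilon> sn(6)[OF that] by (intro mult_right_mono) auto
      finally show ?thesis .
    qed
    show "p ((S' \<circ> R0) x) \<le> (1 + \<epsilon>) * norm x" for x
    proof -
      have "(1 - \<theta>) * p (S' (R0 x)) \<le> (1 + \<delta>)\<^sup>2 * norm x" using S'(4)[OF R0H] R0n by (rule order_trans)
      also have "\<dots> \<le> (1 - \<theta>) * (1 + \<epsilon>) * norm x" unfolding \<theta>2 by (intro mult_right_mono \<delta>2) auto
      finally show ?thesis using \<theta>(2) by (simp add: mult.assoc)
    qed
    show "\<psi> (v x) = x" if "x \<in> E n" for x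
    proof -
      have "x \<in> E m" using that E_mono[of n m] by (auto simp: m_def)
      then show ?thesis using wv[OF that] pr_id by (simp add: \<psi>_def)
    qed
  qed
qed

end

section \<open>Amalgams\<close>

text \<open>An infimal convolution: \<open>z\<close> is the sum of
  \<open>(fst z - \<alpha> c, 0)\<close>, \<open>(0, snd z + \<beta> c)\<close> and
  \<open>(\<alpha> c, - \<beta> c)\<close>, and the pieces cost \<open>M\<close>, \<open>N\<close>
  and \<open>\<gamma> c\<close>. The same formula serves for amalgams and for extending a norm from
  a dense range.\<close>

definition inf_gauge ::
  "'c set \<Rightarrow> ('c \<Rightarrow> real) \<Rightarrow> ('c \<Rightarrow> 'a::real_vector) \<Rightarrow> ('a \<Rightarrow> real) \<Rightarrow> ('c \<Rightarrow> 'b::real_vector) \<Rightarrow> ('b \<Rightarrow> real)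
    \<Rightarrow> 'a \<times> 'b \<Rightarrow> real" where
  "inf_gauge C \<gamma> \<alpha> M \<beta> N z = (INF c\<in>C. M (fst z - \<alpha> c) + N (snd z + \<beta> c) + \<gamma> c)"

lemma inf_gauge_facts:
  fixes \<alpha> :: "'c::real_vector \<Rightarrow> 'a::real_vector" and \<beta> :: "'c \<Rightarrow> 'b::real_vector"
  assumes M: "seminorm_on A M" and N: "seminorm_on B N" and \<gamma>: "seminorm_on C \<gamma>"
    and \<alpha>: "linear \<alpha>" "\<alpha> ` C \<subseteq> A" and \<beta>: "linear \<beta>" "\<beta> ` C \<subseteq> B"
  shows "seminorm_on (A \<times> B) (inf_gauge C \<gamma> \<alpha> M \<beta> N)"
    and "\<And>z c. z \<in> A \<times> B \<Longrightarrow> c \<in> C \<Longrightarrow>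
      inf_gauge C \<gamma> \<alpha> M \<beta> N z \<le> M (fst z - \<alpha> c) + N (snd z + \<beta> c) + \<gamma> c"
    and "\<And>z k. (\<And>c. c \<in> C \<Longrightarrow> k \<le> M (fst z - \<alpha> c) + N (snd z + \<beta> c) + \<gamma> c) \<Longrightarrow>
      k \<le> inf_gauge C \<gamma> \<alpha> M \<beta> N z"
proof -
  note m = seminorm_onD[OF M] and n = seminorm_onD[OF N] and g = seminorm_onD[OF \<gamma>]
  define t where "t z c = M (fst z - \<alpha> c) + N (snd z + \<beta> c) + \<gamma> c" for z c
  let ?p = "inf_gauge C \<gamma> \<alpha> M \<beta> N"
  have p: "?p z = (INF c\<in>C. t z c)" for z by (simp add: inf_gauge_def t_def)
  have C0: "0 \<in> C" using subspace_0[OF g(1)] .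
  have mem: "fst z - \<alpha> c \<in> A" "snd z + \<beta> c \<in> B" if "z \<in> A \<times> B" "c \<in> C" for z c
    using that \<alpha>(2) \<beta>(2) by (auto intro!: subspace_diff[OF m(1)] subspace_add[OF n(1)])
  have t0: "0 \<le> t z c" if "z \<in> A \<times> B" "c \<in> C" for z c
    unfolding t_def using m(6) n(6) g(6) mem[OF that] that by (meson add_nonneg_nonneg)
  have bdd: "bdd_below (t z ` C)" if "z \<in> A \<times> B" for z
    using t0[OF that] by (auto simp: bdd_below_def)
  have le: "?p z \<le> t z c" if "z \<in> A \<times> B" "c \<in> C" for z c
    unfolding p using bdd[OF that(1)] that(2) by (rule cINF_lower)
  have ge: "k \<le> ?p z" if "\<And>c. c \<in> C \<Longrightarrow> k \<le> t z c" for z k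
    unfolding p using that C0 by (intro cINF_greatest) auto
  show "?p z \<le> M (fst z - \<alpha> c) + N (snd z + \<beta> c) + \<gamma> c" if "z \<in> A \<times> B" "c \<in> C" for z c
    using le[OF that] by (simp add: t_def)
  show "k \<le> ?p z" if "\<And>c. c \<in> C \<Longrightarrow> k \<le> M (fst z - \<alpha> c) + N (snd z + \<beta> c) + \<gamma> c" for z k
    using ge that by (simp add: t_def)
  have sub: "subspace (A \<times> B)" by (intro subspace_Times m n)
  have tscale: "t (a *\<^sub>R z) (a *\<^sub>R c) = \<bar>a\<bar> * t z c" if "z \<in> A \<times> B" "c \<in> C" for a z c
  proof -
    have "M (a *\<^sub>R (fst z - \<alpha> c)) = \<bar>a\<bar> * M (fst z - \<alpha> c)" "N (a *\<^sub>R (snd z + \<beta> c)) = \<bar>a\<bar> * N (snd z + \<beta> c)"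
      using m(2) n(2) mem[OF that] by auto
    then show ?thesis using g(2)[OF that(2), of a]
      by (simp add: t_def linear_scale[OF \<alpha>(1)] linear_scale[OF \<beta>(1)] scaleR_diff_right scaleR_add_right distrib_left)
  qed
  have half: "?p (a *\<^sub>R z) \<le> \<bar>a\<bar> * ?p z" if z: "z \<in> A \<times> B" and a: "a \<noteq> 0" for a z
  proof -
    have "?p (a *\<^sub>R z) / \<bar>a\<bar> \<le> t z c" if c: "c \<in> C" for c
      using le[OF subspace_scale[OF sub z] subspace_scale[OF g(1) c], of a a] tscale[OF z c, of a] a
      by (simp add: field_simps)
    from ge[OF this] show ?thesis using a by (simp add: field_simps)
  qed
  have scale: "?p (a *\<^sub>R z) = \<bar>a\<bar> * ?p z" if z: "z \<in> A \<times> B" for a z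
  proof (cases "a = 0")
    case True
    have "?p 0 \<le> t 0 0" using le[of 0 0] C0 subspace_0[OF sub] by simp
    also have "t 0 0 = 0" using m(4) n(4) g(4) by (simp add: t_def linear_0[OF \<alpha>(1)] linear_0[OF \<beta>(1)])
    finally have "?p 0 \<le> 0" .
    moreover have "0 \<le> ?p 0" using t0 subspace_0[OF sub] by (intro ge) auto
    ultimately show ?thesis using True by simp
  next
    case False
    have "?p z \<le> \<bar>inverse a\<bar> * ?p (a *\<^sub>R z)"
      using half[OF subspace_scale[OF sub z, of a], of "inverse a"] False by simp
    then have "\<bar>a\<bar> * ?p z \<le> ?p (a *\<^sub>R z)" using False by (simp add: field_simps)
    then show ?thesis using half[OF z False] by simp
  qed
  have tri: "?p (z + z') \<le> ?p z + ?p z'" if z: "z \<in> A \<times> B" and z': "z' \<in> A \<times> B" for z z'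
  proof -
    have t: "?p (z + z') \<le> t z c + t z' c'" if c: "c \<in> C" "c' \<in> C" for c c'
    proof -
      have "?p (z + z') \<le> t (z + z') (c + c')"
        using c z z' by (intro le subspace_add[OF sub] subspace_add[OF g(1)])
      also have "fst (z + z') - \<alpha> (c + c') = (fst z - \<alpha> c) + (fst z' - \<alpha> c')"
        by (simp add: linear_add[OF \<alpha>(1)])
      then have "t (z + z') (c + c') = M ((fst z - \<alpha> c) + (fst z' - \<alpha> c')) + N ((snd z + \<beta> c) + (snd z' + \<beta> c')) + \<gamma> (c + c')"
        by (simp add: t_def linear_add[OF \<beta>(1)] algebra_simps)
      also have "\<dots> \<le> t z c + t z' c'"
        using m(3)[OF mem(1)[OF z c(1)] mem(1)[OF z' c(2)]] n(3)[OF mem(2)[OF z c(1)] mem(2)[OF z' c(2)]] g(3)[OF c]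
        by (simp add: t_def)
      finally show ?thesis .
    qed
    have "?p (z + z') - t z c \<le> ?p z'" if "c \<in> C" for c
      using t[OF that] by (intro ge) (simp add: algebra_simps)
    then have "?p (z + z') - ?p z' \<le> ?p z" by (intro ge) (simp add: algebra_simps)
    then show ?thesis by simp
  qed
  show "seminorm_on (A \<times> B) ?p" unfolding seminorm_on_def using sub scale tri by blast
qed

lemma fin_dim_Times:
  fixes A :: "'a::real_vector set" and B :: "'b::real_vector set"
  assumes "fin_dim_subspace A" "fin_dim_subspace B"
  shows "fin_dim_subspace (A \<times> B)"
proof -
  obtain SA SB where S: "finite SA" "A = span SA" "finite SB" "B = span SB"
    using assms by (auto simp: fin_dim_subspace_def)
  let ?S = "(\<lambda>a. (a, 0)) ` SA \<union> (\<lambda>b. (0, b)) ` SB"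
  have la: "linear (\<lambda>a::'a. (a, 0::'b))" and lb: "linear (\<lambda>b::'b. (0::'a, b))"
    by (auto intro!: linearI)
  have e1: "span ((\<lambda>a::'a. (a, 0::'b)) ` SA) = (\<lambda>a. (a, 0)) ` A"
    using linear_span_image[OF la, of SA] S by simp
  have e2: "span ((\<lambda>b::'b. (0::'a, b)) ` SB) = (\<lambda>b. (0, b)) ` B"
    using linear_span_image[OF lb, of SB] S by simp
  have "A \<times> B \<subseteq> span ?S"
  proof
    fix z assume "z \<in> A \<times> B"
    then obtain a b where z: "z = (a, b)" "a \<in> A" "b \<in> B" by auto
    have "(a, 0::'b) \<in> span ((\<lambda>a. (a, 0)) ` SA)" "(0::'a, b) \<in> span ((\<lambda>b. (0, b)) ` SB)"
      using z e1 e2 by auto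
    then have "(a, 0) \<in> span ?S" "(0, b) \<in> span ?S"
      by (meson Un_upper1 Un_upper2 span_mono subsetD)+
    then have "(a, 0) + (0, b) \<in> span ?S" by (rule span_add)
    then show "z \<in> span ?S" by (simp add: z)
  qed
  moreover have "span ?S \<subseteq> A \<times> B"
    using S by (intro span_minimal subspace_Times) (auto simp: span_base span_zero)
  ultimately have "A \<times> B = span ?S" by blast
  then show ?thesis unfolding fin_dim_subspace_def using S by (intro exI[of _ ?S]) auto
qed

context skeleton_space
begin

text \<open>
  The space \<open>E n \<times> F\<close> is normed by the gauge of the convex hull of the unit balls of \<open>E n\<close> and
  \<open>F\<close> and of the vectors \<open>(\<alpha> c, - \<beta> c)\<close> with \<open>\<gamma> c \<le> 1\<close>. Both factors remain isometric and
  \<open>1\<close>-complemented, while \<open>\<alpha> c\<close> and \<open>\<beta> c\<close> become \<open>\<gamma> c\<close>-close.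
\<close>

lemma amalgam:
  fixes \<alpha> :: "'c::real_vector \<Rightarrow> 'a" and \<beta> :: "'c \<Rightarrow> 'b::real_vector"
  assumes F: "fin_dim_subspace F" and N: "norm_on F N" and \<gamma>: "seminorm_on C \<gamma>"
    and \<alpha>: "linear \<alpha>" "\<alpha> ` C \<subseteq> E n" and \<beta>: "linear \<beta>" "\<beta> ` C \<subseteq> F"
    and \<rho>: "linear \<rho>" "\<And>f. f \<in> F \<Longrightarrow> \<rho> f \<in> E n" "\<And>f. f \<in> F \<Longrightarrow> norm (\<rho> f) \<le> N f"
    and \<tau>: "linear \<tau>" "\<And>e. e \<in> E n \<Longrightarrow> \<tau> e \<in> F" "\<And>e. e \<in> E n \<Longrightarrow> N (\<tau> e) \<le> norm e"
    and h1: "\<And>c. c \<in> C \<Longrightarrow> norm (\<alpha> c) \<le> N (\<beta> c) + \<gamma> c"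
    and h2: "\<And>c. c \<in> C \<Longrightarrow> norm (\<alpha> c - \<rho> (\<beta> c)) \<le> \<gamma> c"
    and h3: "\<And>c. c \<in> C \<Longrightarrow> N (\<tau> (\<alpha> c) - \<beta> c) \<le> \<gamma> c"
    and h4: "\<And>c. c \<in> C \<Longrightarrow> norm (\<alpha> c) \<le> K * \<gamma> c" "\<And>c. c \<in> C \<Longrightarrow> N (\<beta> c) \<le> K * \<gamma> c"
    and \<epsilon>: "0 < \<epsilon>"
  obtains m \<psi> \<sigma> where "n \<le> m" "linear \<psi>" "linear \<sigma>" "\<And>f. f \<in> F \<Longrightarrow> \<psi> f \<in> E m" "\<And>x. \<sigma> x \<in> F"
    "\<And>f. f \<in> F \<Longrightarrow> \<sigma> (\<psi> f) = f" "\<And>f. f \<in> F \<Longrightarrow> norm (\<psi> f) \<le> (1 + \<epsilon>) * N f"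
    "\<And>x. N (\<sigma> x) \<le> (1 + \<epsilon>) * norm x" "\<And>c. c \<in> C \<Longrightarrow> norm (\<psi> (\<beta> c) - \<alpha> c) \<le> (1 + \<epsilon>) * \<gamma> c"
    "\<And>e. e \<in> E n \<Longrightarrow> \<sigma> e = \<tau> e"
proof -
  note s = seminorm_onD[OF norm_on_seminorm[OF N]] and g = seminorm_onD[OF \<gamma>]
  have sE: "subspace (E n)" and sF: "subspace F" using E_subspace s(1) by auto
  have nE: "norm_on (E n) norm" by (rule norm_on_norm[OF sE])
  define p where "p = inf_gauge C \<gamma> \<alpha> norm \<beta> N"
  note ig = inf_gauge_facts[OF norm_on_seminorm[OF nE] norm_on_seminorm[OF N] \<gamma> \<alpha> \<beta>, folded p_def]
  have C0: "0 \<in> C" using subspace_0[OF g(1)] .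
  have ige: "k \<le> p (e, f)" if "\<And>c. c \<in> C \<Longrightarrow> k \<le> norm (e - \<alpha> c) + N (f + \<beta> c) + \<gamma> c" for e f k
    using ig(3)[of k "(e, f)"] that by simp
  have ile: "p (e, f) \<le> norm (e - \<alpha> c) + N (f + \<beta> c) + \<gamma> c" if "e \<in> E n" "f \<in> F" "c \<in> C" for e f c
    using ig(2)[of "(e, f)" c] that by simp
  have \<beta>F: "\<beta> c \<in> F" and \<alpha>E: "\<alpha> c \<in> E n" and \<gamma>0: "0 \<le> \<gamma> c" if "c \<in> C" for c
    using that \<alpha>(2) \<beta>(2) g(6) by auto
  have N0: "0 \<le> N f" if "f \<in> F" for f using s(6) that .
  \<comment> \<open>Definiteness rests on \<open>h4\<close>: since \<open>\<alpha> c\<close> and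
    \<open>\<beta> c\<close> are at most \<open>K * \<gamma> c\<close>, a cheap \<open>c\<close>
    moves neither component far.\<close>
  have p_norm: "norm_on (E n \<times> F) p"
  proof -
    define K' where "K' = 1 + \<bar>K\<bar>"
    have K': "K' > 0" by (simp add: K'_def)
    have KK: "x + K * y \<le> K' * (x + z + y)" "x + K * y \<le> K' * (z + x + y)" if "0 \<le> x" "0 \<le> y" "0 \<le> z" for x y z :: real
    proof -
      have "K * y \<le> \<bar>K\<bar> * y" using that by (intro mult_right_mono) auto
      moreover have "0 \<le> \<bar>K\<bar> * x" "0 \<le> \<bar>K\<bar> * z" using that by auto
      ultimately have "x + K * y \<le> (x + z + y) + (\<bar>K\<bar> * x + \<bar>K\<bar> * z + \<bar>K\<bar> * y)"
        using that by linarith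
      moreover have "K' * (x + z + y) = (x + z + y) + (\<bar>K\<bar> * x + \<bar>K\<bar> * z + \<bar>K\<bar> * y)"
        "K' * (z + x + y) = (x + z + y) + (\<bar>K\<bar> * x + \<bar>K\<bar> * z + \<bar>K\<bar> * y)"
        by (simp_all add: K'_def algebra_simps)
      ultimately show "x + K * y \<le> K' * (x + z + y)" "x + K * y \<le> K' * (z + x + y)"
        by simp_all
    qed
    have e: "norm e \<le> K' * p (e, f)" and f: "N f \<le> K' * p (e, f)" if ef: "e \<in> E n" "f \<in> F" for e f
    proof -
      have "norm e / K' \<le> norm (e - \<alpha> c) + N (f + \<beta> c) + \<gamma> c" if c: "c \<in> C" for c
      proof -
        have "norm e \<le> norm (e - \<alpha> c) + K * \<gamma> c" using norm_triangle_sub[of e "\<alpha> c"] h4(1)[OF c] by linarith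
        also have "\<dots> \<le> K' * (norm (e - \<alpha> c) + N (f + \<beta> c) + \<gamma> c)"
          by (intro KK \<gamma>0 c N0 subspace_add[OF sF] ef \<beta>F) auto
        finally show ?thesis using K' by (simp add: field_simps)
      qed
      from ige[OF this] show "norm e \<le> K' * p (e, f)" using K' by (simp add: field_simps)
      have "N f / K' \<le> norm (e - \<alpha> c) + N (f + \<beta> c) + \<gamma> c" if c: "c \<in> C" for c
      proof -
        have "N f \<le> N (f + \<beta> c) + K * \<gamma> c"
          using s(7)[OF subspace_add[OF sF ef(2) \<beta>F[OF c]] \<beta>F[OF c]] h4(2)[OF c] by simp
        also have "\<dots> \<le> K' * (norm (e - \<alpha> c) + N (f + \<beta> c) + \<gamma> c)"
          by (intro KK \<gamma>0 c N0 subspace_add[OF sF] ef \<beta>F) auto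
        finally show ?thesis using K' by (simp add: field_simps)
      qed
      from ige[OF this] show "N f \<le> K' * p (e, f)" using K' by (simp add: field_simps)
    qed
    have zero: "z = 0" if z: "z \<in> E n \<times> F" "p z = 0" for z
    proof -
      obtain e' f' where z': "z = (e', f')" "e' \<in> E n" "f' \<in> F" using z(1) by auto
      have "e' = 0" using e[OF z'(2,3)] z z'(1) by simp
      moreover have "f' = 0" using f[OF z'(2,3)] z z' N0[OF z'(3)] norm_on_zero[OF N z'(3)] by simp
      ultimately show ?thesis by (simp add: z' zero_prod_def)
    qed
    note sp = seminorm_onD[OF ig(1)]
    show ?thesis unfolding norm_on_def using sp zero by metis
  qed
  \<comment> \<open>By \<open>h1\<close>, passing through some \<open>c\<close> never makes a vector
    of the first factor cheaper.\<close>
  have pe: "p (e, 0) = norm e" if e: "e \<in> E n" for e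
  proof (rule antisym)
    show "p (e, 0) \<le> norm e"
      using ile[OF e subspace_0[OF sF] C0] s(4) g(4) by (simp add: linear_0[OF \<alpha>(1)] linear_0[OF \<beta>(1)])
    show "norm e \<le> p (e, 0)"
    proof (rule ige)
      fix c assume c: "c \<in> C"
      show "norm e \<le> norm (e - \<alpha> c) + N (0 + \<beta> c) + \<gamma> c"
        using norm_triangle_sub[of e "\<alpha> c"] h1[OF c] by simp
    qed
  qed
  have pf: "p (0, f) \<le> N f" if f: "f \<in> F" for f
    using ile[OF subspace_0[OF sE] f C0] s(4) g(4) by (simp add: linear_0[OF \<alpha>(1)] linear_0[OF \<beta>(1)])
  define v where "v e = (e, 0::'b)" for e :: 'a
  have lv: "linear v" by (rule linearI) (auto simp: v_def)
  have vH: "v ` E n \<subseteq> E n \<times> F" using subspace_0[OF sF] by (auto simp: v_def)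
  \<comment> \<open>The projection onto the first factor adds \<open>\<rho>\<close> of the second
    component; \<open>h2\<close> bounds its failure to map \<open>\<beta> c\<close> to
    \<open>\<alpha> c\<close>.\<close>
  have compl: "complemented_in 1 (E n \<times> F) p (v ` E n)"
    unfolding complemented_in_def
  proof (intro conjI exI[of _ "\<lambda>z. v (fst z + \<rho> (snd z))"])
    show "v ` E n \<subseteq> E n \<times> F" by fact
    show "linear (\<lambda>z. v (fst z + \<rho> (snd z)))"
      by (rule linearI) (auto simp: v_def linear_add[OF \<rho>(1)] linear_scale[OF \<rho>(1)] scaleR_add_right)
    show "(\<lambda>z. v (fst z + \<rho> (snd z))) ` (E n \<times> F) = v ` E n"
    proof (intro equalityI subsetI)
      fix z assume "z \<in> v ` E n"
      then obtain e where "e \<in> E n" "z = v e" by blast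
      then show "z \<in> (\<lambda>z. v (fst z + \<rho> (snd z))) ` (E n \<times> F)"
        using subspace_0[OF sF] by (intro image_eqI[of _ _ "(e, 0)"]) (auto simp: linear_0[OF \<rho>(1)])
    qed (use \<rho>(2) subspace_add[OF sE] in auto)
    show "\<forall>x\<in>E n \<times> F. v (fst (v (fst x + \<rho> (snd x))) + \<rho> (snd (v (fst x + \<rho> (snd x))))) = v (fst x + \<rho> (snd x))"
      by (simp add: v_def linear_0[OF \<rho>(1)])
    show "\<forall>x\<in>E n \<times> F. p (v (fst x + \<rho> (snd x))) \<le> 1 * p x"
    proof
      fix z assume "z \<in> E n \<times> F"
      then obtain e f where z: "z = (e, f)" "e \<in> E n" "f \<in> F" by auto
      have "norm (e + \<rho> f) \<le> p (e, f)"
      proof (rule ige)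
        fix c assume c: "c \<in> C"
        have "e + \<rho> f = (e - \<alpha> c) + \<rho> (f + \<beta> c) + (\<alpha> c - \<rho> (\<beta> c))" by (simp add: linear_add[OF \<rho>(1)])
        then have "norm (e + \<rho> f) \<le> norm (e - \<alpha> c) + norm (\<rho> (f + \<beta> c)) + norm (\<alpha> c - \<rho> (\<beta> c))"
          by (metis norm_triangle_le norm_triangle_ineq add_right_mono)
        then show "norm (e + \<rho> f) \<le> norm (e - \<alpha> c) + N (f + \<beta> c) + \<gamma> c"
          using \<rho>(3)[OF subspace_add[OF sF z(3) \<beta>F[OF c]]] h2[OF c] by linarith
      qed
      then show "p (v (fst z + \<rho> (snd z))) \<le> 1 * p z"
        using pe[OF subspace_add[OF sE z(2) \<rho>(2)[OF z(3)]]] by (simp add: z v_def)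
    qed
  qed
  obtain m \<psi>0 R where x: "n \<le> m" "linear \<psi>0" "linear R" "\<psi>0 ` (E n \<times> F) \<subseteq> E m" "\<And>x. R x \<in> E n \<times> F"
    "\<And>h. h \<in> E n \<times> F \<Longrightarrow> R (\<psi>0 h) = h" "\<And>h. h \<in> E n \<times> F \<Longrightarrow> norm (\<psi>0 h) \<le> (1 + \<epsilon>) * p h"
    "\<And>x. p (R x) \<le> (1 + \<epsilon>) * norm x" "\<And>x. x \<in> E n \<Longrightarrow> \<psi>0 (v x) = x"
    using extension[OF fin_dim_Times[OF fd F] p_norm lv vH _ compl \<epsilon>] pe by (auto simp: v_def)
  define \<psi> where "\<psi> f = \<psi>0 (0, f)" for f
  define \<sigma> where "\<sigma> x = \<tau> (fst (R x)) + snd (R x)" for x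
  \<comment> \<open>Symmetrically, \<open>h3\<close> makes the retraction onto the second factor
    contractive for the gauge.\<close>
  have \<sigma>p: "N (\<tau> e + f) \<le> p (e, f)" if ef: "e \<in> E n" "f \<in> F" for e f
  proof (rule ige)
    fix c assume c: "c \<in> C"
    have 1: "\<tau> e + f = (\<tau> (e - \<alpha> c) + (f + \<beta> c)) + (\<tau> (\<alpha> c) - \<beta> c)" by (simp add: linear_diff[OF \<tau>(1)])
    have i: "\<tau> (e - \<alpha> c) \<in> F" "f + \<beta> c \<in> F" "\<tau> (\<alpha> c) - \<beta> c \<in> F" "e - \<alpha> c \<in> E n"
      using ef c \<alpha>E \<beta>F by (auto intro!: \<tau>(2) subspace_add[OF sF] subspace_diff[OF sF] subspace_diff[OF sE])
    have "N (\<tau> e + f) \<le> N (\<tau> (e - \<alpha> c)) + N (f + \<beta> c) + N (\<tau> (\<alpha> c) - \<beta> c)"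
      using s(3)[OF subspace_add[OF sF i(1,2)] i(3)] s(3)[OF i(1,2)] unfolding 1 by linarith
    then show "N (\<tau> e + f) \<le> norm (e - \<alpha> c) + N (f + \<beta> c) + \<gamma> c"
      using \<tau>(3)[OF i(4)] h3[OF c] by linarith
  qed
  show ?thesis
  proof
    show "n \<le> m" by fact
    show "linear \<psi>" unfolding \<psi>_def
      by (rule linear_compose[of "\<lambda>f. (0, f)" \<psi>0, unfolded o_def]) (auto intro!: linearI x)
    show "linear \<sigma>"
      by (rule linearI) (auto simp: \<sigma>_def linear_add[OF x(3)] linear_scale[OF x(3)] linear_add[OF \<tau>(1)] linear_scale[OF \<tau>(1)] scaleR_add_right)
    show "\<psi> f \<in> E m" if "f \<in> F" for f using x(4) that subspace_0[OF sE] by (auto simp: \<psi>_def)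
    show "\<sigma> y \<in> F" for y
      using x(5)[of y] unfolding \<sigma>_def by (auto intro!: subspace_add[OF sF] \<tau>(2))
    show "\<sigma> (\<psi> f) = f" if "f \<in> F" for f
      using x(6)[of "(0, f)"] that subspace_0[OF sE] by (simp add: \<sigma>_def \<psi>_def linear_0[OF \<tau>(1)])
    show "norm (\<psi> f) \<le> (1 + \<epsilon>) * N f" if "f \<in> F" for f
    proof -
      have "norm (\<psi> f) \<le> (1 + \<epsilon>) * p (0, f)" using x(7)[of "(0, f)"] that subspace_0[OF sE] by (simp add: \<psi>_def)
      also have "\<dots> \<le> (1 + \<epsilon>) * N f" using pf[OF that] \<epsilon> by (intro mult_left_mono) auto
      finally show ?thesis .
    qed
    show "N (\<sigma> y) \<le> (1 + \<epsilon>) * norm y" for y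
      using x(8)[of y] \<sigma>p[of "fst (R y)" "snd (R y)"] x(5)[of y] by (auto simp: \<sigma>_def mem_Times_iff)
    \<comment> \<open>The parameter \<open>- c\<close> represents
      \<open>(- \<alpha> c, \<beta> c)\<close> at cost \<open>\<gamma> c\<close> alone; this is how
      closeness is built into the gauge.\<close>
    show "norm (\<psi> (\<beta> c) - \<alpha> c) \<le> (1 + \<epsilon>) * \<gamma> c" if c: "c \<in> C" for c
    proof -
      have i: "- \<alpha> c \<in> E n" "\<beta> c \<in> F" "- c \<in> C"
        using c \<alpha>E \<beta>F by (auto intro: subspace_neg[OF sE] subspace_neg[OF g(1)])
      have "\<psi> (\<beta> c) - \<alpha> c = \<psi>0 (0, \<beta> c) - \<psi>0 (v (\<alpha> c))" using x(9)[OF \<alpha>E[OF c]] by (simp add: \<psi>_def)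
      also have "\<dots> = \<psi>0 (- \<alpha> c, \<beta> c)" by (simp add: v_def flip: linear_diff[OF x(2)])
      finally have "norm (\<psi> (\<beta> c) - \<alpha> c) \<le> (1 + \<epsilon>) * p (- \<alpha> c, \<beta> c)" using x(7)[of "(- \<alpha> c, \<beta> c)"] i by simp
      moreover have "p (- \<alpha> c, \<beta> c) \<le> \<gamma> c"
        using ile[OF i] s(4) g(5)[OF c] by (simp add: linear_neg[OF \<alpha>(1)] linear_neg[OF \<beta>(1)])
      ultimately show ?thesis using \<epsilon> by (smt (verit) mult_left_mono)
    qed
    show "\<sigma> e = \<tau> e" if e: "e \<in> E n" for e
    proof -
      have "R e = v e" using x(6)[of "v e"] x(9)[OF e] vH e by auto
      then show ?thesis by (simp add: \<sigma>_def v_def)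
    qed
  qed
qed

end

text \<open>Telescoping against the tail of a geometric series, whence the factor \<open>2\<close>.
  The hypothesis starts at \<open>K\<close> because a given vector lies in the domain of the
  \<open>k\<close>-th map of a chain only from some index on.\<close>

lemma geometric_limit:
  fixes y :: "nat \<Rightarrow> 'x::banach"
  assumes d: "\<And>k. K \<le> k \<Longrightarrow> norm (y (Suc k) - y k) \<le> c * (1 / 2) ^ k"
  obtains l where "y \<longlonglongrightarrow> l" "\<And>k. K \<le> k \<Longrightarrow> norm (l - y k) \<le> 2 * c * (1 / 2) ^ k"
proof -
  have c0: "0 \<le> c"
  proof -
    have "0 \<le> c * (1 / 2) ^ K" using norm_ge_zero d[OF order_refl] by (rule order_trans)
    moreover have "0 < (1 / 2 :: real) ^ K" by simp
    ultimately show ?thesis unfolding zero_le_mult_iff by linarith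
  qed
  have dist: "norm (y (k + j) - y k) \<le> 2 * c * (1 / 2) ^ k - 2 * c * (1 / 2) ^ (k + j)" if k: "K \<le> k" for k j
  proof (induction j)
    case (Suc j)
    have "norm (y (k + Suc j) - y k) \<le> norm (y (Suc (k + j)) - y (k + j)) + norm (y (k + j) - y k)"
      using norm_triangle_ineq[of "y (Suc (k + j)) - y (k + j)" "y (k + j) - y k"] by simp
    also have "\<dots> \<le> c * (1 / 2) ^ (k + j) + (2 * c * (1 / 2) ^ k - 2 * c * (1 / 2) ^ (k + j))"
      using d[of "k + j"] Suc k by (intro add_mono) auto
    also have "\<dots> = 2 * c * (1 / 2) ^ k - 2 * c * (1 / 2) ^ (k + Suc j)" by simp
    finally show ?case .
  qed simp
  have dist': "norm (y m - y k) \<le> 2 * c * (1 / 2) ^ k" if "K \<le> k" "k \<le> m" for k m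
  proof -
    have "norm (y m - y k) \<le> 2 * c * (1 / 2) ^ k - 2 * c * (1 / 2) ^ m"
      using dist[OF that(1), of "m - k"] that(2) by simp
    also have "\<dots> \<le> 2 * c * (1 / 2) ^ k" using c0 by simp
    finally show ?thesis .
  qed
  have "Cauchy y"
  proof (rule metric_CauchyI)
    fix e :: real assume e: "0 < e"
    have "(\<lambda>k. 4 * c * (1 / 2) ^ k) \<longlonglongrightarrow> 4 * c * 0" by (intro tendsto_intros LIMSEQ_power_zero) auto
    then have "\<forall>\<^sub>F k in sequentially. 4 * c * (1 / 2) ^ k < e" using e by (intro order_tendstoD(2)) auto
    then have "\<forall>\<^sub>F k in sequentially. 4 * c * (1 / 2) ^ k < e \<and> K \<le> k"
      by (intro eventually_conj eventually_ge_at_top)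
    then obtain k where k: "4 * c * (1 / 2) ^ k < e" "K \<le> k" by (auto simp: eventually_sequentially)
    have "dist (y m) (y n) < e" if "m \<ge> k" "n \<ge> k" for m n
    proof -
      have "norm (y m - y n) \<le> norm (y m - y k) + norm (y n - y k)"
        using norm_triangle_ineq4[of "y m - y k" "y n - y k"] by simp
      also have "\<dots> \<le> 2 * c * (1 / 2) ^ k + 2 * c * (1 / 2) ^ k"
        using dist'[OF k(2) that(1)] dist'[OF k(2) that(2)] by (rule add_mono)
      finally show ?thesis using k(1) by (simp add: dist_norm)
    qed
    then show "\<exists>M. \<forall>m\<ge>M. \<forall>n\<ge>M. dist (y m) (y n) < e" by blast
  qed
  then obtain l where l: "y \<longlonglongrightarrow> l" using Cauchy_convergent convergent_def by blast
  have "norm (l - y k) \<le> 2 * c * (1 / 2) ^ k" if k: "K \<le> k" for k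
  proof (rule LIMSEQ_le_const2)
    show "(\<lambda>m. norm (y m - y k)) \<longlonglongrightarrow> norm (l - y k)" by (intro tendsto_intros l)
    show "\<exists>N. \<forall>n\<ge>N. norm (y n - y k) \<le> 2 * c * (1 / 2) ^ k" using dist'[OF k] by blast
  qed
  then show ?thesis using l that by blast
qed

section \<open>Almost transitivity and complemented subspaces\<close>

context skeleton_space
begin

text \<open>A finite dimensional approximation to an isometric embedding with 1-complemented range:
  \<open>\<phi>\<close> and its left inverse \<open>\<rho>\<close> each lose at most the factor
  \<open>1 + \<delta>\<close>. Such pairs are the states of both limit constructions.\<close>

definition retract_pair :: "real \<Rightarrow> 'b::real_vector set \<Rightarrow> ('b \<Rightarrow> real) \<Rightarrow> nat \<Rightarrow> ('b \<Rightarrow> 'a) \<Rightarrow> ('a \<Rightarrow> 'b) \<Rightarrow> bool" where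
  "retract_pair \<delta> A N n \<phi> \<rho> \<longleftrightarrow> linear \<phi> \<and> linear \<rho> \<and>
     (\<forall>f\<in>A. \<phi> f \<in> E n \<and> \<rho> (\<phi> f) = f \<and> norm (\<phi> f) \<le> (1 + \<delta>) * N f) \<and>
     (\<forall>x\<in>E n. \<rho> x \<in> A \<and> N (\<rho> x) \<le> (1 + \<delta>) * norm x)"

lemma retract_pairD:
  assumes "retract_pair \<delta> A N n \<phi> \<rho>"
  shows "linear \<phi>" "linear \<rho>" "f \<in> A \<Longrightarrow> \<phi> f \<in> E n" "f \<in> A \<Longrightarrow> \<rho> (\<phi> f) = f"
    "f \<in> A \<Longrightarrow> norm (\<phi> f) \<le> (1 + \<delta>) * N f" "x \<in> E n \<Longrightarrow> \<rho> x \<in> A" "x \<in> E n \<Longrightarrow> N (\<rho> x) \<le> (1 + \<delta>) * norm x"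
    "f \<in> A \<Longrightarrow> N f \<le> (1 + \<delta>) * norm (\<phi> f)"
proof -
  show "linear \<phi>" "linear \<rho>" "f \<in> A \<Longrightarrow> \<phi> f \<in> E n" "f \<in> A \<Longrightarrow> \<rho> (\<phi> f) = f"
    "f \<in> A \<Longrightarrow> norm (\<phi> f) \<le> (1 + \<delta>) * N f" "x \<in> E n \<Longrightarrow> \<rho> x \<in> A" "x \<in> E n \<Longrightarrow> N (\<rho> x) \<le> (1 + \<delta>) * norm x"
    using assms by (auto simp: retract_pair_def)
  show "N f \<le> (1 + \<delta>) * norm (\<phi> f)" if "f \<in> A"
    using assms that unfolding retract_pair_def by metis
qed

text \<open>The multiplicative lower bound, in the additive shape that an amalgam requires for the
  cost \<open>\<delta> * N f\<close>.\<close>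

lemma retract_pair_low:
  assumes "retract_pair \<delta> A N n \<phi> \<rho>" "0 < \<delta>" "f \<in> A"
  shows "N f \<le> norm (\<phi> f) + \<delta> * N f"
proof -
  have "N f \<le> (1 + \<delta>) * norm (\<phi> f)" by (rule retract_pairD(8)[OF assms(1,3)])
  then have "N f / (1 + \<delta>) \<le> norm (\<phi> f)" using assms(2) by (simp add: field_simps)
  moreover have "N f - N f / (1 + \<delta>) = \<delta> * (N f / (1 + \<delta>))" using assms(2) by (simp add: field_simps)
  moreover have "\<delta> * (N f / (1 + \<delta>)) \<le> \<delta> * N f"
  proof -
    have "0 \<le> (1 + \<delta>) * N f" using retract_pairD(5)[OF assms(1,3)] norm_ge_zero order_trans by blast
    then have "0 \<le> N f" using assms(2) by (simp add: zero_le_mult_iff)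
    then show ?thesis using assms(2) by (intro mult_left_mono) (auto simp: field_simps)
  qed
  ultimately show ?thesis by linarith
qed

lemma damped_distance:
  fixes x :: "'x::real_vector" and \<delta> :: real
  assumes N: "seminorm_on V N" and x: "x \<in> V" "N x \<le> (1 + \<delta>) * t" and \<delta>: "0 < \<delta>"
  shows "N ((1 / (1 + \<delta>)) *\<^sub>R x - x) \<le> \<delta> * t"
proof -
  have "(1 / (1 + \<delta>)) *\<^sub>R x - x = (- (\<delta> / (1 + \<delta>))) *\<^sub>R x"
  proof -
    have "1 / (1 + \<delta>) - 1 = - (\<delta> / (1 + \<delta>))" using \<delta> by (simp add: field_simps)
    then have "(1 / (1 + \<delta>) - 1) *\<^sub>R x = (- (\<delta> / (1 + \<delta>))) *\<^sub>R x" by (rule arg_cong)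
    then show ?thesis by (simp add: scaleR_diff_left)
  qed
  then have "N ((1 / (1 + \<delta>)) *\<^sub>R x - x) = \<delta> / (1 + \<delta>) * N x"
    using seminorm_onD(2)[OF N x(1), of "- (\<delta> / (1 + \<delta>))"] \<delta> by (simp del: scaleR_minus_left)
  also have "\<dots> \<le> \<delta> / (1 + \<delta>) * ((1 + \<delta>) * t)" using x \<delta> by (intro mult_left_mono) auto
  also have "\<dots> = \<delta> * t" using \<delta> by simp
  finally show ?thesis .
qed

lemma damped_contraction:
  fixes x :: "'x::real_vector" and \<delta> :: real
  assumes N: "seminorm_on V N" and x: "x \<in> V" "N x \<le> (1 + \<delta>) * t" and \<delta>: "0 < \<delta>"
  shows "N ((1 / (1 + \<delta>)) *\<^sub>R x) \<le> t"
proof -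
  have "N ((1 / (1 + \<delta>)) *\<^sub>R x) = N x / (1 + \<delta>)"
    unfolding seminorm_onD(2)[OF N x(1)] using \<delta> by simp
  also have "\<dots> \<le> t" using x(2) \<delta> by (simp add: pos_divide_le_eq mult.commute)
  finally show ?thesis .
qed

section \<open>The back-and-forth construction of isometries\<close>

lemma linear_damped: "linear f \<Longrightarrow> linear (\<lambda>x. a *\<^sub>R f x)"
  by (rule linear_compose_scale_right)

text \<open>The amalgam of \<open>E n\<close> and \<open>E m\<close> along \<open>\<phi>\<close>, at
  cost \<open>\<delta> * norm c\<close>, embeds \<open>E m\<close> in a later member so that
  \<open>\<psi>\<close> almost undoes \<open>\<phi>\<close>. The damped \<open>\<rho>\<close> and
  \<open>\<phi>\<close> are the two contractions it asks for.\<close>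

lemma back_and_forth_step:
  assumes P: "retract_pair \<delta> (E n) norm m \<phi> \<rho>" and \<delta>: "0 < \<delta>" "0 < \<delta>'"
  obtains m' \<psi> \<sigma> where "m < m'" "retract_pair \<delta>' (E m) norm m' \<psi> \<sigma>"
    "\<And>e. e \<in> E n \<Longrightarrow> norm (\<psi> (\<phi> e) - e) \<le> (1 + \<delta>') * (\<delta> * norm e)"
proof -
  note p = retract_pairD[OF P]
  have sm: "seminorm_on (E n) norm" and nm: "norm_on (E n) norm" for n
    using norm_on_norm[OF E_subspace] norm_on_seminorm by auto
  have g: "seminorm_on (E n) (\<lambda>c. \<delta> * norm c)"
    unfolding seminorm_on_def using E_subspace \<delta>
    by (auto simp: mult_left_mono norm_triangle_ineq simp flip: distrib_left)
  \<comment> \<open>Turns the cost \<open>\<delta> * norm c\<close> into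
    \<open>(1 + \<delta>) * norm c\<close>, which dominates the norms of \<open>c\<close> and of
    \<open>\<phi> c\<close>.\<close>
  define K where "K = (1 + \<delta>) / \<delta>"
  have K: "K * (\<delta> * x) = (1 + \<delta>) * x" for x using \<delta> by (simp add: K_def)
  obtain m' \<psi> \<sigma> where r: "n \<le> m'" "linear \<psi>" "linear \<sigma>" "\<And>f. f \<in> E m \<Longrightarrow> \<psi> f \<in> E m'" "\<And>x. \<sigma> x \<in> E m"
    "\<And>f. f \<in> E m \<Longrightarrow> \<sigma> (\<psi> f) = f" "\<And>f. f \<in> E m \<Longrightarrow> norm (\<psi> f) \<le> (1 + \<delta>') * norm f"
    "\<And>x. norm (\<sigma> x) \<le> (1 + \<delta>') * norm x" "\<And>c. c \<in> E n \<Longrightarrow> norm (\<psi> (\<phi> c) - id c) \<le> (1 + \<delta>') * (\<delta> * norm c)"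
  proof (rule amalgam[OF fd[of m] nm g, of id n \<phi> "\<lambda>x. (1 / (1 + \<delta>)) *\<^sub>R \<rho> x" "\<lambda>x. (1 / (1 + \<delta>)) *\<^sub>R \<phi> x" K \<delta>'], goal_cases)
    case 1 show ?case by (rule linear_id)
  next
    case 3 show ?case by (rule p)
  next
    case 5 show ?case by (intro linear_damped p)
  next
    case (6 f) then show ?case by (intro subspace_scale[OF E_subspace] p)
  next
    case (7 f) then show ?case by (intro damped_contraction[OF sm p(6) p(7)] \<delta>)
  next
    case 8 show ?case by (intro linear_damped p)
  next
    case (9 e) then show ?case by (intro subspace_scale[OF E_subspace] p)
  next
    case (10 e) then show ?case by (intro damped_contraction[OF sm p(3) p(5)] \<delta>)
  next
    case (11 c) then show ?case using retract_pair_low[OF P \<delta>(1)] by simp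
  next
    case (12 c)
    have "norm ((1 / (1 + \<delta>)) *\<^sub>R c - c) \<le> \<delta> * norm c"
      by (rule damped_distance[OF sm[of n]]) (use \<open>c \<in> E n\<close> \<delta> in \<open>auto simp: algebra_simps\<close>)
    then show ?case using p(4)[OF \<open>c \<in> E n\<close>] by (simp add: norm_minus_commute)
  next
    case (13 c)
    then show ?case using damped_distance[OF sm p(3)[OF \<open>c \<in> E n\<close>] p(5)[OF \<open>c \<in> E n\<close>] \<delta>(1)] by simp
  next
    case (14 c) then show ?case using \<delta> unfolding K by (simp add: algebra_simps)
  next
    case (15 c) then show ?case unfolding K using p(5) by simp
  qed (use p \<delta> in auto)
  show ?thesis
  \<comment> \<open>The estimate for \<open>\<sigma>\<close> holds on the whole space, so the target
    may be enlarged; strictly increasing indices make the chain exhaust the skeleton.\<close>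
  proof (rule that[of "max m' (Suc m)" \<psi> \<sigma>])
    show "m < max m' (Suc m)" by simp
    show "retract_pair \<delta>' (E m) norm (max m' (Suc m)) \<psi> \<sigma>"
      unfolding retract_pair_def using r E_mono[of m' "max m' (Suc m)"] by auto
    show "norm (\<psi> (\<phi> e) - e) \<le> (1 + \<delta>') * (\<delta> * norm e)" if "e \<in> E n" for e using r(9)[OF that] by simp
  qed
qed

text \<open>\<open>E n\<close> is amalgamated with itself along the lines through \<open>x0\<close>
  and \<open>y0\<close>. Norming functionals give rank one contractions taking \<open>y0\<close> to
  \<open>x0\<close> and \<open>x0\<close> to \<open>y0\<close> exactly; the positive cost keeps the
  gauge definite.\<close>

lemma back_and_forth_start:
  assumes x0: "x0 \<in> E n" "norm x0 = 1" and y0: "y0 \<in> E n" "norm y0 = 1" and \<delta>: "0 < \<delta>"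
  obtains m \<phi> \<rho> where "n < m" "retract_pair \<delta> (E n) norm m \<phi> \<rho>" "norm (\<phi> y0 - x0) \<le> (1 + \<delta>) * \<delta>"
proof -
  have nm: "norm_on (E n) norm" by (rule norm_on_norm[OF E_subspace])
  obtain gx where gx: "linear gx" "gx x0 = norm x0" "\<And>x. x \<in> E n \<Longrightarrow> \<bar>gx x\<bar> \<le> norm x"
    using norming_functional[OF fd x0(1)] by blast
  obtain gy where gy: "linear gy" "gy y0 = norm y0" "\<And>x. x \<in> E n \<Longrightarrow> \<bar>gy x\<bar> \<le> norm x"
    using norming_functional[OF fd y0(1)] by blast
  have g: "seminorm_on UNIV (\<lambda>c::real. \<delta> * \<bar>c\<bar>)"
    unfolding seminorm_on_def using \<delta>
    by (auto simp: abs_mult mult_left_mono abs_triangle_ineq simp flip: distrib_left)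
  have ls: "linear (\<lambda>c. c *\<^sub>R x)" for x :: 'a by (rule linearI) (auto simp: scaleR_add_left)
  have lg: "linear (\<lambda>z. g z *\<^sub>R x)" if "linear g" for g :: "'a \<Rightarrow> real" and x :: 'a
    by (rule linearI) (auto simp: scaleR_add_left linear_add[OF that] linear_scale[OF that])
  obtain m \<psi> \<sigma> where r: "n \<le> m" "linear \<psi>" "linear \<sigma>" "\<And>f. f \<in> E n \<Longrightarrow> \<psi> f \<in> E m" "\<And>x. \<sigma> x \<in> E n"
    "\<And>f. f \<in> E n \<Longrightarrow> \<sigma> (\<psi> f) = f" "\<And>f. f \<in> E n \<Longrightarrow> norm (\<psi> f) \<le> (1 + \<delta>) * norm f"
    "\<And>x. norm (\<sigma> x) \<le> (1 + \<delta>) * norm x"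
    "\<And>c. c \<in> UNIV \<Longrightarrow> norm (\<psi> (c *\<^sub>R y0) - c *\<^sub>R x0) \<le> (1 + \<delta>) * (\<delta> * \<bar>c\<bar>)"
    by (rule amalgam[OF fd[of n] nm g, of "\<lambda>c. c *\<^sub>R x0" n "\<lambda>c. c *\<^sub>R y0"
          "\<lambda>z. gy z *\<^sub>R x0" "\<lambda>z. gx z *\<^sub>R y0" "1 / \<delta>" \<delta>])
      (use ls lg gx gy x0 y0 \<delta> subspace_scale[OF E_subspace] in
        \<open>auto simp: linear_scale[OF gx(1)] linear_scale[OF gy(1)]\<close>)
  show ?thesis
  proof (rule that[of "max m (Suc n)" \<psi> \<sigma>])
    show "retract_pair \<delta> (E n) norm (max m (Suc n)) \<psi> \<sigma>"
      unfolding retract_pair_def using r E_mono[of m "max m (Suc n)"] by auto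
    show "norm (\<psi> y0 - x0) \<le> (1 + \<delta>) * \<delta>" using r(9)[of 1] by simp
  qed simp
qed

text \<open>
  The maps \<open>\<phi> k\<close> from \<open>E (M k)\<close> to \<open>E (M (Suc k))\<close> go alternately forth and back. Those of even
  index converge to an isometry, and those of odd index show that its range is dense.
\<close>

lemma skeleton_isometry:
  assumes x0: "x0 \<in> E n" "norm x0 = 1" and y0: "y0 \<in> E n" "norm y0 = 1" and d: "0 < d" "d \<le> 1"
  obtains T where "bounded_linear T" "surj T" "\<And>x. norm (T x) = norm x" "norm (T y0 - x0) \<le> 18 * d"
proof -
  define \<delta> where "\<delta> k = d * (1 / 2) ^ k" for k :: nat
  have \<delta>0: "0 < \<delta> k" for k using d by (simp add: \<delta>_def)
  have p1: "(1 / 2 :: real) ^ k \<le> 1" for k :: nat by (simp add: power_le_one)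
  have \<delta>1: "\<delta> k \<le> 1" for k
    unfolding \<delta>_def using d p1[of k] by (intro mult_le_one) auto
  have \<delta>S: "\<delta> (Suc k) \<le> \<delta> k" for k using d by (simp add: \<delta>_def)
  have \<delta>2: "\<delta> (2 * k) \<le> d * (1 / 2) ^ k" for k
    unfolding \<delta>_def using d by (intro mult_left_mono power_decreasing) auto
  \<comment> \<open>A state \<open>(a, b, \<phi>, \<rho>)\<close> embeds \<open>E a\<close> in
    \<open>E b\<close>. By \<open>Q\<close> the next state starts at \<open>b\<close>, and its
    embedding composed with \<open>\<phi>\<close> is close to the identity.\<close>
  define P where "P k s = (case s of (a, b, \<phi>, \<rho>) \<Rightarrow> a < b \<and> retract_pair (\<delta> k) (E a) norm b \<phi> \<rho> \<and>
      (k = 0 \<longrightarrow> a = n \<and> norm (\<phi> y0 - x0) \<le> 2 * d))" for k :: nat and s :: "nat \<times> nat \<times> ('a \<Rightarrow> 'a) \<times> ('a \<Rightarrow> 'a)"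
  define Q where "Q k s s' = (case s of (a, b, \<phi>, \<rho>) \<Rightarrow> case s' of (a', b', \<phi>', \<rho>') \<Rightarrow>
      a' = b \<and> (\<forall>e\<in>E a. norm (\<phi>' (\<phi> e) - e) \<le> 2 * \<delta> k * norm e))"
    for k :: nat and s s' :: "nat \<times> nat \<times> ('a \<Rightarrow> 'a) \<times> ('a \<Rightarrow> 'a)"
  have "\<exists>f. \<forall>k. P k (f k) \<and> Q k (f k) (f (Suc k))"
  proof (rule dependent_nat_choice)
    obtain m \<phi> \<rho> where m: "n < m" "retract_pair (\<delta> 0) (E n) norm m \<phi> \<rho>" "norm (\<phi> y0 - x0) \<le> (1 + \<delta> 0) * \<delta> 0"
      using back_and_forth_start[OF x0 y0 \<delta>0] by blast
    have "(1 + \<delta> 0) * \<delta> 0 \<le> 2 * d" using d by (simp add: \<delta>_def)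
    then have "P 0 (n, m, \<phi>, \<rho>)" using m by (simp add: P_def)
    then show "\<exists>s. P 0 s" by blast
  next
    fix s k assume "P k s"
    then obtain a b \<phi> \<rho> where s: "s = (a, b, \<phi>, \<rho>)" "a < b" "retract_pair (\<delta> k) (E a) norm b \<phi> \<rho>"
      by (auto simp: P_def split: prod.splits)
    obtain c \<psi> \<sigma> where c: "b < c" "retract_pair (\<delta> (Suc k)) (E b) norm c \<psi> \<sigma>"
      "\<And>e. e \<in> E a \<Longrightarrow> norm (\<psi> (\<phi> e) - e) \<le> (1 + \<delta> (Suc k)) * (\<delta> k * norm e)"
      using back_and_forth_step[OF s(3) \<delta>0 \<delta>0[of "Suc k"]] by blast
    have "(1 + \<delta> (Suc k)) * (\<delta> k * norm e) \<le> 2 * \<delta> k * norm e" for e :: 'a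
      using \<delta>1[of "Suc k"] \<delta>0[of k] mult_right_mono[of "1 + \<delta> (Suc k)" 2 "\<delta> k * norm e"] by simp
    then have "norm (\<psi> (\<phi> e) - e) \<le> 2 * \<delta> k * norm e" if "e \<in> E a" for e
      using c(3)[OF that] order_trans by blast
    then have "P (Suc k) (b, c, \<psi>, \<sigma>) \<and> Q k s (b, c, \<psi>, \<sigma>)" using c by (simp add: P_def Q_def s)
    then show "\<exists>s'. P (Suc k) s' \<and> Q k s s'" by blast
  qed
  then obtain f where f: "\<And>k. P k (f k)" "\<And>k. Q k (f k) (f (Suc k))" by blast
  define M where "M k = fst (f k)" for k
  define \<phi> where "\<phi> k = fst (snd (snd (f k)))" for k
  define \<rho> where "\<rho> k = snd (snd (snd (f k)))" for k
  have Mb: "fst (snd (f k)) = M (Suc k)" for k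
    using f(2)[of k] by (auto simp: Q_def M_def split: prod.splits)
  have fk: "f k = (M k, M (Suc k), \<phi> k, \<rho> k)" for k
    using Mb[of k] by (simp add: M_def \<phi>_def \<rho>_def prod_eq_iff)
  have Pk: "M k < M (Suc k)" "retract_pair (\<delta> k) (E (M k)) norm (M (Suc k)) (\<phi> k) (\<rho> k)" for k
    using f(1)[of k] unfolding fk by (auto simp: P_def)
  have M0: "M 0 = n" "norm (\<phi> 0 y0 - x0) \<le> 2 * d" using f(1)[of 0] unfolding fk by (auto simp: P_def)
  have Qk: "norm (\<phi> (Suc k) (\<phi> k e) - e) \<le> 2 * \<delta> k * norm e" if "e \<in> E (M k)" for k e
    using f(2)[of k] that unfolding fk by (auto simp: Q_def)
  have sm: "strict_mono M" using Pk(1) by (simp add: strict_mono_Suc_iff)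
  have Mmono: "E (M k) \<subseteq> E (M l)" if "k \<le> l" for k l
    using that sm by (intro E_mono) (simp add: strict_mono_less_eq)
  note rp = retract_pairD[OF Pk(2)]
  have l\<phi>: "linear (\<phi> k)" for k by (rule rp)
  have \<phi>n: "norm (\<phi> k e) \<le> 2 * norm e" if "e \<in> E (M k)" for k e
    using rp(5)[OF that] \<delta>1[of k] mult_right_mono[of "1 + \<delta> k" 2 "norm e"] by simp
  have inU: "\<exists>K. e \<in> E (M (2 * K))" if e: "e \<in> (\<Union>n. E n)" for e
  proof -
    obtain j where "e \<in> E j" using e by blast
    moreover have "j \<le> M j" using strict_mono_imp_increasing[OF sm] by blast
    ultimately show ?thesis using E_mono[of j "M j"] Mmono[of j "2 * j"] by auto
  qed
  \<comment> \<open>For three consecutive maps, \<open>C e\<close> is close to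
    \<open>C (B (A e))\<close>, which is close to \<open>A e\<close>. Each comparison costs
    \<open>4 * \<delta> (2 * k) * norm e\<close>, since the maps have norm at most
    \<open>2\<close>.\<close>
  have step: "norm (\<phi> (2 * Suc k) e - \<phi> (2 * k) e) \<le> (8 * d * norm e) * (1 / 2) ^ k" if e: "e \<in> E (M (2 * k))" for k e
  proof -
    define A where "A = \<phi> (2 * k)" define B where "B = \<phi> (Suc (2 * k))" define C where "C = \<phi> (Suc (Suc (2 * k)))"
    have Ae: "A e \<in> E (M (Suc (2 * k)))" unfolding A_def by (rule rp(3)[OF e])
    have BAe: "B (A e) \<in> E (M (Suc (Suc (2 * k))))" unfolding B_def by (rule rp(3)[OF Ae])
    have e2: "e \<in> E (M (Suc (Suc (2 * k))))" using e Mmono[of "2 * k" "Suc (Suc (2 * k))"] by auto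
    have "C e - A e = (C (B (A e)) - A e) - C (B (A e) - e)"
      by (simp add: C_def linear_diff[OF l\<phi>])
    then have "norm (C e - A e) \<le> norm (C (B (A e)) - A e) + norm (C (B (A e) - e))"
      using norm_triangle_ineq4 by metis
    also have "norm (C (B (A e)) - A e) \<le> 2 * \<delta> (Suc (2 * k)) * norm (A e)"
      unfolding B_def C_def by (rule Qk[OF Ae])
    also have "\<dots> \<le> 2 * \<delta> (2 * k) * (2 * norm e)"
      using \<delta>S[of "2 * k"] \<phi>n[OF e] \<delta>0[of "2 * k"] less_imp_le[OF \<delta>0[of "Suc (2 * k)"]] by (intro mult_mono) (auto simp: A_def)
    also have "norm (C (B (A e) - e)) \<le> 2 * norm (B (A e) - e)"
      unfolding C_def by (intro \<phi>n subspace_diff[OF E_subspace] BAe e2)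
    also have "norm (B (A e) - e) \<le> 2 * \<delta> (2 * k) * norm e" unfolding A_def B_def by (rule Qk[OF e])
    finally have "norm (C e - A e) \<le> 8 * norm e * \<delta> (2 * k)" by simp
    also have "\<dots> \<le> 8 * norm e * (d * (1 / 2) ^ k)" using \<delta>2 by (intro mult_left_mono) auto
    finally show ?thesis by (simp add: A_def C_def mult_ac)
  qed
  define T0 where "T0 e = lim (\<lambda>k. \<phi> (2 * k) e)" for e
  have T0: "(\<lambda>k. \<phi> (2 * k) e) \<longlonglongrightarrow> T0 e"
    "norm (T0 e - \<phi> (2 * K) e) \<le> 16 * d * norm e * (1 / 2) ^ K" if e: "e \<in> E (M (2 * K))" for e K
  proof -
    have "norm (\<phi> (2 * Suc k) e - \<phi> (2 * k) e) \<le> (8 * d * norm e) * (1 / 2) ^ k" if "K \<le> k" for k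
      using e Mmono[of "2 * K" "2 * k"] that by (intro step) auto
    then obtain l where l: "(\<lambda>k. \<phi> (2 * k) e) \<longlonglongrightarrow> l" "\<And>k. K \<le> k \<Longrightarrow> norm (l - \<phi> (2 * k) e) \<le> 2 * (8 * d * norm e) * (1 / 2) ^ k"
      using geometric_limit[of K "\<lambda>k. \<phi> (2 * k) e" "8 * d * norm e"] by blast
    have "T0 e = l" unfolding T0_def using l(1) by (rule limI)
    then show "(\<lambda>k. \<phi> (2 * k) e) \<longlonglongrightarrow> T0 e"
      "norm (T0 e - \<phi> (2 * K) e) \<le> 16 * d * norm e * (1 / 2) ^ K" using l(1) l(2)[of K] by auto
  qed
  let ?U = "\<Union>n. E n"
  have T0l: "(\<lambda>k. \<phi> (2 * k) e) \<longlonglongrightarrow> T0 e" if "e \<in> ?U" for e using inU[OF that] T0(1) by blast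
  have lT0: "lin_on ?U T0"
    unfolding lin_on_def
  proof (intro conjI ballI allI)
    fix x y a assume x: "x \<in> ?U" "y \<in> ?U"
    have "(\<lambda>k. \<phi> (2 * k) (x + y)) \<longlonglongrightarrow> T0 x + T0 y"
      unfolding linear_add[OF l\<phi>] by (intro tendsto_add T0l x)
    then show "T0 (x + y) = T0 x + T0 y"
      using LIMSEQ_unique T0l[OF subspace_add[OF union_subspace x]] by blast
  next
    fix x a assume x: "x \<in> ?U"
    have "(\<lambda>k. \<phi> (2 * k) (a *\<^sub>R x)) \<longlonglongrightarrow> a *\<^sub>R T0 x"
      unfolding linear_scale[OF l\<phi>] by (intro tendsto_intros T0l x)
    then show "T0 (a *\<^sub>R x) = a *\<^sub>R T0 x"
      using LIMSEQ_unique T0l[OF subspace_scale[OF union_subspace x]] by blast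
  qed
  have \<delta>lim: "(\<lambda>k. 1 + \<delta> (2 * k)) \<longlonglongrightarrow> 1 + 0"
  proof (intro tendsto_intros)
    have "(\<lambda>k. d * (1 / 2) ^ k) \<longlonglongrightarrow> d * 0" by (intro tendsto_intros LIMSEQ_power_zero) auto
    then have z: "(\<lambda>k. d * (1 / 2) ^ k) \<longlonglongrightarrow> 0" by simp
    show "(\<lambda>k. \<delta> (2 * k)) \<longlonglongrightarrow> 0"
      by (rule tendsto_sandwich[OF _ _ tendsto_const z]) (simp_all add: \<delta>2 less_imp_le[OF \<delta>0])
  qed
  have T0norm: "norm (T0 e) = norm e" if e: "e \<in> ?U" for e
  proof -
    obtain K where K: "e \<in> E (M (2 * K))" using inU[OF e] by blast
    have ek: "e \<in> E (M (2 * k))" if "K \<le> k" for k using K Mmono[of "2 * K" "2 * k"] that by auto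
    have n: "(\<lambda>k. norm (\<phi> (2 * k) e)) \<longlonglongrightarrow> norm (T0 e)" by (intro tendsto_intros T0l e)
    show ?thesis
    proof (rule antisym)
      have "(\<lambda>k. (1 + \<delta> (2 * k)) * norm e) \<longlonglongrightarrow> (1 + 0) * norm e" by (intro tendsto_mult \<delta>lim tendsto_const)
      then show "norm (T0 e) \<le> norm e"
        using LIMSEQ_le[OF n] rp(5)[OF ek] by auto
      have "(\<lambda>k. (1 + \<delta> (2 * k)) * norm (\<phi> (2 * k) e)) \<longlonglongrightarrow> (1 + 0) * norm (T0 e)" by (intro tendsto_mult \<delta>lim n)
      then show "norm e \<le> norm (T0 e)"
        using LIMSEQ_le_const[of "\<lambda>k. (1 + \<delta> (2 * k)) * norm (\<phi> (2 * k) e)" "norm (T0 e)" "norm e"] rp(8)[OF ek] by auto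
    qed
  qed
  have b1: "norm (T0 e) \<le> 1 * norm e" if "e \<in> ?U" for e using T0norm[OF that] by simp
  obtain T where T: "bounded_linear T" "\<And>x. x \<in> ?U \<Longrightarrow> T x = T0 x" "\<And>x. norm (T x) \<le> 1 * norm x"
    using bounded_linear_extension[OF union_subspace dense lT0 b1 zero_le_one] by blast
  have cT: "continuous_on UNIV T" using linear_continuous_on[OF T(1)] .
  have Tn: "norm (T x) = norm x" for x
  proof -
    have "closed {x. norm (T x) = norm x}"
      by (intro closed_Collect_eq continuous_intros cT)
    moreover have "norm (T x) = norm x" if "x \<in> ?U" for x using T(2)[OF that] T0norm[OF that] by simp
    then have "?U \<subseteq> {x. norm (T x) = norm x}" by blast
    ultimately have "closure ?U \<subseteq> {x. norm (T x) = norm x}" by (rule closure_minimal[rotated])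
    then show ?thesis using dense by auto
  qed
  \<comment> \<open>The isometric image of a complete space is closed, so a dense range is enough
    for surjectivity.\<close>
  have cl: "closed (range T)"
  proof (rule complete_imp_closed)
    show "complete (range T)"
      by (rule complete_isometric_image[of 1 UNIV T]) (use T(1) Tn complete_UNIV in auto)
  qed
  have "?U \<subseteq> closure (range T)"
  proof
    fix y assume y: "y \<in> ?U"
    then obtain K where K: "y \<in> E (M (2 * K))" using inU by blast
    show "y \<in> closure (range T)"
      unfolding dense_iff_norm
    proof (intro allI impI)
      fix e :: real assume e: "0 < e"
      have "(\<lambda>k. 40 * d * norm y * (1 / 2) ^ k) \<longlonglongrightarrow> 40 * d * norm y * 0"
        by (intro tendsto_intros LIMSEQ_power_zero) auto
      then have "\<forall>\<^sub>F k in sequentially. 40 * d * norm y * (1 / 2) ^ k < e" using e by (intro order_tendstoD(2)) auto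
      then have "\<forall>\<^sub>F k in sequentially. 40 * d * norm y * (1 / 2) ^ k < e \<and> K \<le> k"
        by (intro eventually_conj eventually_ge_at_top)
      then obtain k where k: "40 * d * norm y * (1 / 2) ^ k < e" "K \<le> k" by (auto simp: eventually_sequentially)
      have yk: "y \<in> E (M (Suc (2 * k)))" using K Mmono[of "2 * K" "Suc (2 * k)"] k by auto
      \<comment> \<open>The odd map sends \<open>y\<close> to a vector that the next even map, and
        therefore \<open>T\<close>, returns near \<open>y\<close>.\<close>
      define x where "x = \<phi> (Suc (2 * k)) y"
      have x: "x \<in> E (M (2 * Suc k))" using rp(3)[OF yk] by (simp add: x_def)
      have "norm (\<phi> (2 * Suc k) x - y) \<le> 2 * \<delta> (Suc (2 * k)) * norm y" using Qk[OF yk] by (simp add: x_def)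
      also have "\<dots> \<le> 2 * (d * (1 / 2) ^ k) * norm y"
        using order_trans[OF \<delta>S \<delta>2] by (intro mult_right_mono mult_left_mono) auto
      finally have 1: "norm (\<phi> (2 * Suc k) x - y) \<le> 2 * d * norm y * (1 / 2) ^ k" by (simp add: mult_ac)
      have "norm (T0 x - \<phi> (2 * Suc k) x) \<le> 16 * d * norm x * (1 / 2) ^ Suc k" by (rule T0(2)[OF x])
      also have "\<dots> \<le> 16 * d * (2 * norm y) * (1 / 2) ^ k"
        using \<phi>n[OF yk] d by (intro mult_mono power_decreasing) (auto simp: x_def)
      finally have 2: "norm (T0 x - \<phi> (2 * Suc k) x) \<le> 32 * d * norm y * (1 / 2) ^ k" by simp
      have "x \<in> ?U" using x by blast
      then have Tx: "T x = T0 x" by (rule T(2))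
      have "norm (y - T x) \<le> norm (T0 x - \<phi> (2 * Suc k) x) + norm (\<phi> (2 * Suc k) x - y)"
        using norm_triangle_ineq[of "T0 x - \<phi> (2 * Suc k) x" "\<phi> (2 * Suc k) x - y"] Tx
        by (simp add: norm_minus_commute)
      also have "\<dots> \<le> 34 * d * norm y * (1 / 2) ^ k" using 1 2 by simp
      also have "\<dots> \<le> 40 * d * norm y * (1 / 2) ^ k" using d by (intro mult_right_mono) auto
      finally have "norm (y - T x) < e" using k(1) by linarith
      then show "\<exists>v\<in>range T. norm (y - v) < e" by blast
    qed
  qed
  then have "closure ?U \<subseteq> range T" using cl by (metis closure_minimal closure_closed)
  then have surj: "surj T" using dense by auto
  have y0U: "y0 \<in> E (M (2 * 0))" using y0 M0 by simp
  have "y0 \<in> ?U" using y0 by blast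
  then have Ty0: "T y0 = T0 y0" by (rule T(2))
  \<comment> \<open>\<open>16 * d\<close> is the distance from the limit to the map of index
    \<open>0\<close>, and \<open>2 * d\<close> the error of that map at \<open>y0\<close>.\<close>
  have "norm (T y0 - x0) \<le> norm (T0 y0 - \<phi> (2 * 0) y0) + norm (\<phi> 0 y0 - x0)"
    using Ty0 norm_triangle_ineq[of "T0 y0 - \<phi> 0 y0" "\<phi> 0 y0 - x0"] by simp
  also have "\<dots> \<le> 18 * d" using T0(2)[OF y0U] y0 M0(2) by simp
  finally show ?thesis using that[OF T(1) surj Tn] by blast
qed

lemma unit_approx:
  assumes x: "norm x = 1" and e: "0 < e"
  obtains k u where "u \<in> E k" "norm u = 1" "norm (x - u) < e"
proof -
  define e' where "e' = min (e / 2) (1 / 2)"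
  have e': "0 < e'" "2 * e' \<le> e" "e' \<le> 1 / 2" using e by (auto simp: e'_def)
  obtain v k where v: "v \<in> E k" "norm (x - v) < e'"
    using dense_iff_norm[of x "\<Union>n. E n"] dense e'(1) by auto
  have "\<bar>norm x - norm v\<bar> \<le> norm (x - v)" by (rule norm_triangle_ineq3)
  then have nv: "\<bar>1 - norm v\<bar> < e'" using v x by simp
  then have nv0: "norm v > 0" using e' by linarith
  define u where "u = (1 / norm v) *\<^sub>R v"
  have "norm (v - u) = \<bar>1 - norm v\<bar>"
  proof -
    have "v - u = (1 - 1 / norm v) *\<^sub>R v" by (simp add: u_def scaleR_diff_left)
    then have "norm (v - u) = \<bar>1 - 1 / norm v\<bar> * norm v" by simp
    also have "\<dots> = \<bar>(1 - 1 / norm v) * norm v\<bar>" by (simp only: abs_mult abs_norm_cancel)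
    also have "(1 - 1 / norm v) * norm v = norm v - 1" using nv0 by (simp add: field_simps)
    finally show ?thesis by simp
  qed
  then have "norm (x - u) < e" using norm_triangle_ineq[of "x - v" "v - u"] v nv e' by simp
  moreover have "norm u = 1" "u \<in> E k" using nv0 v subspace_scale[OF E_subspace] by (auto simp: u_def)
  ultimately show ?thesis using that by blast
qed

lemma almost_transitive_norm: "almost_transitive (norm :: 'a \<Rightarrow> real)"
  unfolding almost_transitive_def
proof (intro allI impI)
  fix x y :: 'a and e :: real
  assume xy: "norm x = 1" "norm y = 1" and e: "0 < e"
  have e3: "0 < e / 3" using e by simp
  obtain k u where u: "u \<in> E k" "norm u = 1" "norm (x - u) < e / 3" using unit_approx[OF xy(1) e3] .
  obtain l w where w: "w \<in> E l" "norm w = 1" "norm (y - w) < e / 3" using unit_approx[OF xy(2) e3] .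
  \<comment> \<open>\<open>54\<close> is three times \<open>18\<close>, so that each of the three
    errors is at most a third of \<open>e\<close>.\<close>
  define d where "d = min 1 (e / 54)"
  have d: "0 < d" "d \<le> 1" "18 * d \<le> e / 3" using e by (auto simp: d_def)
  have "u \<in> E (max k l)" "w \<in> E (max k l)" using u w E_mono[of k "max k l"] E_mono[of l "max k l"] by auto
  then obtain T where T: "bounded_linear T" "surj T" "\<And>x. norm (T x) = norm x" "norm (T u - w) \<le> 18 * d"
    using skeleton_isometry[of w "max k l" u d] u w d by blast
  have lT: "linear T" using T(1) by (rule bounded_linear.linear)
  have "y - T x = (y - w) - (T u - w) - T (x - u)" by (simp add: linear_diff[OF lT])
  then have "norm (y - T x) \<le> norm (y - w) + norm (T u - w) + norm (T (x - u))"
    by (smt (verit) norm_triangle_ineq4)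
  also have "\<dots> \<le> e" using u w T d by simp
  finally show "\<exists>T. linear T \<and> surj T \<and> (\<forall>z. norm (T z) = norm z) \<and> norm (y - T x) \<le> e"
    using lT T by blast
qed


text \<open>The amalgam of \<open>E n\<close> with the larger space \<open>A'\<close> along
  \<open>J\<close> on \<open>A\<close>; its contractions are the damped \<open>J \<circ> Q\<close>
  and \<open>T\<close>. The new retraction extends the damped \<open>T\<close>, which is why it
  stays close to \<open>T\<close> on \<open>E n\<close>.\<close>

lemma chain_step:
  assumes P: "retract_pair \<delta> A N n J T" and \<delta>: "0 < \<delta>" "0 < \<delta>'"
    and A': "fin_dim_subspace A'" "A \<subseteq> A'" "subspace A" and N: "norm_on A' N"
    and Q: "linear Q" "\<And>f. f \<in> A' \<Longrightarrow> Q f \<in> A" "\<And>f. f \<in> A \<Longrightarrow> Q f = f" "\<And>f. f \<in> A' \<Longrightarrow> N (Q f) \<le> N f"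
  obtains m J' T' where "n < m" "retract_pair \<delta>' A' N m J' T'"
    "\<And>c. c \<in> A \<Longrightarrow> norm (J' c - J c) \<le> (1 + \<delta>') * (\<delta> * N c)"
    "\<And>e. e \<in> E n \<Longrightarrow> N (T' e - T e) \<le> \<delta> * norm e"
proof -
  note p = retract_pairD[OF P]
  have sE: "seminorm_on (E n) norm" by (rule norm_on_seminorm[OF norm_on_norm[OF E_subspace]])
  have sA: "seminorm_on A N" by (rule norm_on_seminorm[OF norm_on_subset[OF N A'(3,2)]])
  note s = seminorm_onD[OF sA] and s' = seminorm_onD[OF norm_on_seminorm[OF N]]
  have g: "seminorm_on A (\<lambda>c. \<delta> * N c)"
    unfolding seminorm_on_def using s(1,2,3) \<delta> by (auto simp: mult_left_mono simp flip: distrib_left)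
  define K where "K = (1 + \<delta>) / \<delta>"
  have K: "K * (\<delta> * x) = (1 + \<delta>) * x" for x using \<delta> by (simp add: K_def)
  obtain m J' T' where r: "n \<le> m" "linear J'" "linear T'" "\<And>f. f \<in> A' \<Longrightarrow> J' f \<in> E m" "\<And>x. T' x \<in> A'"
    "\<And>f. f \<in> A' \<Longrightarrow> T' (J' f) = f" "\<And>f. f \<in> A' \<Longrightarrow> norm (J' f) \<le> (1 + \<delta>') * N f"
    "\<And>x. N (T' x) \<le> (1 + \<delta>') * norm x" "\<And>c. c \<in> A \<Longrightarrow> norm (J' (id c) - J c) \<le> (1 + \<delta>') * (\<delta> * N c)"
    "\<And>e. e \<in> E n \<Longrightarrow> T' e = (1 / (1 + \<delta>)) *\<^sub>R T e"
  proof (rule amalgam[OF A'(1) N g, of J n id "\<lambda>x. (1 / (1 + \<delta>)) *\<^sub>R J (Q x)" "\<lambda>x. (1 / (1 + \<delta>)) *\<^sub>R T x" K \<delta>'], goal_cases)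
    case 1 show ?case by (rule p)
  next
    case 3 show ?case by (rule linear_id)
  next
    case 5 show ?case using linear_damped[OF linear_compose[OF Q(1) p(1)]] by (simp add: o_def)
  next
    case (6 f) then show ?case by (intro subspace_scale[OF E_subspace] p Q)
  next
    case (7 f)
    have "norm (J (Q f)) \<le> (1 + \<delta>) * N f"
      by (rule order_trans[OF p(5)[OF Q(2)[OF \<open>f \<in> A'\<close>]] mult_left_mono[OF Q(4)[OF \<open>f \<in> A'\<close>]]]) (use \<delta> in simp)
    then show ?case by (intro damped_contraction[OF sE p(3)] \<delta> Q \<open>f \<in> A'\<close>)
  next
    case 8 show ?case by (intro linear_damped p)
  next
    case (9 e) then show ?case using A'(2) by (intro subspace_scale[OF s'(1)]) (auto intro: p)
  next
    case (10 e) then show ?case by (intro damped_contraction[OF sA p(6) p(7)] \<delta>)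
  next
    case (11 c) then show ?case using retract_pair_low[OF P \<delta>(1)] p(5)[OF \<open>c \<in> A\<close>] by (simp add: algebra_simps)
  next
    case (12 c)
    show ?case using damped_distance[OF sE p(3)[OF \<open>c \<in> A\<close>] p(5)[OF \<open>c \<in> A\<close>] \<delta>(1)] Q(3)[OF \<open>c \<in> A\<close>]
      by (simp add: norm_minus_commute)
  next
    case (13 c)
    have "N ((1 / (1 + \<delta>)) *\<^sub>R c - c) \<le> \<delta> * N c"
      by (rule damped_distance[OF sA]) (use \<open>c \<in> A\<close> s(6)[OF \<open>c \<in> A\<close>] \<delta> in \<open>auto simp: algebra_simps\<close>)
    then show ?case using p(4)[OF \<open>c \<in> A\<close>] by simp
  next
    case (14 c) then show ?case using p(5)[OF \<open>c \<in> A\<close>] unfolding K by simp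
  next
    case (15 c) then show ?case using s(6)[OF \<open>c \<in> A\<close>] \<delta> unfolding K by (simp add: algebra_simps)
  qed (use p \<delta> A' in auto)
  show ?thesis
  proof (rule that[of "max m (Suc n)" J' T'])
    show "retract_pair \<delta>' A' N (max m (Suc n)) J' T'"
      unfolding retract_pair_def using r E_mono[of m "max m (Suc n)"] by auto
    show "norm (J' c - J c) \<le> (1 + \<delta>') * (\<delta> * N c)" if "c \<in> A" for c using r(9)[OF that] by simp
    show "N (T' e - T e) \<le> \<delta> * norm e" if "e \<in> E n" for e
      using damped_distance[OF sA p(6)[OF that] p(7)[OF that] \<delta>(1)] r(10)[OF that] by simp
  qed simp
qed

text \<open>The pairs \<open>J k\<close>, \<open>T k\<close> for \<open>F k\<close> change by
  geometrically small amounts, so \<open>J k\<close> converges to an isometric embedding and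
  \<open>J k \<circ> T k\<close> to a projection. The domain need not be complete, so the range of
  \<open>P\<close> is located only in the closure of the range of \<open>J\<close>.\<close>

lemma complementably_universal:
  fixes F :: "nat \<Rightarrow> 'b::real_vector set"
  assumes N: "norm_on UNIV N" and F: "\<And>k. fin_dim_subspace (F k)" "\<And>k. F k \<subseteq> F (Suc k)" "F 0 = {0}"
    and Q: "\<And>k. linear (Q k)" "\<And>k f. Q k f \<in> F k" "\<And>k f. f \<in> F k \<Longrightarrow> Q k f = f" "\<And>k f. N (Q k f) \<le> N f"
    and F_dense: "\<And>f e. 0 < e \<Longrightarrow> \<exists>k. \<exists>v\<in>F k. N (f - v) < e"
  obtains J :: "'b \<Rightarrow> 'a" and P where "linear J" "\<And>f. norm (J f) = N f" "bounded_linear P"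
    "\<And>f. P (J f) = J f" "\<And>x. P x \<in> closure (range J)"
proof -
  note s = seminorm_onD[OF norm_on_seminorm[OF N], simplified]
  define \<delta> where "\<delta> k = (1 / 2 :: real) ^ k" for k :: nat
  have \<delta>0: "0 < \<delta> k" and \<delta>1: "\<delta> k \<le> 1" for k by (auto simp: \<delta>_def power_le_one)
  have NF: "norm_on (F k) N" for k by (rule norm_on_subset[OF N]) (use F(1) fin_dim_subspace_subspace in auto)
  have sF: "subspace (F k)" for k using F(1) fin_dim_subspace_subspace by blast
  have Fm: "F k \<subseteq> F l" if "k \<le> l" for k l using F(2) that by (rule lift_Suc_mono_le)
  define R where "R k s = (case s of (n, J, T) \<Rightarrow> retract_pair (\<delta> k) (F k) N n J T)"
    for k :: nat and s :: "nat \<times> ('b \<Rightarrow> 'a) \<times> ('a \<Rightarrow> 'b)"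
  define S where "S k s s' = (case s of (n, J, T) \<Rightarrow> case s' of (n', J', T') \<Rightarrow>
      n < n' \<and> (\<forall>c\<in>F k. norm (J' c - J c) \<le> 2 * \<delta> k * N c) \<and> (\<forall>e\<in>E n. N (T' e - T e) \<le> \<delta> k * norm e))"
    for k :: nat and s s' :: "nat \<times> ('b \<Rightarrow> 'a) \<times> ('a \<Rightarrow> 'b)"
  have "\<exists>f. \<forall>k. R k (f k) \<and> S k (f k) (f (Suc k))"
  proof (rule dependent_nat_choice)
    have "R 0 (0, \<lambda>_. 0, \<lambda>_. 0)"
      unfolding R_def retract_pair_def using F(3) subspace_0[OF E_subspace] s(4) \<delta>0[of 0] by (auto simp: linear_zero)
    then show "\<exists>s. R 0 s" by blast
  next
    fix s k assume "R k s"
    then obtain n J T where st: "s = (n, J, T)" "retract_pair (\<delta> k) (F k) N n J T"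
      by (auto simp: R_def split: prod.splits)
    obtain m J' T' where m: "n < m" "retract_pair (\<delta> (Suc k)) (F (Suc k)) N m J' T'"
      "\<And>c. c \<in> F k \<Longrightarrow> norm (J' c - J c) \<le> (1 + \<delta> (Suc k)) * (\<delta> k * N c)"
      "\<And>e. e \<in> E n \<Longrightarrow> N (T' e - T e) \<le> \<delta> k * norm e"
      by (rule chain_step[OF st(2) \<delta>0 \<delta>0[of "Suc k"] F(1) F(2) sF NF, of "Q k"]) (use Q in auto)
    have "(1 + \<delta> (Suc k)) * (\<delta> k * N c) \<le> 2 * \<delta> k * N c" for c
      using \<delta>1[of "Suc k"] \<delta>0[of k] s(6)[of c] mult_right_mono[of "1 + \<delta> (Suc k)" 2 "\<delta> k * N c"] by simp
    then have "norm (J' c - J c) \<le> 2 * \<delta> k * N c" if "c \<in> F k" for c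
      using m(3)[OF that] order_trans by blast
    then have "R (Suc k) (m, J', T') \<and> S k s (m, J', T')" using m by (simp add: R_def S_def st)
    then show "\<exists>s'. R (Suc k) s' \<and> S k s s'" by blast
  qed
  then obtain f where f: "\<And>k. R k (f k)" "\<And>k. S k (f k) (f (Suc k))" by blast
  define M where "M k = fst (f k)" for k
  define J where "J k = fst (snd (f k))" for k
  define T where "T k = snd (snd (f k))" for k
  have fk: "f k = (M k, J k, T k)" for k by (simp add: M_def J_def T_def)
  have Pk: "retract_pair (\<delta> k) (F k) N (M k) (J k) (T k)" for k using f(1)[of k] by (simp add: fk R_def)
  have M1: "M k < M (Suc k)" and dJ: "\<And>c. c \<in> F k \<Longrightarrow> norm (J (Suc k) c - J k c) \<le> 2 * \<delta> k * N c"
    and dT: "\<And>e. e \<in> E (M k) \<Longrightarrow> N (T (Suc k) e - T k e) \<le> \<delta> k * norm e" for k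
    using f(2)[of k] by (auto simp: fk S_def)
  note p = retract_pairD[OF Pk]
  have sm: "strict_mono M" using M1 by (simp add: strict_mono_Suc_iff)
  have Mmono: "E (M k) \<subseteq> E (M l)" if "k \<le> l" for k l
    using that sm by (intro E_mono) (simp add: strict_mono_less_eq)
  have inU: "\<exists>K. e \<in> E (M K)" if e: "e \<in> (\<Union>n. E n)" for e
  proof -
    obtain j where "e \<in> E j" using e by blast
    moreover have "j \<le> M j" using strict_mono_imp_increasing[OF sm] by blast
    ultimately show ?thesis using E_mono[of j "M j"] by auto
  qed
  have two: "(1 + \<delta> k) * x \<le> 2 * x" if "0 \<le> x" for k x using \<delta>1[of k] that by (intro mult_right_mono) auto
  have J2: "norm (J k c) \<le> 2 * N c" if "c \<in> F k" for k c using p(5)[OF that] two[OF s(6)] order_trans by blast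
  have T2: "N (T k e) \<le> 2 * norm e" if "e \<in> E (M k)" for k e using p(7)[OF that] two[OF norm_ge_zero] order_trans by blast
  have \<delta>z: "(\<lambda>k. a * \<delta> k) \<longlonglongrightarrow> 0" for a
  proof -
    have "(\<lambda>k. a * (1 / 2) ^ k) \<longlonglongrightarrow> a * 0" by (intro tendsto_intros LIMSEQ_power_zero) auto
    then show ?thesis by (simp add: \<delta>_def)
  qed
  define V where "V = (\<Union>k. F k)"
  have sV: "subspace V" unfolding V_def by (rule subspace_chain_Union[of F, OF sF F(2)])
  define J0 where "J0 c = lim (\<lambda>k. J k c)" for c
  have J0: "(\<lambda>k. J k c) \<longlonglongrightarrow> J0 c" "norm (J0 c - J K c) \<le> 4 * N c * \<delta> K" if c: "c \<in> F K" for c K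
  proof -
    have "norm (J (Suc k) c - J k c) \<le> (2 * N c) * (1 / 2) ^ k" if "K \<le> k" for k
      using dJ[of c k] c Fm[OF that] by (auto simp: \<delta>_def mult_ac)
    then obtain l where l: "(\<lambda>k. J k c) \<longlonglongrightarrow> l" "\<And>k. K \<le> k \<Longrightarrow> norm (l - J k c) \<le> 2 * (2 * N c) * (1 / 2) ^ k"
      using geometric_limit[of K "\<lambda>k. J k c" "2 * N c"] by blast
    have "J0 c = l" unfolding J0_def using l(1) by (rule limI)
    then show "(\<lambda>k. J k c) \<longlonglongrightarrow> J0 c" "norm (J0 c - J K c) \<le> 4 * N c * \<delta> K"
      using l(1) l(2)[of K] by (auto simp: \<delta>_def)
  qed
  have J0l: "(\<lambda>k. J k c) \<longlonglongrightarrow> J0 c" if "c \<in> V" for c using that J0(1) by (auto simp: V_def)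
  have lJ0: "lin_on V J0"
    unfolding lin_on_def
  proof (intro conjI ballI allI)
    fix x y assume x: "x \<in> V" "y \<in> V"
    have "(\<lambda>k. J k (x + y)) \<longlonglongrightarrow> J0 x + J0 y"
      unfolding linear_add[OF p(1)] by (intro tendsto_add J0l x)
    then show "J0 (x + y) = J0 x + J0 y" using LIMSEQ_unique J0l[OF subspace_add[OF sV x]] by blast
  next
    fix x a assume x: "x \<in> V"
    have "(\<lambda>k. J k (a *\<^sub>R x)) \<longlonglongrightarrow> a *\<^sub>R J0 x"
      unfolding linear_scale[OF p(1)] by (intro tendsto_intros J0l x)
    then show "J0 (a *\<^sub>R x) = a *\<^sub>R J0 x" using LIMSEQ_unique J0l[OF subspace_scale[OF sV x]] by blast
  qed
  have \<delta>lim: "(\<lambda>k. 1 + \<delta> k) \<longlonglongrightarrow> 1" using tendsto_add[OF tendsto_const \<delta>z[of 1], of 1] by simp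
  have J0norm: "norm (J0 c) = N c" if c: "c \<in> V" for c
  proof -
    obtain K where K: "c \<in> F K" using c by (auto simp: V_def)
    have ck: "c \<in> F k" if "K \<le> k" for k using K Fm[OF that] by auto
    have n: "(\<lambda>k. norm (J k c)) \<longlonglongrightarrow> norm (J0 c)" by (intro tendsto_intros J0l c)
    show ?thesis
    proof (rule antisym)
      have "(\<lambda>k. (1 + \<delta> k) * N c) \<longlonglongrightarrow> 1 * N c" by (intro tendsto_mult \<delta>lim tendsto_const)
      then show "norm (J0 c) \<le> N c" using LIMSEQ_le[OF n] p(5)[OF ck] by auto
      have "(\<lambda>k. (1 + \<delta> k) * norm (J k c)) \<longlonglongrightarrow> 1 * norm (J0 c)" by (intro tendsto_mult \<delta>lim n)
      then show "N c \<le> norm (J0 c)"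
        using LIMSEQ_le_const[of "\<lambda>k. (1 + \<delta> k) * norm (J k c)" "norm (J0 c)" "N c"] p(8)[OF ck] by auto
    qed
  qed
  let ?U = "\<Union>n. E n"
  \<comment> \<open>The change of \<open>T\<close> contributes
    \<open>2 * \<delta> k * norm e\<close>, the change of \<open>J\<close> contributes
    \<open>4 * \<delta> k * norm e\<close>.\<close>
  have step: "norm (J (Suc k) (T (Suc k) e) - J k (T k e)) \<le> (6 * norm e) * (1 / 2) ^ k" if e: "e \<in> E (M k)" for k e
  proof -
    have e': "e \<in> E (M (Suc k))" using e Mmono[of k "Suc k"] by auto
    have i: "T k e \<in> F (Suc k)" "T (Suc k) e \<in> F (Suc k)" using p(6)[OF e] p(6)[OF e'] F(2) by auto
    have "J (Suc k) (T (Suc k) e) - J k (T k e) = J (Suc k) (T (Suc k) e - T k e) + (J (Suc k) (T k e) - J k (T k e))"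
      by (simp add: linear_diff[OF p(1)])
    then have "norm (J (Suc k) (T (Suc k) e) - J k (T k e)) \<le> norm (J (Suc k) (T (Suc k) e - T k e)) + norm (J (Suc k) (T k e) - J k (T k e))"
      using norm_triangle_ineq by metis
    also have "norm (J (Suc k) (T (Suc k) e - T k e)) \<le> 2 * N (T (Suc k) e - T k e)"
      by (intro J2 subspace_diff[OF sF] i)
    also have "N (T (Suc k) e - T k e) \<le> \<delta> k * norm e" by (rule dT[OF e])
    also have "norm (J (Suc k) (T k e) - J k (T k e)) \<le> 2 * \<delta> k * N (T k e)" by (rule dJ[OF p(6)[OF e]])
    also have "2 * \<delta> k * N (T k e) \<le> 2 * \<delta> k * (2 * norm e)" using T2[OF e] \<delta>0[of k] by (intro mult_left_mono) auto
    finally show ?thesis by (simp add: \<delta>_def)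
  qed
  define P0 where "P0 e = lim (\<lambda>k. J k (T k e))" for e
  have P0: "(\<lambda>k. J k (T k e)) \<longlonglongrightarrow> P0 e" "norm (P0 e - J K (T K e)) \<le> 12 * norm e * \<delta> K" if e: "e \<in> E (M K)" for e K
  proof -
    have "norm (J (Suc k) (T (Suc k) e) - J k (T k e)) \<le> (6 * norm e) * (1 / 2) ^ k" if "K \<le> k" for k
      using e Mmono[OF that] by (intro step) auto
    then obtain l where l: "(\<lambda>k. J k (T k e)) \<longlonglongrightarrow> l" "\<And>k. K \<le> k \<Longrightarrow> norm (l - J k (T k e)) \<le> 2 * (6 * norm e) * (1 / 2) ^ k"
      using geometric_limit[of K "\<lambda>k. J k (T k e)" "6 * norm e"] by blast
    have "P0 e = l" unfolding P0_def using l(1) by (rule limI)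
    then show "(\<lambda>k. J k (T k e)) \<longlonglongrightarrow> P0 e" "norm (P0 e - J K (T K e)) \<le> 12 * norm e * \<delta> K"
      using l(1) l(2)[of K] by (auto simp: \<delta>_def)
  qed
  have P0l: "(\<lambda>k. J k (T k e)) \<longlonglongrightarrow> P0 e" if "e \<in> ?U" for e using inU[OF that] P0(1) by blast
  have lP0: "lin_on ?U P0"
    unfolding lin_on_def
  proof (intro conjI ballI allI)
    fix x y assume x: "x \<in> ?U" "y \<in> ?U"
    have "(\<lambda>k. J k (T k (x + y))) \<longlonglongrightarrow> P0 x + P0 y"
      unfolding linear_add[OF p(1)] linear_add[OF p(2)] by (intro tendsto_add P0l x)
    then show "P0 (x + y) = P0 x + P0 y" using LIMSEQ_unique P0l[OF subspace_add[OF union_subspace x]] by blast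
  next
    fix x a assume x: "x \<in> ?U"
    have "(\<lambda>k. J k (T k (a *\<^sub>R x))) \<longlonglongrightarrow> a *\<^sub>R P0 x"
      unfolding linear_scale[OF p(1)] linear_scale[OF p(2)] by (intro tendsto_intros P0l x)
    then show "P0 (a *\<^sub>R x) = a *\<^sub>R P0 x" using LIMSEQ_unique P0l[OF subspace_scale[OF union_subspace x]] by blast
  qed
  have bP0: "norm (P0 e) \<le> 4 * norm e" if "e \<in> ?U" for e
  proof -
    obtain K where K: "e \<in> E (M K)" using inU \<open>e \<in> ?U\<close> by blast
    have "norm (J k (T k e)) \<le> 4 * norm e" if "K \<le> k" for k
    proof -
      have ek: "e \<in> E (M k)" using K Mmono[OF that] by auto
      show ?thesis using J2[OF p(6)[OF ek]] T2[OF ek] by simp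
    qed
    then show ?thesis using LIMSEQ_le_const2[OF tendsto_norm[OF P0(1)[OF K]]] by blast
  qed
  obtain P where P: "bounded_linear P" "\<And>x. x \<in> ?U \<Longrightarrow> P x = P0 x" "\<And>x. norm (P x) \<le> 4 * norm x"
    using bounded_linear_extension[OF union_subspace dense lP0 bP0 zero_le_numeral] by blast
  have cP: "continuous_on UNIV P" using linear_continuous_on[OF P(1)] .
  \<comment> \<open>\<open>J k c\<close> is fixed by \<open>J k \<circ> T k\<close>, so
    \<open>P\<close> moves it by at most \<open>12 * norm (J k c) * \<delta> k\<close>, which tends
    to \<open>0\<close>.\<close>
  have PJ0: "P (J0 c) = J0 c" if c: "c \<in> V" for c
  proof -
    obtain K where K: "c \<in> F K" using c by (auto simp: V_def)
    have lim1: "(\<lambda>k. P (J k c)) \<longlonglongrightarrow> P (J0 c)" by (intro bounded_linear.tendsto[OF P(1)] J0l c)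
    have "norm (P (J k c) - J k c) \<le> (24 * N c) * \<delta> k" if "K \<le> k" for k
    proof -
      have ck: "c \<in> F k" using K Fm[OF that] by auto
      have "norm (P0 (J k c) - J k (T k (J k c))) \<le> 12 * norm (J k c) * \<delta> k" by (rule P0(2)[OF p(3)[OF ck]])
      also have "\<dots> \<le> 24 * N c * \<delta> k" using J2[OF ck] \<delta>0[of k] by (intro mult_right_mono mult_left_mono) auto
      finally have "norm (P0 (J k c) - J k (T k (J k c))) \<le> 24 * N c * \<delta> k" .
      moreover have "J k c \<in> ?U" using p(3)[OF ck] by blast
      ultimately show ?thesis using P(2) p(4)[OF ck] by simp
    qed
    then have "\<forall>\<^sub>F k in sequentially. norm (P (J k c) - J k c) \<le> (24 * N c) * \<delta> k"
      unfolding eventually_sequentially by blast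
    then have "(\<lambda>k. P (J k c) - J k c) \<longlonglongrightarrow> 0" by (rule Lim_null_comparison[OF _ \<delta>z])
    from tendsto_add[OF this J0l[OF c]] have "(\<lambda>k. P (J k c)) \<longlonglongrightarrow> J0 c" by simp
    then show ?thesis using lim1 LIMSEQ_unique by blast
  qed
  \<comment> \<open>\<open>P x\<close> is the limit of \<open>J k (T k x)\<close>, and
    \<open>J k\<close> differs from its limit at \<open>T k x\<close> by at most a multiple of
    \<open>\<delta> k\<close>.\<close>
  have Pcl: "P x \<in> closure (J0 ` V)" for x
  proof -
    have "P x \<in> closure (J0 ` V)" if x: "x \<in> ?U" for x
    proof -
      obtain K where K: "x \<in> E (M K)" using inU[OF x] by blast
      have xk: "x \<in> E (M k)" if "K \<le> k" for k using K Mmono[OF that] by auto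
      have "norm (J0 (T k x) - J k (T k x)) \<le> (8 * norm x) * \<delta> k" if "K \<le> k" for k
      proof -
        have "norm (J0 (T k x) - J k (T k x)) \<le> 4 * N (T k x) * \<delta> k" by (rule J0(2)[OF p(6)[OF xk[OF that]]])
        also have "\<dots> \<le> 4 * (2 * norm x) * \<delta> k" using T2[OF xk[OF that]] \<delta>0[of k] by (intro mult_right_mono mult_left_mono) auto
        finally show ?thesis by simp
      qed
      then have "\<forall>\<^sub>F k in sequentially. norm (J0 (T k x) - J k (T k x)) \<le> (8 * norm x) * \<delta> k"
        unfolding eventually_sequentially by blast
      then have "(\<lambda>k. J0 (T k x) - J k (T k x)) \<longlonglongrightarrow> 0" by (rule Lim_null_comparison[OF _ \<delta>z])
      from tendsto_add[OF this P0l[OF x]] have "(\<lambda>k. J0 (T k x)) \<longlonglongrightarrow> P x" using P(2)[OF x] by simp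
      moreover have "\<forall>\<^sub>F k in sequentially. J0 (T k x) \<in> closure (J0 ` V)"
        unfolding eventually_sequentially
      proof (intro exI[of _ K] allI impI)
        fix k assume "K \<le> k"
        then have "T k x \<in> V" using p(6)[OF xk] by (auto simp: V_def)
        then show "J0 (T k x) \<in> closure (J0 ` V)" using closure_subset[of "J0 ` V"] by blast
      qed
      ultimately show ?thesis using Lim_in_closed_set[OF closed_closure] by (metis sequentially_bot)
    qed
    then have "P ` closure ?U \<subseteq> closure (J0 ` V)"
      by (intro order_trans[OF continuous_image_closure_subset[OF cP]] closure_minimal) auto
    then show ?thesis using dense by auto
  qed
  have lid: "linear (id :: 'b \<Rightarrow> 'b)" by (rule linear_id)
  have bJ0: "norm (J0 v) \<le> 1 * N (id v)" if "v \<in> V" for v using J0norm[OF that] by simp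
  obtain J1 where J1: "\<And>v. v \<in> V \<Longrightarrow> J1 (id v) = J0 v" "lin_on {y. \<forall>e>0. \<exists>v\<in>V. N (y - id v) < e} J1"
    "\<And>y. \<forall>e>0. \<exists>v\<in>V. N (y - id v) < e \<Longrightarrow> norm (J1 y) \<le> 1 * N y"
    using extend_by_density[OF sV lid lJ0 norm_on_seminorm[OF N] bJ0 zero_le_one] by blast
  have Vd: "\<exists>v\<in>V. N (y - v) < e" if "0 < e" for y e using F_dense[OF that, of y] by (auto simp: V_def)
  have lJ1: "linear J1" using J1(2) Vd unfolding lin_on_def by (intro linearI) auto
  have J1le: "norm (J1 y) \<le> N y" for y using J1(3)[of y] Vd by simp
  have J1V: "J1 v = J0 v" if "v \<in> V" for v using J1(1)[OF that] by simp
  have J1n: "norm (J1 y) = N y" for y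
  proof (rule antisym[OF J1le])
    show "N y \<le> norm (J1 y)"
    proof (rule field_le_epsilon)
      fix e :: real assume "0 < e"
      then obtain v where v: "v \<in> V" "N (y - v) < e / 2" using Vd[of "e / 2"] by auto
      have "N y \<le> N v + N (y - v)" by (rule s(8))
      also have "N v = norm (J1 v)" using J1V[OF v(1)] J0norm[OF v(1)] by simp
      also have "J1 v = J1 y - J1 (y - v)" by (simp add: linear_diff[OF lJ1])
      also have "norm \<dots> \<le> norm (J1 y) + norm (J1 (y - v))" by (rule norm_triangle_ineq4)
      finally show "N y \<le> norm (J1 y) + e" using J1le[of "y - v"] v(2) by linarith
    qed
  qed
  have "P (J1 y) = J1 y" for y
  proof -
    have "norm (P (J1 y) - J1 y) \<le> 0 + e" if e: "0 < e" for e
    proof -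
      obtain C where C: "C > 0" "\<And>x. norm (P x) \<le> norm x * C"
        using bounded_linear.pos_bounded[OF P(1)] by blast
      have "0 < e / (C + 1)" using e C by simp
      then obtain v where v: "v \<in> V" "N (y - v) < e / (C + 1)" using Vd by blast
      have "P (J1 y) - J1 y = P (J1 (y - v)) - J1 (y - v)"
        using PJ0[OF v(1)] J1V[OF v(1)] by (simp add: linear_diff[OF lJ1] linear_diff[OF bounded_linear.linear[OF P(1)]])
      then have "norm (P (J1 y) - J1 y) \<le> norm (P (J1 (y - v))) + norm (J1 (y - v))"
        using norm_triangle_ineq4 by metis
      also have "\<dots> \<le> (C + 1) * N (y - v)" using C(2)[of "J1 (y - v)"] J1n[of "y - v"] by (simp add: algebra_simps)
      also have "\<dots> \<le> (C + 1) * (e / (C + 1))" using v C by (intro mult_left_mono) auto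
      also have "\<dots> = e" using C by simp
      finally show ?thesis by simp
    qed
    then have "norm (P (J1 y) - J1 y) \<le> 0" by (rule field_le_epsilon)
    then show ?thesis by simp
  qed
  moreover have "P x \<in> closure (range J1)" for x
  proof -
    have "J0 ` V \<subseteq> range J1" using J1V by (metis image_subsetI rangeI)
    then show ?thesis using Pcl closure_mono by blast
  qed
  ultimately show ?thesis using that[OF lJ1 J1n P(1)] by blast
qed

end

section \<open>Vector valued step functions on the half line\<close>

text \<open>All generating cells start at \<open>0\<close>: other intervals are differences of two
  of them, and induction has a single case with one real parameter. For \<open>b \<le> 0\<close> the
  cell is the zero function.\<close>

inductive_set step_funs :: "(real \<Rightarrow> 'a::real_vector) set" where
  zero: "(\<lambda>_. 0) \<in> step_funs"
| add_cell: "f \<in> step_funs \<Longrightarrow> (\<lambda>t. f t + (if 0 \<le> t \<and> t < b then x else 0)) \<in> step_funs"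

lemma step_funs_cell: "(\<lambda>t. if 0 \<le> t \<and> t < b then x else 0) \<in> step_funs"
  using step_funs.add_cell[OF step_funs.zero, of b x] by simp

lemma step_funs_add:
  assumes "f \<in> step_funs" "g \<in> step_funs"
  shows "(\<lambda>t. f t + g t) \<in> step_funs"
  using assms(2)
proof (induction rule: step_funs.induct)
  case zero
  show ?case using assms(1) by simp
next
  case (add_cell g b x)
  show ?case using step_funs.add_cell[OF add_cell.IH, of b x] by (simp add: add.assoc)
qed

lemma step_funs_additive_op:
  assumes f: "f \<in> step_funs" and L0: "L (\<lambda>_. 0) = (\<lambda>_. 0)"
    and L: "\<And>f b x. f \<in> step_funs \<Longrightarrow> L (\<lambda>t. f t + (if 0 \<le> t \<and> t < b then x else 0)) =
        (\<lambda>t. L f t + L (\<lambda>t. if 0 \<le> t \<and> t < b then x else 0) t)"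
    and cell: "\<And>b x. L (\<lambda>t. if 0 \<le> t \<and> t < b then x else 0) \<in> step_funs"
  shows "L f \<in> step_funs"
  using f
proof (induction rule: step_funs.induct)
  case zero
  show ?case unfolding L0 by (rule step_funs.zero)
next
  case (add_cell f b x)
  show ?case unfolding L[OF add_cell.hyps] by (rule step_funs_add[OF add_cell.IH cell])
qed

lemma step_funs_scale: "f \<in> step_funs \<Longrightarrow> (\<lambda>t. c *\<^sub>R f t) \<in> step_funs"
proof (induction rule: step_funs.induct)
  case zero
  show ?case using step_funs.zero by simp
next
  case (add_cell f b x)
  have "(\<lambda>t. c *\<^sub>R (f t + (if 0 \<le> t \<and> t < b then x else 0))) =
      (\<lambda>t. c *\<^sub>R f t + (if 0 \<le> t \<and> t < b then c *\<^sub>R x else 0))"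
    by (auto simp: scaleR_add_right)
  then show ?case using step_funs.add_cell[OF add_cell.IH, of b "c *\<^sub>R x"] by simp
qed

lemma step_funs_interval:
  assumes "0 \<le> a"
  shows "(\<lambda>t. if a \<le> t \<and> t < c then x else 0) \<in> step_funs"
proof (cases "a < c")
  case True
  have "(\<lambda>t. if a \<le> t \<and> t < c then x else 0) =
      (\<lambda>t. (if 0 \<le> t \<and> t < c then x else 0) + (if 0 \<le> t \<and> t < a then - x else 0))"
    using True assms by auto
  then show ?thesis using step_funs_add[OF step_funs_cell step_funs_cell] by simp
next
  case False
  then have "(\<lambda>t. if a \<le> t \<and> t < c then x else 0) = (\<lambda>_. 0)" by (auto simp: fun_eq_iff)
  then show ?thesis using step_funs.zero by simp
qed

text \<open>The functions themselves, not classes modulo null sets: half-open cells make step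
  functions right continuous, so the p-norm already separates them.\<close>

typedef (overloaded) 'a stepf = "step_funs :: (real \<Rightarrow> 'a::real_vector) set"
  morphisms ev Stepf
  using step_funs.zero by blast

lemma ev_Stepf: "f \<in> step_funs \<Longrightarrow> ev (Stepf f) = f"
  by (rule Stepf_inverse)

lemma stepf_eqI: "(\<And>t. ev f t = ev g t) \<Longrightarrow> f = g"
  using ev_inject by blast

instantiation stepf :: (real_vector) real_vector
begin

definition "0 = Stepf (\<lambda>_. 0)"
definition "f + g = Stepf (\<lambda>t. ev f t + ev g t)"
definition "c *\<^sub>R f = Stepf (\<lambda>t. c *\<^sub>R ev f t)"
definition "- f = Stepf (\<lambda>t. (-1) *\<^sub>R ev f t)"
definition "f - g = Stepf (\<lambda>t. ev f t + (-1) *\<^sub>R ev g t)"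

lemma ev_0 [simp]: "ev 0 t = 0"
  by (simp add: zero_stepf_def ev_Stepf step_funs.zero)

lemma ev_add [simp]: "ev (f + g) t = ev f t + ev g t"
  by (simp add: plus_stepf_def ev_Stepf step_funs_add[OF ev ev])

lemma ev_scaleR [simp]: "ev (c *\<^sub>R f) t = c *\<^sub>R ev f t"
  by (simp add: scaleR_stepf_def ev_Stepf step_funs_scale[OF ev])

lemma ev_uminus [simp]: "ev (- f) t = - ev f t"
  unfolding uminus_stepf_def by (subst ev_Stepf[OF step_funs_scale[OF ev]]) simp

lemma ev_diff [simp]: "ev (f - g) t = ev f t - ev g t"
  unfolding minus_stepf_def by (subst ev_Stepf[OF step_funs_add[OF ev step_funs_scale[OF ev]]]) simp

instance
  by standard (rule stepf_eqI, simp add: algebra_simps)+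

end

definition cell :: "real \<Rightarrow> 'a::real_vector \<Rightarrow> 'a stepf" where
  "cell b x = Stepf (\<lambda>t. if 0 \<le> t \<and> t < b then x else 0)"

lemma ev_cell [simp]: "ev (cell b x) t = (if 0 \<le> t \<and> t < b then x else 0)"
  by (simp add: cell_def ev_Stepf[OF step_funs_cell])

lemma stepf_induct [case_names zero add]:
  assumes z: "P 0" and a: "\<And>f b x. 0 < b \<Longrightarrow> P f \<Longrightarrow> P (f + cell b x)"
  shows "P f"
proof -
  have "P (Stepf g)" if "g \<in> step_funs" for g
    using that
  proof (induction rule: step_funs.induct)
    case zero
    show ?case using z by (simp add: zero_stepf_def)
  next
    case (add_cell g b x)
    have eq: "Stepf (\<lambda>t. g t + (if 0 \<le> t \<and> t < b then x else 0)) = Stepf g + cell b x"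
      by (rule stepf_eqI) (simp add: ev_Stepf[OF step_funs.add_cell] ev_Stepf add_cell.hyps)
    show ?case
    proof (cases "0 < b")
      case True
      then show ?thesis unfolding eq using a add_cell.IH by blast
    next
      case False
      then have "cell b x = 0" by (intro stepf_eqI) auto
      then show ?thesis unfolding eq using add_cell.IH by simp
    qed
  qed
  from this[OF ev] show ?thesis by (simp add: ev_inverse)
qed

lemma linear_eq_stepf:
  assumes "linear A" "linear B" "\<And>b x. 0 < b \<Longrightarrow> A (cell b x) = B (cell b x)"
  shows "A f = B f"
  by (induction f rule: stepf_induct)
    (simp_all add: linear_0[OF assms(1)] linear_0[OF assms(2)] linear_add[OF assms(1)] linear_add[OF assms(2)] assms(3))

lemma cell_linear: "linear (cell b)"
  by (rule linearI; rule stepf_eqI) auto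

lemmas cell_add = linear_add[OF cell_linear] and cell_scale = linear_scale[OF cell_linear]
  and cell_diff = linear_diff[OF cell_linear] and cell_0 = linear_0[OF cell_linear]

lemma cell_nonpos: "b \<le> 0 \<Longrightarrow> cell b x = 0"
  by (rule stepf_eqI) auto

lemma ev_neg: "t < 0 \<Longrightarrow> ev f t = 0"
  by (induction f rule: stepf_induct) auto

lemma ev_bounded_support: "\<exists>n::nat. \<forall>t\<ge>real n. ev f t = 0"
proof (induction f rule: stepf_induct)
  case (add f b x)
  then obtain n :: nat where n: "\<forall>t\<ge>real n. ev f t = 0" by blast
  obtain m :: nat where "b \<le> real m" using real_arch_simple by blast
  then show ?case using n by (intro exI[of _ "max n m"]) auto
qed simp

section \<open>Restriction, translation, dilation and pointwise composition of step
  functions\<close>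

definition lift_op :: "((real \<Rightarrow> 'a::real_vector) \<Rightarrow> real \<Rightarrow> 'b::real_vector) \<Rightarrow> 'a stepf \<Rightarrow> 'b stepf" where
  "lift_op L f = Stepf (L (ev f))"

lemma ev_lift_op:
  assumes "L (\<lambda>_. 0) = (\<lambda>_. 0)"
    and "\<And>f b x. f \<in> step_funs \<Longrightarrow> L (\<lambda>t. f t + (if 0 \<le> t \<and> t < b then x else 0)) =
        (\<lambda>t. L f t + L (\<lambda>t. if 0 \<le> t \<and> t < b then x else 0) t)"
    and "\<And>b x. L (\<lambda>t. if 0 \<le> t \<and> t < b then x else 0) \<in> step_funs"
  shows "ev (lift_op L f) = L (ev f)"
  unfolding lift_op_def by (rule ev_Stepf[OF step_funs_additive_op[OF ev assms]])

definition restr :: "real \<Rightarrow> 'a::real_vector stepf \<Rightarrow> 'a stepf" where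
  "restr d = lift_op (\<lambda>g t. if t < d then g t else 0)"

lemma ev_restr [simp]: "ev (restr d f) t = (if t < d then ev f t else 0)"
  unfolding restr_def
proof (subst ev_lift_op)
  fix b :: real and x :: 'a
  have eq: "(\<lambda>t. if t < d then if 0 \<le> t \<and> t < b then x else 0 else 0) = (\<lambda>t. if 0 \<le> t \<and> t < min b d then x else 0)"
    by auto
  show "(\<lambda>t. if t < d then if 0 \<le> t \<and> t < b then x else 0 else 0) \<in> step_funs"
    unfolding eq by (rule step_funs_cell)
qed auto

text \<open>Translation by \<open>d\<close>, cut off at \<open>0\<close>; for \<open>d < 0\<close> this is a left shift.\<close>

definition shift :: "real \<Rightarrow> 'a::real_vector stepf \<Rightarrow> 'a stepf" where
  "shift d = lift_op (\<lambda>g t. if 0 \<le> t then g (t - d) else 0)"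

lemma ev_shift [simp]: "ev (shift d f) t = (if 0 \<le> t then ev f (t - d) else 0)"
  unfolding shift_def
proof (subst ev_lift_op)
  fix b :: real and x :: 'a
  have eq: "(\<lambda>t. if 0 \<le> t then if 0 \<le> t - d \<and> t - d < b then x else 0 else 0) =
      (\<lambda>t. if max 0 d \<le> t \<and> t < b + d then x else 0)"
    by (auto simp: fun_eq_iff)
  show "(\<lambda>t. if 0 \<le> t then if 0 \<le> t - d \<and> t - d < b then x else 0 else 0) \<in> step_funs"
    unfolding eq by (rule step_funs_interval) simp
qed auto

definition dilate :: "real \<Rightarrow> 'a::real_vector stepf \<Rightarrow> 'a stepf" where
  "dilate r = lift_op (\<lambda>g t. g (r * t))"

lemma ev_dilate:
  assumes "0 < r"
  shows "ev (dilate r f) t = ev f (r * t)"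
  unfolding dilate_def
proof (subst ev_lift_op)
  fix b :: real and x :: 'a
  have eq: "(\<lambda>t. if 0 \<le> r * t \<and> r * t < b then x else 0) = (\<lambda>t. if 0 \<le> t \<and> t < b / r then x else 0)"
    using assms by (auto simp: fun_eq_iff zero_le_mult_iff field_simps)
  show "(\<lambda>t. if 0 \<le> r * t \<and> r * t < b then x else 0) \<in> step_funs"
    unfolding eq by (rule step_funs_cell)
qed auto

text \<open>For a nonlinear \<open>G\<close> the induction runs over all \<open>G\<close> at once:
  on the new cell, \<open>G (z + x)\<close> is \<open>G z + G x\<close> plus a remainder that again
  vanishes at \<open>z = 0\<close>. This covers powers of the norm.\<close>

lemma step_funs_compose:
  assumes "f \<in> step_funs" "G 0 = 0"
  shows "(\<lambda>t. G (f t)) \<in> step_funs"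
  using assms
proof (induction arbitrary: G rule: step_funs.induct)
  case zero
  then show ?case using step_funs.zero by simp
next
  case (add_cell f b x)
  define H where "H z = G (z + x) - G z - G x" for z
  have H: "(\<lambda>t. H (f t)) \<in> step_funs" using add_cell.prems by (intro add_cell.IH) (simp add: H_def)
  have eq: "(\<lambda>t. G (f t + (if 0 \<le> t \<and> t < b then x else 0))) =
      (\<lambda>t. (G (f t) + ev (restr b (Stepf (\<lambda>t. H (f t)))) t) + (if 0 \<le> t \<and> t < b then G x else 0))"
  proof
    fix t
    show "G (f t + (if 0 \<le> t \<and> t < b then x else 0)) =
      (G (f t) + ev (restr b (Stepf (\<lambda>t. H (f t)))) t) + (if 0 \<le> t \<and> t < b then G x else 0)"
    proof -
      have e: "ev (Stepf (\<lambda>t. H (f t))) t = H (f t)" by (simp add: ev_Stepf[OF H])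
      show ?thesis
      proof (cases "0 \<le> t \<and> t < b")
        case True
        then show ?thesis using e by (simp add: H_def)
      next
        case False
        then show ?thesis using ev_neg[of t "Stepf (\<lambda>t. H (f t))"] by (cases "t < b") simp_all
      qed
    qed
  qed
  show ?case
    unfolding eq by (rule step_funs_add[OF step_funs_add[OF add_cell.IH[of G, OF add_cell.prems] ev] step_funs_cell])
qed

definition comp_step :: "('a::real_vector \<Rightarrow> 'b::real_vector) \<Rightarrow> 'a stepf \<Rightarrow> 'b stepf" where
  "comp_step G f = Stepf (\<lambda>t. G (ev f t))"

lemma ev_comp_step: "G 0 = 0 \<Longrightarrow> ev (comp_step G f) t = G (ev f t)"
  by (simp add: comp_step_def ev_Stepf[OF step_funs_compose[OF ev]])

lemma comp_step_linear: "linear G \<Longrightarrow> linear (comp_step G)"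
  by (rule linearI; rule stepf_eqI) (simp_all add: ev_comp_step linear_0 linear_add linear_scale)

lemma comp_step_cell: "G 0 = 0 \<Longrightarrow> comp_step G (cell b x) = cell b (G x)"
  by (rule stepf_eqI) (simp add: ev_comp_step)

lemma restr_linear: "linear (restr d)"
  by (rule linearI; rule stepf_eqI) auto

lemma shift_linear: "linear (shift d)"
  by (rule linearI; rule stepf_eqI) auto

lemma dilate_linear: "0 < r \<Longrightarrow> linear (dilate r)"
  by (rule linearI; rule stepf_eqI) (auto simp: ev_dilate)

lemma dilate_cell: "0 < r \<Longrightarrow> dilate r (cell b x) = cell (b / r) x"
  by (rule stepf_eqI) (auto simp: ev_dilate zero_le_mult_iff field_simps)

lemma dilate_dilate: "0 < r \<Longrightarrow> 0 < s \<Longrightarrow> dilate r (dilate s f) = dilate (r * s) f"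
  by (rule stepf_eqI) (simp add: ev_dilate mult_ac)

lemma dilate_1: "dilate 1 f = f"
  by (rule stepf_eqI) (simp add: ev_dilate)

lemma shift_cell: "0 \<le> d \<Longrightarrow> 0 \<le> b \<Longrightarrow> shift d (cell b x) = cell (d + b) x - cell d x"
  by (rule stepf_eqI) auto

lemma shift_left_right: "0 \<le> d \<Longrightarrow> shift (- d) (shift d f) = f"
  by (rule stepf_eqI) (simp add: ev_neg)

text \<open>Cutting at \<open>d\<close> and moving the tail back to \<open>0\<close> identifies the
  step functions with pairs of a function on \<open>[0, d)\<close> and an arbitrary step function.
  Isometries are built by acting on one part.\<close>

lemma restr_shift_split: "0 \<le> d \<Longrightarrow> f = restr d f + shift d (shift (- d) f)"
  by (rule stepf_eqI) (simp add: ev_neg)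

lemma restr_shift: "0 \<le> d \<Longrightarrow> restr d (restr d f + shift d g) = restr d f"
  by (rule stepf_eqI) (simp add: ev_neg)

lemma shift_left_restr: "0 \<le> d \<Longrightarrow> shift (- d) (restr d f + shift d g) = g"
  by (rule stepf_eqI) (simp add: ev_neg)

lemma restr_cell: "restr d (cell b x) = cell (min b d) x"
  by (rule stepf_eqI) auto

text \<open>This induction peels off the leftmost cell and leaves a translate of an arbitrary step
  function. \<open>R n\<close> collects the functions built from \<open>n\<close> successive cells;
  adding a cell \<open>[0, b)\<close> only refines the cut at \<open>b\<close>.\<close>

lemma stepf_induct_cell_shift:
  assumes z: "P 0" and s: "\<And>d y g. 0 < d \<Longrightarrow> P g \<Longrightarrow> P (cell d y + shift d g)"
  shows "P f"
proof -
  define R where "R = rec_nat {0} (\<lambda>_ X. {cell d y + shift d g | d y g. (0::real) < d \<and> g \<in> X} :: 'a stepf set)"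
  have R0: "R 0 = {0}" and RS: "R (Suc n) = {cell d y + shift d g | d y g. 0 < d \<and> g \<in> R n}" for n
    by (simp_all add: R_def)
  have RP: "g \<in> R n \<Longrightarrow> P g" for g n
    by (induction n arbitrary: g) (auto simp: R0 RS z s)
  have radd: "\<exists>m. g + cell b x \<in> R m" if "g \<in> R n" "0 < b" for g n b x
    using that
  proof (induction n arbitrary: g b x)
    case 0
    have "shift b (0 :: 'a stepf) = 0" by (rule linear_0[OF shift_linear])
    then have "g + cell b x = cell b x + shift b 0" using 0 by (simp add: R0)
    then have "g + cell b x \<in> R (Suc 0)" using 0 unfolding RS R0 by blast
    then show ?case by blast
  next
    case (Suc n)
    then obtain d y h where g: "g = cell d y + shift d h" "0 < d" "h \<in> R n" by (auto simp: RS)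
    consider "b = d" | "b < d" | "d < b" by linarith
    then show ?case
    proof cases
      case 1
      then have "g + cell b x = cell d (y + x) + shift d h" by (simp add: g cell_add)
      then have "g + cell b x \<in> R (Suc n)" unfolding RS using g by blast
      then show ?thesis by blast
    next
      case 2
      have "g + cell b x = cell b (y + x) + shift b (cell (d - b) y + shift (d - b) h)"
        by (rule stepf_eqI) (use 2 \<open>0 < b\<close> in \<open>auto simp: g ev_neg\<close>)
      moreover have "0 < d - b" using 2 by simp
      then have "cell (d - b) y + shift (d - b) h \<in> R (Suc n)" unfolding RS using g(3) by blast
      ultimately have "g + cell b x \<in> R (Suc (Suc n))" unfolding RS[of "Suc n"] using \<open>0 < b\<close> by blast
      then show ?thesis by blast
    next
      case 3
      then obtain m where m: "h + cell (b - d) x \<in> R m" using Suc.IH[OF g(3), of "b - d"] by auto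
      have "g + cell b x = cell d (y + x) + shift d (h + cell (b - d) x)"
        by (rule stepf_eqI) (use 3 g(2) in \<open>auto simp: g(1) ev_neg\<close>)
      then have "g + cell b x \<in> R (Suc m)" unfolding RS using g(2) m by blast
      then show ?thesis by blast
    qed
  qed
  have "\<exists>n. f \<in> R n"
  proof (induction f rule: stepf_induct)
    case zero
    show ?case using R0 by blast
  next
    case (add f b x)
    then show ?case using radd by blast
  qed
  then show ?thesis using RP by blast
qed

section \<open>Integrals of step functions\<close>

definition intg :: "'a::banach stepf \<Rightarrow> 'a" where
  "intg f = integral UNIV (ev f)"

lemma has_integral_cell: "0 \<le> b \<Longrightarrow> (ev (cell b x) has_integral b *\<^sub>R x) UNIV"
  for x :: "'a::banach"
proof -
  assume b: "0 \<le> b"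
  have "((\<lambda>t. x) has_integral (b - 0) *\<^sub>R x) {0..b}" using has_integral_const_real[of x 0 b] b by simp
  then have "((\<lambda>t. if t \<in> {0..b} then x else 0) has_integral b *\<^sub>R x) UNIV"
    by (simp only: has_integral_restrict_UNIV diff_zero)
  then show ?thesis by (rule has_integral_spike[of "{b}", rotated 2]) auto
qed

lemma ev_integrable: "ev f integrable_on UNIV" for f :: "'a::banach stepf"
proof (induction f rule: stepf_induct)
  case zero
  show ?case by (simp add: integrable_0)
next
  case (add f b x)
  have "(\<lambda>t. ev f t + ev (cell b x) t) integrable_on UNIV"
    using has_integral_cell[of b x] add by (intro integrable_add) (auto simp del: ev_cell)
  moreover have "(\<lambda>t. ev f t + ev (cell b x) t) = ev (f + cell b x)" by (simp add: fun_eq_iff)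
  ultimately show ?case by simp
qed

lemma intg_linear: "linear (intg :: 'a::banach stepf \<Rightarrow> 'a)"
proof (rule linearI)
  fix f g :: "'a stepf" and c :: real
  have "ev (f + g) = (\<lambda>t. ev f t + ev g t)" "ev (c *\<^sub>R f) = (\<lambda>t. c *\<^sub>R ev f t)" by (simp_all add: fun_eq_iff)
  then show "intg (f + g) = intg f + intg g" "intg (c *\<^sub>R f) = c *\<^sub>R intg f"
    unfolding intg_def by (simp_all add: integral_add[OF ev_integrable ev_integrable])
qed

lemma intg_cell: "0 \<le> b \<Longrightarrow> intg (cell b x) = b *\<^sub>R x"
  unfolding intg_def by (rule integral_unique[OF has_integral_cell])

lemma intg_mono:
  fixes f g :: "real stepf"
  assumes "\<And>t. ev f t \<le> ev g t"
  shows "intg f \<le> intg g"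
  unfolding intg_def using assms by (intro integral_le ev_integrable) auto

lemma intg_nonneg:
  fixes f :: "real stepf"
  assumes "\<And>t. 0 \<le> ev f t"
  shows "0 \<le> intg f"
  using intg_mono[of 0 f] assms by (simp add: linear_0[OF intg_linear])

lemma norm_intg_le: "norm (intg f) \<le> intg (comp_step norm f)" for f :: "'a::banach stepf"
  unfolding intg_def
  by (rule integral_norm_bound_integral) (auto simp: ev_integrable ev_comp_step)

lemma intg_shift: "0 \<le> d \<Longrightarrow> intg (shift d f) = intg f" for f :: "'a::banach stepf"
proof (rule linear_eq_stepf[of "\<lambda>f. intg (shift d f)" intg])
  show "linear (\<lambda>f :: 'a stepf. intg (shift d f))" using linear_compose[OF shift_linear intg_linear] by (simp add: o_def)
  fix b :: real and x :: 'a assume "0 \<le> d" "0 < b"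
  then show "intg (shift d (cell b x)) = intg (cell b x)"
    by (simp add: shift_cell linear_diff[OF intg_linear] intg_cell flip: scaleR_diff_left)
qed (rule intg_linear)

lemma intg_dilate: "0 < r \<Longrightarrow> intg (dilate r f) = inverse r *\<^sub>R intg f" for f :: "'a::banach stepf"
proof (rule linear_eq_stepf[of "\<lambda>f. intg (dilate r f)" "\<lambda>f. inverse r *\<^sub>R intg f"])
  assume r: "0 < r"
  show "linear (\<lambda>f :: 'a stepf. intg (dilate r f))" using linear_compose[OF dilate_linear[OF r] intg_linear] by (simp add: o_def)
  show "linear (\<lambda>f :: 'a stepf. inverse r *\<^sub>R intg f)" by (rule linear_compose_scale_right[OF intg_linear])
  fix b :: real and x :: 'a assume "0 < b"
  then show "intg (dilate r (cell b x)) = inverse r *\<^sub>R intg (cell b x)"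
    using r by (simp add: dilate_cell intg_cell divide_inverse mult.commute)
qed

lemma intg_comp_linear:
  fixes L :: "'a::banach \<Rightarrow> 'b::banach"
  assumes L: "linear L"
  shows "intg (comp_step L f) = L (intg f)"
proof (rule linear_eq_stepf[of "\<lambda>f. intg (comp_step L f)" "\<lambda>f. L (intg f)"])
  show "linear (\<lambda>f. intg (comp_step L f))" using linear_compose[OF comp_step_linear[OF L] intg_linear] by (simp add: o_def)
  show "linear (\<lambda>f. L (intg f))" using linear_compose[OF intg_linear L] by (simp add: o_def)
  fix b :: real and x assume "0 < b"
  then show "intg (comp_step L (cell b x)) = L (intg (cell b x))"
    by (simp add: comp_step_cell linear_0[OF L] intg_cell linear_scale[OF L])
qed

section \<open>The \<open>L\<^sub>p\<close> norm of step functions\<close>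

text \<open>After division by \<open>m\<close> this is Bernoulli's inequality, a consequence of the
  convexity of \<open>exp\<close>. For \<open>m = 0\<close> the left side is \<open>0\<close>,
  because \<open>0 powr a\<close> is \<open>0\<close>.\<close>

lemma powr_above_tangent:
  fixes x m p :: real
  assumes p: "1 \<le> p" and x: "0 \<le> x" and m: "0 \<le> m"
  shows "m powr p + p * m powr (p - 1) * (x - m) \<le> x powr p"
proof (cases "m = 0")
  case True
  then show ?thesis by simp
next
  case False
  then have m0: "0 < m" using m by simp
  define y where "y = x / m"
  have y: "0 \<le> y" using x m0 by (simp add: y_def)
  have key: "1 + p * (y - 1) \<le> y powr p"
  proof (cases "1 + p * (y - 1) \<le> 0")
    case True
    then show ?thesis using powr_ge_zero[of y p] by linarith
  next
    case False
    define c where "c = 1 + p * (y - 1)"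
    have c: "0 < c" using False by (simp add: c_def)
    have "exp ((1 - 1 / p) *\<^sub>R 0 + (1 / p) *\<^sub>R ln c) \<le> (1 - 1 / p) * exp 0 + (1 / p) * exp (ln c)"
      using p by (intro convex_onD[OF exp_convex]) auto
    then have "exp (1 / p * ln c) \<le> (1 - 1 / p) + (1 / p) * c" using c by simp
    also have "\<dots> = y" using p by (simp add: c_def field_simps)
    finally have "c powr (1 / p) \<le> y" using c by (simp add: powr_def)
    then have "(c powr (1 / p)) powr p \<le> y powr p" using p by (intro powr_mono2) auto
    then show ?thesis using c p by (simp add: powr_powr c_def)
  qed
  have "m powr p * (1 + p * (y - 1)) \<le> m powr p * y powr p" using key by (intro mult_left_mono) auto
  also have "m powr p * y powr p = x powr p" using m0 by (simp add: y_def flip: powr_mult)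
  also have "m powr p * (1 + p * (y - 1)) = m powr p + p * m powr (p - 1) * (x - m)"
  proof -
    have "m powr p = m powr (p - 1) * m" using m0 powr_add[of m "p - 1" 1] by simp
    then show ?thesis using m0 by (simp add: y_def field_simps)
  qed
  finally show ?thesis .
qed

text \<open>The tangent at the mean lies below the power at both end points; in the weighted sum the
  linear terms cancel.\<close>

lemma powr_convex_combination:
  fixes a b p u :: real
  assumes p: "1 \<le> p" and ab: "0 \<le> a" "0 \<le> b" and u: "0 \<le> u" "u \<le> 1"
  shows "((1 - u) * a + u * b) powr p \<le> (1 - u) * a powr p + u * b powr p"
proof -
  define m where "m = (1 - u) * a + u * b"
  have m: "0 \<le> m" using ab u by (simp add: m_def)
  let ?k = "p * m powr (p - 1)"
  have "(1 - u) * (m powr p + ?k * (a - m)) + u * (m powr p + ?k * (b - m)) \<le> (1 - u) * a powr p + u * b powr p"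
    using powr_above_tangent[OF p ab(1) m] powr_above_tangent[OF p ab(2) m] u by (intro add_mono mult_left_mono) auto
  also have "(1 - u) * (m powr p + ?k * (a - m)) + u * (m powr p + ?k * (b - m)) = m powr p + ?k * ((1 - u) * a + u * b - m)"
    by (simp add: algebra_simps)
  finally show ?thesis by (simp add: m_def)
qed

text \<open>The \<open>p\<close>-th power of the norm is additive over disjoint supports, so
  preservation of the norm is checked on it rather than on \<open>Lp\<close>.\<close>

definition pow_int :: "real \<Rightarrow> 'a::banach stepf \<Rightarrow> real" where
  "pow_int p f = intg (comp_step (\<lambda>x. norm x powr p) f)"

definition Lp :: "real \<Rightarrow> 'a::banach stepf \<Rightarrow> real" where
  "Lp p f = pow_int p f powr (1 / p)"

lemma ev_comp_pow [simp]: "ev (comp_step (\<lambda>x. norm x powr p) f) t = norm (ev f t) powr p"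
  by (simp add: ev_comp_step)

lemma pow_int_nonneg: "0 \<le> pow_int p f"
  unfolding pow_int_def by (rule intg_nonneg) simp

lemma pow_int_0 [simp]: "pow_int p 0 = 0"
proof -
  have "comp_step (\<lambda>x::'a. norm x powr p) 0 = 0" by (rule stepf_eqI) simp
  then show ?thesis by (simp add: pow_int_def linear_0[OF intg_linear])
qed

lemma pow_int_cell: "0 \<le> b \<Longrightarrow> pow_int p (cell b x) = b * norm x powr p"
  by (simp add: pow_int_def comp_step_cell intg_cell)

lemma pow_int_split:
  assumes "0 \<le> d"
  shows "pow_int p (restr d f + shift d g) = pow_int p (restr d f) + pow_int p g"
proof -
  let ?G = "comp_step (\<lambda>x::'a. norm x powr p)"
  have "?G (restr d f + shift d g) = ?G (restr d f) + shift d (?G g)"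
    by (rule stepf_eqI) (use assms in \<open>auto simp: ev_neg\<close>)
  then show ?thesis by (simp add: pow_int_def linear_add[OF intg_linear] intg_shift[OF assms])
qed

lemma pow_int_shift: "0 \<le> d \<Longrightarrow> pow_int p (shift d g) = pow_int p g"
  using pow_int_split[of d p 0 g] by (simp add: linear_0[OF restr_linear])

lemma restr_cell_same: "restr d (cell d x) = cell d x"
  by (simp add: restr_cell)

lemma pow_int_cell_shift: "0 \<le> d \<Longrightarrow> pow_int p (cell d x + shift d g) = d * norm x powr p + pow_int p g"
  using pow_int_split[of d p "cell d x" g] by (simp add: restr_cell_same pow_int_cell)

lemma pow_int_decompose: "0 \<le> d \<Longrightarrow> pow_int p f = pow_int p (restr d f) + pow_int p (shift (- d) f)"
  using pow_int_split[of d p f "shift (- d) f"] by (simp add: restr_shift_split[symmetric])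

lemma pow_int_restr_le: "pow_int p (restr d f) \<le> pow_int p f"
  unfolding pow_int_def by (rule intg_mono) simp

lemma pow_int_shift_left_le: "0 \<le> d \<Longrightarrow> pow_int p (shift (- d) f) \<le> pow_int p f"
  using pow_int_decompose[of d p f] pow_int_nonneg[of p "restr d f"] by simp

lemma pow_int_scale: "pow_int p (c *\<^sub>R f) = \<bar>c\<bar> powr p * pow_int p f"
proof -
  have "comp_step (\<lambda>x::'a. norm x powr p) (c *\<^sub>R f) = \<bar>c\<bar> powr p *\<^sub>R comp_step (\<lambda>x. norm x powr p) f"
    by (rule stepf_eqI) (simp add: powr_mult)
  then show ?thesis by (simp add: pow_int_def linear_scale[OF intg_linear])
qed

lemma pow_int_dilate: "0 < r \<Longrightarrow> pow_int p (dilate r f) = pow_int p f / r"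
proof -
  assume r: "0 < r"
  have "comp_step (\<lambda>x::'a. norm x powr p) (dilate r f) = dilate r (comp_step (\<lambda>x. norm x powr p) f)"
    by (rule stepf_eqI) (simp add: ev_dilate[OF r])
  then show ?thesis by (simp add: pow_int_def intg_dilate[OF r] divide_inverse mult.commute)
qed

lemma pow_int_comp_le:
  assumes p: "0 \<le> p" and L: "linear L" "\<And>x. norm (L x) \<le> K * norm x" and K: "0 \<le> K"
  shows "pow_int p (comp_step L f) \<le> K powr p * pow_int p f"
proof -
  have "pow_int p (comp_step L f) \<le> intg (K powr p *\<^sub>R comp_step (\<lambda>x. norm x powr p) f)"
    unfolding pow_int_def
  proof (rule intg_mono)
    fix t
    have "norm (L (ev f t)) powr p \<le> (K * norm (ev f t)) powr p" using p L(2) by (intro powr_mono2) auto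
    then show "ev (comp_step (\<lambda>x. norm x powr p) (comp_step L f)) t \<le> ev (K powr p *\<^sub>R comp_step (\<lambda>x. norm x powr p) f) t"
      by (simp add: ev_comp_step linear_0[OF L(1)] powr_mult)
  qed
  then show ?thesis by (simp add: pow_int_def linear_scale[OF intg_linear])
qed

lemma pow_int_comp_isometry:
  assumes "linear L" "\<And>x. norm (L x) = norm x"
  shows "pow_int p (comp_step L f) = pow_int p f"
proof -
  have "comp_step (\<lambda>x. norm x powr p) (comp_step L f) = comp_step (\<lambda>x. norm x powr p) f"
    by (rule stepf_eqI) (simp add: ev_comp_step linear_0[OF assms(1)] assms(2))
  then show ?thesis by (simp add: pow_int_def)
qed

context
  fixes p :: real
  assumes p: "1 < p"
begin

text \<open>With the first cell peeled off, the power integral is a sum of two nonnegative terms,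
  and that cell has positive length.\<close>

lemma pow_int_eq_0: "pow_int p f = 0 \<Longrightarrow> f = 0"
proof (induction f rule: stepf_induct_cell_shift)
  case (2 d y g)
  have "0 \<le> d * norm y powr p" using 2 by simp
  moreover have "d * norm y powr p + pow_int p g = 0" using 2 by (simp add: pow_int_cell_shift)
  ultimately have "d * norm y powr p = 0" "pow_int p g = 0"
    using pow_int_nonneg[of p g] by linarith+
  then show ?case using 2 by (simp add: cell_0 linear_0[OF shift_linear])
qed simp

lemma pow_int_convex:
  assumes u: "0 \<le> u" "u \<le> 1"
  shows "pow_int p ((1 - u) *\<^sub>R f + u *\<^sub>R g) \<le> (1 - u) * pow_int p f + u * pow_int p g"
proof -
  let ?G = "comp_step (\<lambda>x::'a. norm x powr p)"
  have "intg (?G ((1 - u) *\<^sub>R f + u *\<^sub>R g)) \<le> intg ((1 - u) *\<^sub>R ?G f + u *\<^sub>R ?G g)"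
  proof (rule intg_mono)
    fix t
    have "norm ((1 - u) *\<^sub>R ev f t + u *\<^sub>R ev g t) \<le> (1 - u) * norm (ev f t) + u * norm (ev g t)"
      using norm_triangle_ineq[of "(1 - u) *\<^sub>R ev f t" "u *\<^sub>R ev g t"] u by simp
    then have "norm ((1 - u) *\<^sub>R ev f t + u *\<^sub>R ev g t) powr p \<le> ((1 - u) * norm (ev f t) + u * norm (ev g t)) powr p"
      using p by (intro powr_mono2) auto
    also have "\<dots> \<le> (1 - u) * norm (ev f t) powr p + u * norm (ev g t) powr p"
      using p u by (intro powr_convex_combination) auto
    finally show "ev (?G ((1 - u) *\<^sub>R f + u *\<^sub>R g)) t \<le> ev ((1 - u) *\<^sub>R ?G f + u *\<^sub>R ?G g) t" by simp
  qed
  then show ?thesis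
    by (simp add: pow_int_def linear_add[OF intg_linear] linear_scale[OF intg_linear])
qed

lemma Lp_nonneg: "0 \<le> Lp p f"
  by (simp add: Lp_def)

lemma Lp_powr: "Lp p f powr p = pow_int p f"
  using p pow_int_nonneg[of p f] by (simp add: Lp_def powr_powr)

lemma Lp_leI: "0 \<le> c \<Longrightarrow> pow_int p f \<le> c powr p \<Longrightarrow> Lp p f \<le> c"
proof -
  assume c: "0 \<le> c" "pow_int p f \<le> c powr p"
  then have "Lp p f \<le> (c powr p) powr (1 / p)" unfolding Lp_def using p pow_int_nonneg by (intro powr_mono2) auto
  then show "Lp p f \<le> c" using c p by (simp add: powr_powr)
qed

lemma Lp_mono: "pow_int p f \<le> pow_int p g \<Longrightarrow> Lp p f \<le> Lp p g"
  by (rule Lp_leI) (simp_all add: Lp_nonneg Lp_powr)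

lemma Lp_cong: "pow_int p f = pow_int p g \<Longrightarrow> Lp p f = Lp p g"
  by (simp add: Lp_def)

lemma Lp_cell: "0 \<le> b \<Longrightarrow> Lp p (cell b x) = b powr (1 / p) * norm x"
  using p by (simp add: Lp_def pow_int_cell powr_mult powr_powr)

lemma Lp_scale: "Lp p (c *\<^sub>R f) = \<bar>c\<bar> * Lp p f"
  using p by (simp add: Lp_def pow_int_scale powr_mult powr_powr)

lemma Lp_eq_0: "Lp p f = 0 \<longleftrightarrow> f = 0"
proof
  assume "Lp p f = 0"
  then have "pow_int p f = 0" using Lp_powr[of f] by simp
  then show "f = 0" by (rule pow_int_eq_0)
qed (simp add: Lp_def)

text \<open>Minkowski's inequality from convexity: \<open>f + g\<close> is \<open>s + t\<close>
  times a convex combination of the normalised functions, each of power integral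
  \<open>1\<close>.\<close>

lemma Lp_triangle: "Lp p (f + g) \<le> Lp p f + Lp p g"
proof (cases "f = 0 \<or> g = 0")
  case True
  then show ?thesis using Lp_nonneg by auto
next
  case False
  define s t where "s = Lp p f" and "t = Lp p g"
  have st: "0 < s" "0 < t" using False Lp_eq_0 Lp_nonneg by (auto simp: s_def t_def less_le)
  define u where "u = t / (s + t)"
  have u: "0 \<le> u" "u \<le> 1" "1 - u = s / (s + t)" using st by (auto simp: u_def field_simps)
  have one: "pow_int p ((1 / s) *\<^sub>R f) = 1" "pow_int p ((1 / t) *\<^sub>R g) = 1"
    using st unfolding pow_int_scale Lp_powr[symmetric] s_def[symmetric] t_def[symmetric] powr_mult[symmetric] by simp_all
  have "f + g = (s + t) *\<^sub>R ((1 - u) *\<^sub>R ((1 / s) *\<^sub>R f) + u *\<^sub>R ((1 / t) *\<^sub>R g))"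
    unfolding u(3) using st by (simp add: u_def scaleR_add_right)
  then have "pow_int p (f + g) = (s + t) powr p * pow_int p ((1 - u) *\<^sub>R ((1 / s) *\<^sub>R f) + u *\<^sub>R ((1 / t) *\<^sub>R g))"
    using st by (metis abs_of_pos add_pos_pos pow_int_scale)
  also have "\<dots> \<le> (s + t) powr p * 1"
    using pow_int_convex[OF u(1,2), of "(1 / s) *\<^sub>R f" "(1 / t) *\<^sub>R g"] one by (intro mult_left_mono) auto
  finally show ?thesis using st by (intro Lp_leI) (auto simp: s_def t_def)
qed

lemma Lp_norm_on: "norm_on UNIV (Lp p)"
  unfolding norm_on_def using Lp_nonneg Lp_eq_0 Lp_scale Lp_triangle by auto

lemmas Lp_seminorm = seminorm_onD[OF norm_on_seminorm[OF Lp_norm_on], simplified]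

lemma Lp_shift: "0 \<le> d \<Longrightarrow> Lp p (shift d g) = Lp p g"
  by (intro Lp_cong pow_int_shift)

lemma Lp_shift_left_le: "0 \<le> d \<Longrightarrow> Lp p (shift (- d) g) \<le> Lp p g"
  by (intro Lp_mono pow_int_shift_left_le)

lemma Lp_comp_le:
  assumes L: "linear L" "\<And>x. norm (L x) \<le> K * norm x" and K: "0 \<le> K"
  shows "Lp p (comp_step L f) \<le> K * Lp p f"
  using pow_int_comp_le[of p L K f] p L K
  by (intro Lp_leI) (auto simp: powr_mult Lp_powr Lp_nonneg)

text \<open>Jensen's inequality on the unit interval: the tangent at the mean \<open>m\<close> of
  the pointwise norm is integrated, and its linear part contributes nothing because \<open>m\<close>
  is the mean.\<close>

lemma pow_norm_mean_le: "norm (intg (restr 1 f)) powr p \<le> pow_int p (restr 1 f)"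
proof -
  let ?h = "comp_step norm (restr 1 f)"
  define m where "m = intg ?h"
  have m: "0 \<le> m" unfolding m_def by (rule intg_nonneg) (simp add: ev_comp_step)
  let ?k = "p * m powr (p - 1)"
  have "intg (cell 1 (m powr p) + ?k *\<^sub>R (?h - cell 1 m)) \<le> pow_int p (restr 1 f)"
    unfolding pow_int_def
  proof (rule intg_mono)
    fix t
    have "m powr p + ?k * (norm (ev f t) - m) \<le> norm (ev f t) powr p"
      using p m by (intro powr_above_tangent) auto
    then show "ev (cell 1 (m powr p) + ?k *\<^sub>R (?h - cell 1 m)) t \<le> ev (comp_step (\<lambda>x. norm x powr p) (restr 1 f)) t"
      by (auto simp: ev_comp_step ev_neg)
  qed
  moreover have "intg (cell 1 (m powr p) + ?k *\<^sub>R (?h - cell 1 m)) = m powr p"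
    by (simp add: linear_add[OF intg_linear] linear_scale[OF intg_linear] linear_diff[OF intg_linear] intg_cell m_def[symmetric])
  moreover have "norm (intg (restr 1 f)) powr p \<le> m powr p"
    using p norm_intg_le[of "restr 1 f"] by (intro powr_mono2) (auto simp: m_def)
  ultimately show ?thesis by simp
qed

end

text \<open>Conditional expectation onto the unit intervals \<open>[n, n + 1)\<close>.\<close>

definition avg :: "'a::banach stepf \<Rightarrow> 'a stepf" where
  "avg f = Stepf (\<lambda>t. if 0 \<le> t then intg (restr 1 (shift (- of_int \<lfloor>t\<rfloor>) f)) else 0)"

section \<open>Averages over unit and dyadic intervals\<close>

lemma shift_left_cell: "0 \<le> d \<Longrightarrow> shift (- d) (cell b x) = cell (b - d) x"
  by (rule stepf_eqI) auto

text \<open>The mean over a unit interval is the full value before the integer part of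
  \<open>b\<close>, the fraction \<open>frac b\<close> of it on the interval containing
  \<open>b\<close>, and \<open>0\<close> after; two cells superpose to these values. Hence averages
  are step functions again.\<close>

lemma mean_cell:
  fixes x :: "'a::banach"
  assumes "0 \<le> t"
  shows "intg (restr 1 (shift (- of_int \<lfloor>t\<rfloor>) (cell b x))) =
    ev (cell (of_int \<lfloor>b\<rfloor>) ((1 - frac b) *\<^sub>R x) + cell (of_int \<lfloor>b\<rfloor> + 1) (frac b *\<^sub>R x)) t"
proof -
  define n where "n = \<lfloor>t\<rfloor>"
  have n: "0 \<le> n" "of_int n \<le> t" "t < of_int n + 1" using assms by (auto simp: n_def)
  have fb: "b = of_int \<lfloor>b\<rfloor> + frac b" "0 \<le> frac b" "frac b < 1"
    using frac_lt_1[of b] frac_ge_0[of b] by (auto simp: frac_def)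
  have e: "restr 1 (shift (- of_int n) (cell b x)) = cell (min (b - of_int n) 1) x"
    using n by (simp add: shift_left_cell restr_cell)
  consider "n + 1 \<le> \<lfloor>b\<rfloor>" | "n = \<lfloor>b\<rfloor>" | "\<lfloor>b\<rfloor> + 1 \<le> n" by linarith
  then show ?thesis
  proof cases
    case 1
    then have r: "of_int n + 1 \<le> (of_int \<lfloor>b\<rfloor> :: real)" by linarith
    then have m: "min (b - of_int n) 1 = 1" using fb by linarith
    show ?thesis using r n fb assms unfolding n_def[symmetric] e m
      by (simp add: intg_cell scaleR_add_left[symmetric])
  next
    case 2
    then have "b - of_int n = frac b" by (simp add: frac_def)
    then have m: "min (b - of_int n) 1 = frac b" using fb by simp
    show ?thesis using n fb assms 2 unfolding n_def[symmetric] e m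
      by (simp add: intg_cell)
  next
    case 3
    then have r: "of_int \<lfloor>b\<rfloor> + 1 \<le> (of_int n :: real)" by linarith
    then have "min (b - of_int n) 1 \<le> 0" using fb by linarith
    then have c: "cell (min (b - of_int n) 1) x = 0" by (rule cell_nonpos)
    show ?thesis using r n assms unfolding n_def[symmetric] e c
      by (simp add: linear_0[OF intg_linear])
  qed
qed

lemma ev_avg: "ev (avg f) t = (if 0 \<le> t then intg (restr 1 (shift (- of_int \<lfloor>t\<rfloor>) f)) else 0)"
  for f :: "'a::banach stepf"
proof -
  have "(\<lambda>t. if 0 \<le> t then intg (restr 1 (shift (- of_int \<lfloor>t\<rfloor>) f)) else 0) \<in> step_funs"
  proof (induction f rule: stepf_induct)
    case zero
    have "(\<lambda>t::real. if 0 \<le> t then intg (restr 1 (shift (- of_int \<lfloor>t\<rfloor>) (0 :: 'a stepf))) else 0) = (\<lambda>_. 0)"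
      by (auto simp: linear_0[OF shift_linear] linear_0[OF restr_linear] linear_0[OF intg_linear])
    then show ?case using step_funs.zero by simp
  next
    case (add f b x)
    let ?h = "cell (of_int \<lfloor>b\<rfloor>) ((1 - frac b) *\<^sub>R x) + cell (of_int \<lfloor>b\<rfloor> + 1) (frac b *\<^sub>R x)"
    have eq: "(\<lambda>t. if 0 \<le> t then intg (restr 1 (shift (- of_int \<lfloor>t\<rfloor>) (f + cell b x))) else 0) =
      (\<lambda>t. (if 0 \<le> t then intg (restr 1 (shift (- of_int \<lfloor>t\<rfloor>) f)) else 0) + ev ?h t)"
    proof
      fix t :: real
      show "(if 0 \<le> t then intg (restr 1 (shift (- of_int \<lfloor>t\<rfloor>) (f + cell b x))) else 0) =
        (if 0 \<le> t then intg (restr 1 (shift (- of_int \<lfloor>t\<rfloor>) f)) else 0) + ev ?h t"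
      proof (cases "0 \<le> t")
        case True
        then show ?thesis using mean_cell[OF True, of b x]
          by (simp add: linear_add[OF shift_linear] linear_add[OF restr_linear] linear_add[OF intg_linear] del: ev_add ev_cell)
      next
        case False
        then show ?thesis using ev_neg[of t ?h] by (simp del: ev_add ev_cell)
      qed
    qed
    show ?case unfolding eq by (rule step_funs_add[OF add.IH ev])
  qed
  then show ?thesis by (simp add: avg_def ev_Stepf)
qed

lemma avg_linear: "linear avg"
  by (rule linearI; rule stepf_eqI)
    (simp_all add: ev_avg linear_add[OF shift_linear] linear_add[OF restr_linear] linear_add[OF intg_linear]
      linear_scale[OF shift_linear] linear_scale[OF restr_linear] linear_scale[OF intg_linear])

lemma avg_cell: "avg (cell b x) = cell (of_int \<lfloor>b\<rfloor>) ((1 - frac b) *\<^sub>R x) + cell (of_int \<lfloor>b\<rfloor> + 1) (frac b *\<^sub>R x)"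
proof (rule stepf_eqI)
  fix t
  show "ev (avg (cell b x)) t = ev (cell (of_int \<lfloor>b\<rfloor>) ((1 - frac b) *\<^sub>R x) + cell (of_int \<lfloor>b\<rfloor> + 1) (frac b *\<^sub>R x)) t"
    using mean_cell[of t b x] by (cases "0 \<le> t") (simp_all add: ev_avg del: ev_cell ev_add, simp)
qed

lemma avg_cell_int: "avg (cell (of_int n) x) = cell (of_int n) x"
  by (simp add: avg_cell cell_0)

lemma shift_left_left: "0 \<le> a \<Longrightarrow> 0 \<le> b \<Longrightarrow> shift (- a) (shift (- b) f) = shift (- (a + b)) f"
  by (rule stepf_eqI) (simp add: algebra_simps)

text \<open>Separates the first unit interval, for recursion along the half line.\<close>

lemma avg_rec: "avg f = cell 1 (intg (restr 1 f)) + shift 1 (avg (shift (- 1) f))"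
proof (rule stepf_eqI)
  fix t :: real
  have s0: "shift 0 f = f" by (rule stepf_eqI) (simp add: ev_neg)
  consider "t < 0" | "0 \<le> t" "t < 1" | "1 \<le> t" by linarith
  then show "ev (avg f) t = ev (cell 1 (intg (restr 1 f)) + shift 1 (avg (shift (- 1) f))) t"
  proof cases
    case 1
    then show ?thesis by (simp add: ev_neg)
  next
    case 2
    then have "\<lfloor>t\<rfloor> = 0" by linarith
    then show ?thesis using 2 by (simp add: ev_avg s0)
  next
    case 3
    define n where "n = \<lfloor>t\<rfloor>"
    have n: "1 \<le> n" "\<lfloor>t - 1\<rfloor> = n - 1" using 3 by (auto simp: n_def)
    have "shift (- of_int (n - 1)) (shift (- 1) f) = shift (- of_int n) f"
      using n shift_left_left[of "of_int (n - 1)" 1 f] by simp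
    then show ?thesis using 3 n by (simp add: ev_avg n_def[symmetric])
  qed
qed

lemma avg_shift_left: "avg (shift (- 1) f) = shift (- 1) (avg f)"
proof -
  have "shift (- 1) (avg f) = shift (- 1) (restr 1 (cell 1 (intg (restr 1 f))) + shift 1 (avg (shift (- 1) f)))"
    by (subst avg_rec) (simp add: restr_cell_same)
  then show ?thesis by (simp add: shift_left_restr)
qed

lemma avg_shift: "avg (shift 1 f) = shift 1 (avg f)"
proof -
  have "restr 1 (shift 1 f) = 0" by (rule stepf_eqI) (simp add: ev_neg)
  then have "avg (shift 1 f) = cell 1 0 + shift 1 (avg (shift (- 1) (shift 1 f)))"
    by (subst avg_rec) (simp add: linear_0[OF intg_linear])
  then show ?thesis by (simp add: cell_0 shift_left_right)
qed

lemma avg_avg: "avg (avg f) = avg f"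
proof (rule linear_eq_stepf[of "\<lambda>f. avg (avg f)" avg])
  show "linear (\<lambda>f :: 'a stepf. avg (avg f))" using linear_compose[OF avg_linear avg_linear] by (simp add: o_def)
  fix b :: real and x :: 'a
  have "cell (of_int \<lfloor>b\<rfloor> + 1) (frac b *\<^sub>R x) = cell (of_int (\<lfloor>b\<rfloor> + 1)) (frac b *\<^sub>R x)" by simp
  then show "avg (avg (cell b x)) = avg (cell b x)"
    unfolding avg_cell[of b x] linear_add[OF avg_linear] by (simp only: avg_cell_int)
qed (rule avg_linear)

lemma avg_comp:
  fixes L :: "'a::banach \<Rightarrow> 'b::banach"
  assumes L: "linear L"
  shows "avg (comp_step L f) = comp_step L (avg f)"
proof (rule stepf_eqI)
  fix t
  have "restr 1 (shift d (comp_step L f)) = comp_step L (restr 1 (shift d f))" for d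
    by (rule stepf_eqI) (simp add: ev_comp_step linear_0[OF L])
  then show "ev (avg (comp_step L f)) t = ev (comp_step L (avg f)) t"
    by (simp add: ev_avg ev_comp_step linear_0[OF L] intg_comp_linear[OF L])
qed

text \<open>Jensen's inequality on each unit interval, summed by induction on the number of unit
  intervals that cover the support.\<close>

lemma pow_int_avg_le:
  assumes p: "1 < p"
  shows "pow_int p (avg f) \<le> pow_int p f"
proof -
  have "pow_int p (avg f) \<le> pow_int p f" if "\<forall>t\<ge>real n. ev f t = 0" for n f
    using that
  proof (induction n arbitrary: f)
    case 0
    have "f = 0" by (rule stepf_eqI) (use 0 ev_neg[of _ f] in \<open>metis ev_0 not_le of_nat_0\<close>)
    then show ?case by (simp add: linear_0[OF avg_linear])
  next
    case (Suc n)
    have "\<forall>t\<ge>real n. ev (shift (- 1) f) t = 0" using Suc.prems by simp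
    then have IH: "pow_int p (avg (shift (- 1) f)) \<le> pow_int p (shift (- 1) f)" by (rule Suc.IH)
    have "pow_int p (avg f) = norm (intg (restr 1 f)) powr p + pow_int p (avg (shift (- 1) f))"
      by (subst avg_rec) (simp add: pow_int_cell_shift)
    also have "\<dots> \<le> pow_int p (restr 1 f) + pow_int p (shift (- 1) f)"
      using IH pow_norm_mean_le[OF p] by (intro add_mono)
    also have "\<dots> = pow_int p f" using pow_int_decompose[of 1 p f] by simp
    finally show ?case .
  qed
  then show ?thesis using ev_bounded_support by blast
qed

text \<open>Conjugation with a dilation turns unit intervals into intervals of length
  \<open>(1 / 2) ^ k\<close>.\<close>

definition dyadic_avg :: "nat \<Rightarrow> 'a::banach stepf \<Rightarrow> 'a stepf" where
  "dyadic_avg k f = dilate (2 ^ k) (avg (dilate (inverse (2 ^ k)) f))"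

lemma dyadic_avg_linear: "linear (dyadic_avg k)"
  unfolding dyadic_avg_def
  using linear_compose[OF linear_compose[OF dilate_linear avg_linear] dilate_linear, of "inverse (2 ^ k)" "2 ^ k"]
  by (simp add: o_def)

lemma pow_int_dyadic_avg_le: "1 < p \<Longrightarrow> pow_int p (dyadic_avg k f) \<le> pow_int p f"
  using pow_int_avg_le[of p "dilate (inverse (2 ^ k)) f"]
  by (simp add: dyadic_avg_def pow_int_dilate field_simps)

lemma dyadic_avg_cell:
  assumes "0 < b"
  obtains i x' y' where "dyadic_avg k (cell b x) = cell (real i / 2 ^ k) x' + cell (real (Suc i) / 2 ^ k) y'"
proof -
  define n where "n = nat \<lfloor>b * 2 ^ k\<rfloor>"
  have "real n = of_int \<lfloor>b * 2 ^ k\<rfloor>" using assms by (simp add: n_def)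
  then have "dyadic_avg k (cell b x) = cell (real n / 2 ^ k) ((1 - frac (b * 2 ^ k)) *\<^sub>R x) + cell (real (Suc n) / 2 ^ k) (frac (b * 2 ^ k) *\<^sub>R x)"
    by (simp add: dyadic_avg_def dilate_cell avg_cell linear_add[OF dilate_linear] divide_inverse add.commute)
  then show ?thesis using that by blast
qed

lemma dyadic_avg_dyadic_cell: "dyadic_avg k (cell (real i / 2 ^ k) x) = cell (real i / 2 ^ k) x"
  using avg_cell_int[of "int i" x] by (simp add: dyadic_avg_def dilate_cell)

section \<open>A skeleton of the space of step functions\<close>

context skeleton_space
begin

text \<open>The fineness of the mesh, the length of the support and the space of values all grow
  with \<open>k\<close>. For \<open>k = 0\<close> only cells of length \<open>0\<close> remain, so
  the chain starts with the zero space.\<close>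

definition step_chain :: "nat \<Rightarrow> 'a stepf set" where
  "step_chain k = span {cell (real i / 2 ^ k) y | i y. i \<le> k * 2 ^ k \<and> y \<in> E k}"

text \<open>Averaging over dyadic intervals, projecting the values and cutting at \<open>k\<close>
  are three contractions, each of which fixes \<open>step_chain k\<close> pointwise.\<close>

definition step_proj :: "nat \<Rightarrow> 'a stepf \<Rightarrow> 'a stepf" where
  "step_proj k f = restr (real k) (comp_step (pr k) (dyadic_avg k f))"

lemma step_chain_cell: "i \<le> k * 2 ^ k \<Longrightarrow> y \<in> E k \<Longrightarrow> cell (real i / 2 ^ k) y \<in> step_chain k"
  unfolding step_chain_def by (rule span_base) blast

lemma step_chain_fin_dim: "fin_dim_subspace (step_chain k)"
proof -
  obtain B where B: "finite B" "E k = span B" using fd by (auto simp: fin_dim_subspace_def)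
  define S where "S = (\<lambda>(i, b). cell (real i / 2 ^ k) b) ` ({..k * 2 ^ k} \<times> B)"
  have "step_chain k \<subseteq> span S"
    unfolding step_chain_def
  proof (rule span_minimal[OF _ subspace_span], clarify)
    fix i y assume i: "i \<le> k * 2 ^ k" "y \<in> E k"
    have "cell (real i / 2 ^ k) y \<in> span (cell (real i / 2 ^ k) ` B)"
      using linear_span_image[OF cell_linear, of "real i / 2 ^ k" B] i B by auto
    moreover have "cell (real i / 2 ^ k) ` B \<subseteq> S" using i by (auto simp: S_def)
    ultimately show "cell (real i / 2 ^ k) y \<in> span S" using span_mono by blast
  qed
  moreover have "span S \<subseteq> step_chain k"
    unfolding step_chain_def by (rule span_mono) (auto simp: S_def B intro!: exI span_base)
  ultimately have "step_chain k = span S" by blast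
  moreover have "finite S" using B by (simp add: S_def)
  ultimately show ?thesis unfolding fin_dim_subspace_def by blast
qed

lemma step_chain_0: "step_chain 0 = {0}"
proof -
  have "{cell (real i / 2 ^ 0) y | i y. i \<le> 0 * 2 ^ 0 \<and> y \<in> E 0} \<subseteq> {0}" by (auto simp: cell_nonpos)
  then have "step_chain 0 \<subseteq> span {0}" unfolding step_chain_def by (rule span_mono)
  then show ?thesis unfolding step_chain_def using span_zero by auto
qed

lemma step_chain_mono: "step_chain k \<subseteq> step_chain (Suc k)"
  unfolding step_chain_def[of k]
proof (rule span_minimal, clarify)
  fix i y assume i: "i \<le> k * 2 ^ k" "y \<in> E k"
  have "cell (real (2 * i) / 2 ^ Suc k) y \<in> step_chain (Suc k)"
  proof (rule step_chain_cell)
    have "2 * i \<le> k * 2 ^ Suc k" using i by simp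
    also have "\<dots> \<le> Suc k * 2 ^ Suc k" by simp
    finally show "2 * i \<le> Suc k * 2 ^ Suc k" .
    show "y \<in> E (Suc k)" using i mono_Suc by blast
  qed
  then show "cell (real i / 2 ^ k) y \<in> step_chain (Suc k)" by simp
qed (simp add: step_chain_def)

lemma step_proj_linear: "linear (step_proj k)"
proof -
  have "linear (restr (real k) \<circ> (comp_step (pr k) \<circ> dyadic_avg k))"
    by (intro linear_compose dyadic_avg_linear comp_step_linear pr_linear restr_linear)
  then show ?thesis by (simp add: step_proj_def[abs_def] o_def)
qed

lemma comp_pr_cell: "comp_step (pr n) (cell b x) = cell b (pr n x)"
  by (rule comp_step_cell) (rule linear_0[OF pr_linear])

lemma restr_dyadic_cell:
  assumes "y \<in> E k"
  shows "restr (real k) (cell (real i / 2 ^ k) y) \<in> step_chain k"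
proof -
  have "min (real i / 2 ^ k) (real k) = real (min i (k * 2 ^ k)) / 2 ^ k"
  proof (cases "i \<le> k * 2 ^ k")
    case True
    then have "real i \<le> real (k * 2 ^ k)" by (simp only: of_nat_le_iff)
    then show ?thesis using True by (simp add: min_def pos_divide_le_eq)
  next
    case False
    then have "real (k * 2 ^ k) < real i" by (simp only: of_nat_less_iff not_le)
    then show ?thesis using False by (simp add: min_def pos_divide_le_eq)
  qed
  then show ?thesis using step_chain_cell[of "min i (k * 2 ^ k)" k y] assms by (simp add: restr_cell)
qed

lemma step_proj_in: "step_proj k f \<in> step_chain k"
proof (induction f rule: stepf_induct)
  case zero
  show ?case using linear_0[OF step_proj_linear] by (simp add: step_chain_def span_zero)
next
  case (add f b x)
  obtain i x' y' where "dyadic_avg k (cell b x) = cell (real i / 2 ^ k) x' + cell (real (Suc i) / 2 ^ k) y'"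
    using dyadic_avg_cell[OF add.hyps] by blast
  then have "step_proj k (cell b x) =
      restr (real k) (cell (real i / 2 ^ k) (pr k x')) + restr (real k) (cell (real (Suc i) / 2 ^ k) (pr k y'))"
    by (simp only: step_proj_def linear_add[OF comp_step_linear[OF pr_linear]] linear_add[OF restr_linear] comp_pr_cell)
  moreover have "\<dots> \<in> step_chain k"
    unfolding step_chain_def by (intro span_add; fold step_chain_def; intro restr_dyadic_cell pr_in)
  ultimately have "step_proj k (cell b x) \<in> step_chain k" by simp
  then have "step_proj k f + step_proj k (cell b x) \<in> step_chain k"
    using add.IH unfolding step_chain_def by (intro span_add)
  then show ?case by (simp add: linear_add[OF step_proj_linear])
qed

lemma step_proj_id:
  assumes "f \<in> step_chain k"
  shows "step_proj k f = f"
proof -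
  have "step_proj k f = id f"
    using assms unfolding step_chain_def
  proof (rule linear_eq_on[OF step_proj_linear linear_id])
    fix g assume "g \<in> {cell (real i / 2 ^ k) y | i y. i \<le> k * 2 ^ k \<and> y \<in> E k}"
    then obtain i y where g: "g = cell (real i / 2 ^ k) y" "i \<le> k * 2 ^ k" "y \<in> E k" by blast
    have "real i \<le> real (k * 2 ^ k)" using g(2) by (simp only: of_nat_le_iff)
    then have "min (real i / 2 ^ k) (real k) = real i / 2 ^ k" by (simp add: min_def pos_divide_le_eq)
    then show "step_proj k g = id g"
      unfolding g(1) step_proj_def dyadic_avg_dyadic_cell comp_pr_cell pr_id[OF g(3)] restr_cell by simp
  qed
  then show ?thesis by simp
qed

lemma step_proj_norm:
  assumes p: "1 < p"
  shows "Lp p (step_proj k f) \<le> Lp p f"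
proof -
  have "Lp p (step_proj k f) \<le> Lp p (comp_step (pr k) (dyadic_avg k f))"
    unfolding step_proj_def by (intro Lp_mono[OF p] pow_int_restr_le)
  also have "\<dots> \<le> 1 * Lp p (dyadic_avg k f)"
    by (rule Lp_comp_le[OF p pr_linear]) (simp_all add: pr_norm)
  also have "\<dots> \<le> 1 * Lp p f" using Lp_mono[OF p pow_int_dyadic_avg_le[OF p]] by simp
  finally show ?thesis by simp
qed

lemma step_chain_mono_le: "k \<le> l \<Longrightarrow> step_chain k \<subseteq> step_chain l"
  using step_chain_mono by (rule lift_Suc_mono_le)

text \<open>The value is approximated inside some \<open>E l\<close> and the end point by a dyadic
  number from below; the error is \<open>x - y\<close> on \<open>[0, b)\<close> plus
  \<open>y\<close> on a short interval.\<close>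

lemma step_chain_dense_cell:
  assumes p: "1 < p" and b: "0 < b" and e: "0 < e"
  shows "\<exists>k. \<exists>v\<in>step_chain k. Lp p (cell b x - v) < e"
proof -
  have b0: "0 < b powr (1 / p)" using b by simp
  then have "0 < e / (2 * b powr (1 / p))" using e by simp
  then obtain y l where y: "y \<in> E l" "norm (x - y) < e / (2 * b powr (1 / p))"
    using dense dense_iff_norm[of x "\<Union>n. E n"] by blast
  have "(\<lambda>k. ((1 / 2) ^ k) powr (1 / p) * norm y) \<longlonglongrightarrow> 0 powr (1 / p) * norm y"
    using p by (intro tendsto_intros tendsto_powr' LIMSEQ_power_zero) auto
  then have "\<forall>\<^sub>F k in sequentially. ((1 / 2) ^ k) powr (1 / p) * norm y < e / 2"
    using e by (intro order_tendstoD(2)) auto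
  then obtain K where K: "\<And>k. k \<ge> K \<Longrightarrow> ((1 / 2) ^ k) powr (1 / p) * norm y < e / 2"
    unfolding eventually_sequentially by blast
  obtain m :: nat where m: "b \<le> real m" using real_arch_simple by blast
  \<comment> \<open>\<open>K\<close> makes the mesh fine enough, \<open>l\<close> puts
    \<open>y\<close> in \<open>E k\<close>, and \<open>m\<close> keeps the cell inside
    \<open>[0, k)\<close>.\<close>
  define k where "k = max K (max l m)"
  define i where "i = nat \<lfloor>b * 2 ^ k\<rfloor>"
  have i: "real i \<le> b * 2 ^ k" "b * 2 ^ k < real i + 1" using b by (auto simp: i_def)
  define c where "c = real i / 2 ^ k"
  have c: "0 \<le> c" "c \<le> b" "b - c \<le> (1 / 2) ^ k"
  proof -
    have "b \<le> (real i + 1) / 2 ^ k" using i by (simp add: pos_le_divide_eq)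
    then show "b - c \<le> (1 / 2) ^ k" by (simp add: c_def power_one_over add_divide_distrib)
  qed (use i in \<open>simp_all add: c_def pos_divide_le_eq\<close>)
  have "cell c y \<in> step_chain k"
    unfolding c_def
  proof (rule step_chain_cell)
    have "b * 2 ^ k \<le> real m * 2 ^ k" using m by (intro mult_right_mono) auto
    then have "real i \<le> real m * 2 ^ k" using i(1) by linarith
    also have "\<dots> \<le> real k * 2 ^ k" by (intro mult_right_mono) (auto simp: k_def)
    finally have "real i \<le> real (k * 2 ^ k)" by simp
    then show "i \<le> k * 2 ^ k" by (simp only: of_nat_le_iff)
    have "l \<le> k" by (simp add: k_def)
    then show "y \<in> E k" using y(1) E_mono by blast
  qed
  moreover have "Lp p (cell b x - cell c y) < e"
  proof -
    have "cell b x - cell c y = cell b (x - y) + shift c (cell (b - c) y)"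
      using c by (simp add: shift_cell cell_diff)
    then have "Lp p (cell b x - cell c y) \<le> Lp p (cell b (x - y)) + Lp p (shift c (cell (b - c) y))"
      using Lp_triangle[OF p] by simp
    also have "Lp p (shift c (cell (b - c) y)) = (b - c) powr (1 / p) * norm y"
      using c by (simp add: Lp_shift[OF p] Lp_cell[OF p])
    also have "\<dots> \<le> ((1 / 2) ^ k) powr (1 / p) * norm y" using c p by (intro mult_right_mono powr_mono2) auto
    also have "\<dots> < e / 2" by (rule K) (simp add: k_def)
    also have "Lp p (cell b (x - y)) = b powr (1 / p) * norm (x - y)" using b by (simp add: Lp_cell[OF p])
    also have "\<dots> < b powr (1 / p) * (e / (2 * b powr (1 / p)))" using y(2) b0 by (intro mult_strict_left_mono)
    also have "\<dots> = e / 2" using b0 by simp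
    finally show ?thesis by simp
  qed
  ultimately show ?thesis by blast
qed

lemma step_chain_dense:
  assumes p: "1 < p" and e: "0 < e"
  shows "\<exists>k. \<exists>v\<in>step_chain k. Lp p (f - v) < e"
  using e
proof (induction f arbitrary: e rule: stepf_induct)
  case zero
  have "(0 :: 'a stepf) \<in> step_chain 0" by (simp add: step_chain_0)
  moreover have "Lp p (0 - 0 :: 'a stepf) < e" using zero by (simp add: Lp_seminorm(4)[OF p])
  ultimately show ?case by blast
next
  case (add f b x)
  obtain k v where v: "v \<in> step_chain k" "Lp p (f - v) < e / 2" using add.IH[OF half_gt_zero[OF add.prems]] by blast
  obtain l w where w: "w \<in> step_chain l" "Lp p (cell b x - w) < e / 2"
    using step_chain_dense_cell[OF p add.hyps half_gt_zero[OF add.prems]] by blast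
  have "v + w \<in> step_chain (max k l)"
    using v(1) w(1) step_chain_mono_le[of k "max k l"] step_chain_mono_le[of l "max k l"]
    unfolding step_chain_def by (intro span_add) auto
  moreover have "Lp p (f + cell b x - (v + w)) < e"
    using Lp_triangle[OF p, of "f - v" "cell b x - w"] v(2) w(2) by (simp add: algebra_simps)
  ultimately show ?case by blast
qed

lemma Lp_complemented:
  assumes p: "1 < p"
  obtains J :: "'a stepf \<Rightarrow> 'a" and P where "linear J" "\<And>f. norm (J f) = Lp p f" "bounded_linear P"
    "\<And>f. P (J f) = J f" "\<And>x. P x \<in> closure (range J)"
proof (rule complementably_universal[of "Lp p" step_chain step_proj, OF Lp_norm_on[OF p] step_chain_fin_dim], goal_cases)
  case (1 k)
  show ?case by (rule step_chain_mono)
next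
  case 2
  show ?case by (rule step_chain_0)
next
  case (3 k)
  show ?case by (rule step_proj_linear)
next
  case (4 k f)
  show ?case by (rule step_proj_in)
next
  case (5 k f)
  then show ?case by (intro step_proj_id)
next
  case (6 k f)
  show ?case by (rule step_proj_norm[OF p])
next
  case (7 f e)
  show ?case by (rule step_chain_dense[OF p \<open>0 < e\<close>])
next
  case (8 J P)
  show ?case by (rule that[of J P]) (fact 8)+
qed

end

section \<open>Almost transitivity of the space of step functions\<close>

context
  fixes p :: real
  assumes p: "1 < p"
begin

definition step_iso :: "('a::banach stepf \<Rightarrow> 'a stepf) \<Rightarrow> bool" where
  "step_iso S \<longleftrightarrow> linear S \<and> bij S \<and> (\<forall>f. pow_int p (S f) = pow_int p f)"

lemma step_isoI:
  assumes "linear S" "\<And>f. S' (S f) = f" "\<And>f. S (S' f) = f" "\<And>f. pow_int p (S f) = pow_int p f"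
  shows "step_iso S"
  unfolding step_iso_def using assms by (auto intro!: bij_betw_byWitness[where f' = S'])

lemma step_iso_Lp: "step_iso S \<Longrightarrow> Lp p (S f) = Lp p f"
  by (simp add: step_iso_def Lp_def)

lemma step_iso_inv: "step_iso S \<Longrightarrow> step_iso (inv S)"
proof -
  assume S: "step_iso S"
  then have b: "bij S" and l: "linear S" by (auto simp: step_iso_def)
  have i: "inv S (S f) = f" "S (inv S f) = f" for f
    using b by (simp_all add: bij_is_inj bij_is_surj surj_f_inv_f)
  have "linear (inv S)"
    by (rule linearI) (metis i linear_add[OF l], metis i linear_scale[OF l])
  then show ?thesis
    by (rule step_isoI[where S' = S]) (use S i in \<open>auto simp: step_iso_def\<close>, metis i(2))
qed

lemma step_iso_comp: "step_iso S \<Longrightarrow> step_iso T \<Longrightarrow> step_iso (S \<circ> T)"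
  by (auto simp: step_iso_def linear_compose bij_comp)

text \<open>Approximate orbits of the isometry group. The relation is an equivalence that preserves
  the norm, so it is enough to move every function near a normal form determined by its
  norm.\<close>

definition orbit_close :: "'a::banach stepf \<Rightarrow> 'a stepf \<Rightarrow> bool" where
  "orbit_close f g \<longleftrightarrow> (\<forall>e>0. \<exists>S. step_iso S \<and> Lp p (S f - g) < e)"

lemma orbit_close_iso: "step_iso S \<Longrightarrow> orbit_close f (S f)"
  unfolding orbit_close_def using Lp_seminorm(4)[OF p] by (metis diff_self)

lemma orbit_close_refl: "orbit_close f f"
proof -
  have "step_iso (id :: 'a stepf \<Rightarrow> 'a stepf)" by (simp add: step_iso_def linear_id)
  from orbit_close_iso[OF this] show ?thesis by simp
qed

lemma orbit_close_trans:
  assumes "orbit_close f g" "orbit_close g h"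
  shows "orbit_close f h"
  unfolding orbit_close_def
proof (intro allI impI)
  fix e :: real assume "0 < e"
  then have e: "0 < e / 2" by simp
  obtain S where S: "step_iso S" "Lp p (S f - g) < e / 2" using assms(1) e unfolding orbit_close_def by blast
  obtain T where T: "step_iso T" "Lp p (T g - h) < e / 2" using assms(2) e unfolding orbit_close_def by blast
  have eq: "T (S f) - h = T (S f - g) + (T g - h)" using T(1) by (simp add: step_iso_def linear_diff)
  have "Lp p (T (S f) - h) \<le> Lp p (T (S f - g)) + Lp p (T g - h)"
    unfolding eq by (rule Lp_triangle[OF p])
  then have "Lp p (T (S f) - h) \<le> Lp p (S f - g) + Lp p (T g - h)" using step_iso_Lp[OF T(1)] by simp
  then have "Lp p ((T \<circ> S) f - h) < e" using S(2) T(2) by simp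
  then show "\<exists>S. step_iso S \<and> Lp p (S f - h) < e" using step_iso_comp[OF T(1) S(1)] by blast
qed

lemma orbit_close_sym:
  assumes "orbit_close f g"
  shows "orbit_close g f"
  unfolding orbit_close_def
proof (intro allI impI)
  fix e :: real assume "0 < e"
  then obtain S where S: "step_iso S" "Lp p (S f - g) < e" using assms unfolding orbit_close_def by blast
  have i: "step_iso (inv S)" by (rule step_iso_inv[OF S(1)])
  have "inv S (S f) = f" using S(1) by (simp add: step_iso_def bij_is_inj)
  then have "inv S g - f = inv S (g - S f)" using i by (simp add: step_iso_def linear_diff)
  then have "Lp p (inv S g - f) = Lp p (S f - g)" using step_iso_Lp[OF i] Lp_seminorm(9)[OF p] by simp
  then show "\<exists>S. step_iso S \<and> Lp p (S g - f) < e" using i S(2) by auto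
qed

lemma orbit_close_Lp:
  assumes "orbit_close f g"
  shows "Lp p f = Lp p g"
proof -
  have le: "Lp p f \<le> Lp p g" if fg: "orbit_close f g" for f g :: "'b::banach stepf"
  proof (rule field_le_epsilon)
    fix e :: real assume "0 < e"
    then obtain S where S: "step_iso S" "Lp p (S f - g) < e" using fg unfolding orbit_close_def by blast
    have "Lp p (S f) \<le> Lp p g + Lp p (S f - g)" by (rule Lp_seminorm(8)[OF p])
    then show "Lp p f \<le> Lp p g + e" using S step_iso_Lp[OF S(1), of f] by linarith
  qed
  show ?thesis using le[OF assms] le[OF orbit_close_sym[OF assms]] by (rule antisym)
qed

lemma step_iso_tail:
  assumes S: "step_iso S" and d: "0 \<le> d"
  shows "step_iso (\<lambda>f. restr d f + shift d (S (shift (- d) f)))"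
proof -
  have i: "inv S (S f) = f" "S (inv S f) = f" for f
    using S by (simp_all add: step_iso_def bij_is_inj bij_is_surj surj_f_inv_f)
  have l: "linear S" and pow: "\<And>f. pow_int p (S f) = pow_int p f" using S by (auto simp: step_iso_def)
  show ?thesis
  proof (rule step_isoI[where S' = "\<lambda>f. restr d f + shift d (inv S (shift (- d) f))"])
    show "linear (\<lambda>f. restr d f + shift d (S (shift (- d) f)))"
      by (rule linearI) (simp_all add: linear_add[OF restr_linear] linear_add[OF shift_linear] linear_add[OF l]
          linear_scale[OF restr_linear] linear_scale[OF shift_linear] linear_scale[OF l] scaleR_add_right)
    fix f
    show "pow_int p (restr d f + shift d (S (shift (- d) f))) = pow_int p f"
      by (simp add: pow_int_split[OF d] pow pow_int_decompose[OF d, symmetric])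
  qed (use d in \<open>simp_all add: restr_shift shift_left_restr i restr_shift_split[symmetric]\<close>)
qed

text \<open>Dilation by \<open>r\<close> divides the power integral by \<open>r\<close>; the scalar
  factor restores it.\<close>

lemma step_iso_dilate:
  assumes r: "0 < r"
  shows "step_iso (\<lambda>f. r powr (1 / p) *\<^sub>R dilate r f)"
proof (rule step_isoI[where S' = "\<lambda>f. (1 / r) powr (1 / p) *\<^sub>R dilate (1 / r) f"])
  show "linear (\<lambda>f :: 'a stepf. r powr (1 / p) *\<^sub>R dilate r f)" by (intro linear_compose_scale_right dilate_linear r)
  have one: "(1 / r) powr (1 / p) * r powr (1 / p) = 1" using r by (simp flip: powr_mult)
  have r': "0 < 1 / r" using r by simp
  fix f :: "'a stepf"
  show "(1 / r) powr (1 / p) *\<^sub>R dilate (1 / r) (r powr (1 / p) *\<^sub>R dilate r f) = f"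
    using one r by (simp add: linear_scale[OF dilate_linear[OF r']] dilate_dilate dilate_1)
  show "r powr (1 / p) *\<^sub>R dilate r ((1 / r) powr (1 / p) *\<^sub>R dilate (1 / r) f) = f"
    using one r by (simp add: linear_scale[OF dilate_linear[OF r]] dilate_dilate dilate_1 mult.commute)
  show "pow_int p (r powr (1 / p) *\<^sub>R dilate r f) = pow_int p f"
    using r p by (simp add: pow_int_scale pow_int_dilate powr_powr)
qed

lemma step_iso_values:
  fixes U :: "'a::banach \<Rightarrow> 'a"
  assumes U: "linear U" "surj U" "\<And>x. norm (U x) = norm x" and d: "0 \<le> d"
  shows "step_iso (\<lambda>f. restr d (comp_step U f) + shift d (shift (- d) f))"
proof -
  have "inj U"
    using linear_inj_iff_eq_0[OF U(1)] U(3) by (metis norm_eq_zero)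
  then have i: "inv U (U x) = x" "U (inv U x) = x" for x using U(2) by (simp_all add: surj_f_inv_f)
  have U0: "U 0 = 0" by (rule linear_0[OF U(1)])
  have iU0: "inv U 0 = 0" using i(1)[of 0] U0 by simp
  show ?thesis
  proof (rule step_isoI[where S' = "\<lambda>f. restr d (comp_step (inv U) f) + shift d (shift (- d) f)"])
    show "linear (\<lambda>f. restr d (comp_step U f) + shift d (shift (- d) f))"
      by (rule linearI) (simp_all add: linear_add[OF restr_linear] linear_add[OF shift_linear] linear_add[OF comp_step_linear[OF U(1)]]
          linear_scale[OF restr_linear] linear_scale[OF shift_linear] linear_scale[OF comp_step_linear[OF U(1)]] scaleR_add_right)
    fix f
    show "restr d (comp_step (inv U) (restr d (comp_step U f) + shift d (shift (- d) f))) +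
        shift d (shift (- d) (restr d (comp_step U f) + shift d (shift (- d) f))) = f"
      by (rule stepf_eqI) (use d in \<open>auto simp: ev_comp_step U0 iU0 i ev_neg\<close>)
    show "restr d (comp_step U (restr d (comp_step (inv U) f) + shift d (shift (- d) f))) +
        shift d (shift (- d) (restr d (comp_step (inv U) f) + shift d (shift (- d) f))) = f"
      by (rule stepf_eqI) (use d in \<open>auto simp: ev_comp_step U0 iU0 i ev_neg\<close>)
    have "restr d (comp_step U f) = comp_step U (restr d f)"
      by (rule stepf_eqI) (simp add: ev_comp_step U0)
    then show "pow_int p (restr d (comp_step U f) + shift d (shift (- d) f)) = pow_int p f"
      using pow_int_split[OF d, of p "comp_step U f"] pow_int_decompose[OF d, of p f] pow_int_comp_isometry[OF U(1,3), of p "restr d f"]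
      by simp
  qed
qed

context
  fixes e :: "'a::banach"
  assumes AT: "almost_transitive (norm :: 'a \<Rightarrow> real)" and e: "norm e = 1"
begin

text \<open>The normal form for approximate orbits; it depends on \<open>f\<close> only through its
  norm.\<close>

definition std_form :: "'a stepf \<Rightarrow> 'a stepf" where
  "std_form f = cell 1 (Lp p f *\<^sub>R e)"

lemma orbit_close_tail:
  assumes "orbit_close g h" "0 \<le> d"
  shows "orbit_close (cell d y + shift d g) (cell d y + shift d h)"
  unfolding orbit_close_def
proof (intro allI impI)
  fix \<epsilon> :: real assume "0 < \<epsilon>"
  then obtain S where S: "step_iso S" "Lp p (S g - h) < \<epsilon>" using assms(1) unfolding orbit_close_def by blast
  let ?T = "\<lambda>f. restr d f + shift d (S (shift (- d) f))"
  have "?T (cell d y + shift d g) = cell d y + shift d (S g)"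
    using restr_shift[OF assms(2), of "cell d y" g] shift_left_restr[OF assms(2), of "cell d y" g]
    by (simp add: restr_cell_same)
  then have "?T (cell d y + shift d g) - (cell d y + shift d h) = shift d (S g - h)"
    by (simp add: linear_diff[OF shift_linear])
  then have "Lp p (?T (cell d y + shift d g) - (cell d y + shift d h)) < \<epsilon>"
    using S(2) by (simp add: Lp_shift[OF p assms(2)])
  then show "\<exists>S. step_iso S \<and> Lp p (S (cell d y + shift d g) - (cell d y + shift d h)) < \<epsilon>"
    using step_iso_tail[OF S(1) assms(2)] by blast
qed

text \<open>Here almost transitivity of the value space enters: an isometry of the values, applied
  on \<open>[0, d)\<close> alone, turns the first value towards \<open>e\<close>.\<close>

lemma orbit_close_head:
  assumes d: "0 \<le> d"
  shows "orbit_close (cell d y + shift d g) (cell d (norm y *\<^sub>R e) + shift d g)"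
proof (cases "y = 0")
  case True
  then show ?thesis by (simp add: orbit_close_refl)
next
  case False
  show ?thesis
    unfolding orbit_close_def
  proof (intro allI impI)
    fix \<epsilon> :: real assume \<epsilon>: "0 < \<epsilon>"
    define c where "c = (d powr (1 / p) + 1) * norm y"
    have c: "0 < c" using False by (simp add: c_def add_nonneg_pos)
    have "norm ((1 / norm y) *\<^sub>R y) = 1" using False by simp
    then obtain U where U: "linear U" "surj U" "\<And>x. norm (U x) = norm x" "norm (e - U ((1 / norm y) *\<^sub>R y)) \<le> \<epsilon> / (2 * c)"
      using AT e \<epsilon> c unfolding almost_transitive_def by (metis divide_pos_pos mult_pos_pos zero_less_numeral)
    let ?T = "\<lambda>f. restr d (comp_step U f) + shift d (shift (- d) f)"
    have U0: "U 0 = 0" by (rule linear_0[OF U(1)])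
    have "?T (cell d y + shift d g) = cell d (U y) + shift d g"
      by (rule stepf_eqI) (use d in \<open>auto simp: ev_comp_step U0 ev_neg\<close>)
    then have "?T (cell d y + shift d g) - (cell d (norm y *\<^sub>R e) + shift d g) = cell d (U y - norm y *\<^sub>R e)"
      by (simp add: cell_diff)
    then have "Lp p (?T (cell d y + shift d g) - (cell d (norm y *\<^sub>R e) + shift d g)) = d powr (1 / p) * norm (U y - norm y *\<^sub>R e)"
      by (simp add: Lp_cell[OF p d])
    also have "U y - norm y *\<^sub>R e = - (norm y *\<^sub>R (e - U ((1 / norm y) *\<^sub>R y)))"
      using False by (simp add: linear_scale[OF U(1)] scaleR_diff_right)
    also have "norm \<dots> = norm y * norm (e - U ((1 / norm y) *\<^sub>R y))" by simp
    also have "d powr (1 / p) * \<dots> \<le> (d powr (1 / p) + 1) * (norm y * (\<epsilon> / (2 * c)))"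
      using U(4) by (intro mult_mono) auto
    also have "\<dots> = c * (\<epsilon> / (2 * c))" by (simp only: c_def mult.assoc)
    also have "\<dots> = \<epsilon> / 2" using c by simp
    also have "\<dots> < \<epsilon>" using \<epsilon> by simp
    finally show "\<exists>S. step_iso S \<and> Lp p (S (cell d y + shift d g) - (cell d (norm y *\<^sub>R e) + shift d g)) < \<epsilon>"
      using step_iso_values[OF U(1,2,3) d] by blast
  qed
qed

lemma orbit_close_std_formI:
  assumes "orbit_close f (cell 1 (c *\<^sub>R e))" "0 \<le> c"
  shows "orbit_close f (std_form f)"
proof -
  have "Lp p f = c" using orbit_close_Lp[OF assms(1)] assms(2) e by (simp add: Lp_cell[OF p])
  then show ?thesis using assms(1) by (simp add: std_form_def)
qed

text \<open>The second cell is dilated until its value has the same norm as \<open>y\<close>; then both cells merge.\<close>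

lemma orbit_close_two_cells:
  assumes d: "0 < d" and y: "y \<noteq> 0" and r: "0 < r"
  shows "orbit_close (cell d y + shift d (cell 1 (r *\<^sub>R e))) (std_form (cell d y + shift d (cell 1 (r *\<^sub>R e))))"
proof -
  define a where "a = norm y"
  have a: "0 < a" using y by (simp add: a_def)
  define s where "s = (a / r) powr p"
  have s: "0 < s" "s powr (1 / p) = a / r" using a r p by (auto simp: s_def powr_powr)
  define m where "m = d + 1 / s"
  have m: "0 < m" using d s by (simp add: m_def add_pos_pos)
  have "orbit_close (cell 1 (r *\<^sub>R e)) (s powr (1 / p) *\<^sub>R dilate s (cell 1 (r *\<^sub>R e)))"
    by (rule orbit_close_iso[OF step_iso_dilate[OF s(1)]])
  also have "s powr (1 / p) *\<^sub>R dilate s (cell 1 (r *\<^sub>R e)) = cell (1 / s) (a *\<^sub>R e)"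
    using s r by (simp add: dilate_cell flip: cell_scale)
  finally have 1: "orbit_close (cell 1 (r *\<^sub>R e)) (cell (1 / s) (a *\<^sub>R e))" .
  have "orbit_close (cell d y + shift d (cell 1 (r *\<^sub>R e))) (cell d (a *\<^sub>R e) + shift d (cell 1 (r *\<^sub>R e)))"
    unfolding a_def using d by (intro orbit_close_head) simp
  moreover have "orbit_close (cell d (a *\<^sub>R e) + shift d (cell 1 (r *\<^sub>R e))) (cell d (a *\<^sub>R e) + shift d (cell (1 / s) (a *\<^sub>R e)))"
    using d by (intro orbit_close_tail 1) simp
  moreover have "cell d (a *\<^sub>R e) + shift d (cell (1 / s) (a *\<^sub>R e)) = cell m (a *\<^sub>R e)"
    using d s by (simp add: shift_cell m_def)
  moreover have "orbit_close (cell m (a *\<^sub>R e)) (m powr (1 / p) *\<^sub>R dilate m (cell m (a *\<^sub>R e)))"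
    by (rule orbit_close_iso[OF step_iso_dilate[OF m]])
  moreover have "m powr (1 / p) *\<^sub>R dilate m (cell m (a *\<^sub>R e)) = cell 1 ((m powr (1 / p) * a) *\<^sub>R e)"
    using m by (simp add: dilate_cell flip: cell_scale)
  ultimately have "orbit_close (cell d y + shift d (cell 1 (r *\<^sub>R e))) (cell 1 ((m powr (1 / p) * a) *\<^sub>R e))"
    using orbit_close_trans by metis
  then show ?thesis by (rule orbit_close_std_formI) (use a in simp)
qed

text \<open>Merging two cells needs both values nonzero. Degenerate cases are reached by
  approximation, since the normal form depends on \<open>f\<close> with Lipschitz constant
  \<open>1\<close>.\<close>

lemma orbit_close_std_form_perturb:
  assumes "\<And>\<eta>. 0 < \<eta> \<Longrightarrow> \<exists>f'. Lp p (f - f') < \<eta> \<and> orbit_close f' (std_form f')"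
  shows "orbit_close f (std_form f)"
  unfolding orbit_close_def
proof (intro allI impI)
  fix \<epsilon> :: real assume "0 < \<epsilon>"
  then have e3: "0 < \<epsilon> / 3" by simp
  obtain f' where f': "Lp p (f - f') < \<epsilon> / 3" "orbit_close f' (std_form f')" using assms[OF e3] by blast
  obtain S where S: "step_iso S" "Lp p (S f' - std_form f') < \<epsilon> / 3" using f'(2) e3 unfolding orbit_close_def by blast
  have l: "linear S" using S(1) by (simp add: step_iso_def)
  have sf: "Lp p (std_form f' - std_form f) = \<bar>Lp p f' - Lp p f\<bar>"
    using e by (simp add: std_form_def Lp_cell[OF p] flip: cell_diff scaleR_diff_left)
  have "\<bar>Lp p f' - Lp p f\<bar> \<le> Lp p (f - f')"
    using Lp_seminorm(8)[OF p, of f f'] Lp_seminorm(8)[OF p, of f' f] Lp_seminorm(9)[OF p, of f f'] by linarith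
  moreover have "S f - std_form f = (S (f - f') + (S f' - std_form f')) + (std_form f' - std_form f)"
    by (simp add: linear_diff[OF l])
  then have "Lp p (S f - std_form f) \<le> (Lp p (S (f - f')) + Lp p (S f' - std_form f')) + Lp p (std_form f' - std_form f)"
    using Lp_triangle[OF p, of "S (f - f') + (S f' - std_form f')" "std_form f' - std_form f"]
      Lp_triangle[OF p, of "S (f - f')" "S f' - std_form f'"] by simp
  ultimately have "Lp p (S f - std_form f) < \<epsilon>" using S f'(1) sf step_iso_Lp[OF S(1), of "f - f'"] by linarith
  then show "\<exists>S. step_iso S \<and> Lp p (S f - std_form f) < \<epsilon>" using S(1) by blast
qed

text \<open>By induction the tail moves to a single cell without disturbing the first one, and the
  two cells that remain are merged.\<close>

lemma orbit_close_std_form: "orbit_close f (std_form f)"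
proof (induction f rule: stepf_induct_cell_shift)
  case 1
  show ?case by (rule orbit_close_std_formI[of _ 0]) (simp_all add: cell_0 orbit_close_refl)
next
  case (2 d y g)
  define r where "r = Lp p g"
  have r: "0 \<le> r" by (simp add: r_def Lp_nonneg[OF p])
  define h where "h = cell d y + shift d (cell 1 (r *\<^sub>R e))"
  have fh: "orbit_close (cell d y + shift d g) h"
    unfolding h_def using 2 by (intro orbit_close_tail) (auto simp: std_form_def r_def)
  have "orbit_close h (std_form h)"
  proof (rule orbit_close_std_form_perturb)
    fix \<eta> :: real assume \<eta>: "0 < \<eta>"
    define c where "c = d powr (1 / p) + 1"
    have c: "0 < c" by (simp add: c_def add_nonneg_pos)
    define \<xi> where "\<xi> = \<eta> / (2 * c)"
    have \<xi>: "0 < \<xi>" using \<eta> c by (simp add: \<xi>_def)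
    define y' where "y' = (if y = 0 then \<xi> *\<^sub>R e else y)"
    define r' where "r' = (if r = 0 then \<xi> else r)"
    have e0: "e \<noteq> 0" using e by auto
    have y': "y' \<noteq> 0" "norm (y - y') \<le> \<xi>" and r': "0 < r'" "\<bar>r - r'\<bar> \<le> \<xi>"
      using \<xi> r e e0 by (auto simp: y'_def r'_def)
    define h' where "h' = cell d y' + shift d (cell 1 (r' *\<^sub>R e))"
    have "h - h' = cell d (y - y') + shift d (cell 1 ((r - r') *\<^sub>R e))"
      by (simp add: h_def h'_def cell_diff linear_diff[OF shift_linear] scaleR_diff_left)
    then have "Lp p (h - h') \<le> Lp p (cell d (y - y')) + Lp p (shift d (cell 1 ((r - r') *\<^sub>R e)))"
      using Lp_triangle[OF p] by simp
    also have "\<dots> = d powr (1 / p) * norm (y - y') + \<bar>r - r'\<bar>"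
      using 2 e by (simp add: Lp_cell[OF p] Lp_shift[OF p])
    also have "\<dots> \<le> d powr (1 / p) * \<xi> + \<xi>" using y' r' by (intro add_mono mult_left_mono) auto
    also have "\<dots> = c * \<xi>" by (simp add: c_def algebra_simps)
    also have "\<dots> = \<eta> / 2" using c by (simp add: \<xi>_def)
    also have "\<dots> < \<eta>" using \<eta> by simp
    finally have "Lp p (h - h') < \<eta>" .
    moreover have "orbit_close h' (std_form h')" unfolding h'_def using 2 by (intro orbit_close_two_cells y' r')
    ultimately show "\<exists>f'. Lp p (h - f') < \<eta> \<and> orbit_close f' (std_form f')" by blast
  qed
  then have "orbit_close (cell d y + shift d g) (std_form h)" using orbit_close_trans[OF fh] by blast
  moreover have "Lp p (cell d y + shift d g) = Lp p h" by (rule orbit_close_Lp[OF fh])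
  ultimately show ?case by (simp add: std_form_def)
qed

lemma orbit_close_same_norm:
  fixes f g :: "'a stepf"
  assumes "Lp p f = Lp p g"
  shows "orbit_close f g"
proof -
  have "std_form f = std_form g" using assms by (simp add: std_form_def)
  then show ?thesis
    using orbit_close_trans[OF orbit_close_std_form[of f]] orbit_close_sym[OF orbit_close_std_form[of g]] by simp
qed

end

end

section \<open>\<open>L\<^sub>p\<close>-projections\<close>

text \<open>The classical notion of an L-projection with exponent \<open>p\<close>. Zero and the
  identity are excluded because they satisfy the equation for every exponent and would not
  distinguish norms.\<close>

definition Lp_projection :: "real \<Rightarrow> ('a::real_vector \<Rightarrow> real) \<Rightarrow> ('a \<Rightarrow> 'a) \<Rightarrow> bool" where
  "Lp_projection p q P \<longleftrightarrow> linear P \<and> (\<forall>x. P (P x) = P x) \<and>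
     (\<forall>x. q x powr p = q (P x) powr p + q (x - P x) powr p) \<and> (\<exists>x. P x \<noteq> 0) \<and> (\<exists>x. P x \<noteq> x)"

lemma Lp_projectionD:
  assumes "Lp_projection p q P"
  shows "linear P" "P (P x) = P x" "q x powr p = q (P x) powr p + q (x - P x) powr p"
    "\<exists>x. P x \<noteq> 0" "\<exists>x. P x \<noteq> x"
  using assms unfolding Lp_projection_def by blast+

lemma Lp_projection_complement:
  assumes "Lp_projection p q P"
  shows "Lp_projection p q (\<lambda>x. x - P x)"
proof -
  note P = Lp_projectionD[OF assms]
  have "linear (\<lambda>x. x - P x)" by (intro linear_compose_sub linear_ident P)
  moreover have "x - P x - P (x - P x) = x - P x" for x by (simp add: linear_diff[OF P(1)] P(2))
  moreover have "q x powr p = q (x - P x) powr p + q (x - (x - P x)) powr p" for x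
    using P(3)[of x] by simp
  moreover have "\<exists>x. x - P x \<noteq> 0"
  proof -
    obtain x where "P x \<noteq> x" using P(5) by blast
    then have "x - P x \<noteq> 0" by simp
    then show ?thesis by blast
  qed
  moreover have "\<exists>x. x - P x \<noteq> x"
  proof -
    obtain x where "P x \<noteq> 0" using P(4) by blast
    then have "x - P x \<noteq> x" by simp
    then show ?thesis by blast
  qed
  ultimately show ?thesis unfolding Lp_projection_def by blast
qed

lemma Lp_projection_conjugate:
  assumes "Lp_projection p q Q" and T: "linear T" "bij T" "\<And>x. q' x = q (T x)"
  shows "Lp_projection p q' (\<lambda>x. inv T (Q (T x)))"
proof -
  note Q = Lp_projectionD[OF assms(1)]
  have i1: "inv T (T x) = x" for x using T(2) by (simp add: bij_is_inj)
  have i2: "T (inv T y) = y" for y using T(2) by (simp add: bij_is_surj surj_f_inv_f)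
  note i = i1 i2
  have lT': "linear (inv T)"
    by (rule linearI) (metis i linear_add[OF T(1)], metis i linear_scale[OF T(1)])
  have "linear (inv T \<circ> (Q \<circ> T))" by (intro linear_compose T(1) Q(1) lT')
  then have l: "linear (\<lambda>x. inv T (Q (T x)))" by (simp add: o_def)
  have e: "T (x - inv T (Q (T x))) = T x - Q (T x)" for x by (simp add: linear_diff[OF T(1)] i)
  obtain x where x: "Q x \<noteq> 0" using Q(4) by blast
  obtain y where y: "Q y \<noteq> y" using Q(5) by blast
  have "inv T (Q (T (inv T x))) \<noteq> 0" using x by (metis i linear_0[OF T(1)])
  then have ne1: "\<exists>z. inv T (Q (T z)) \<noteq> 0" by blast
  have "inv T (Q (T (inv T y))) \<noteq> inv T y" using y by (metis i)
  then have ne2: "\<exists>z. inv T (Q (T z)) \<noteq> z" by blast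
  show ?thesis
    unfolding Lp_projection_def T(3) e i Q(2) using l Q(3) ne1 ne2 by blast
qed

text \<open>Weighted arithmetic-geometric mean inequality, from convexity of \<open>exp\<close>.
  With \<open>\<theta> = p / r\<close> it turns an exact formula for \<open>r\<close>-th powers of a
  norm into an upper bound for \<open>p\<close>-th powers.\<close>

lemma powr_below_tangent:
  fixes t A \<theta> :: real
  assumes \<theta>: "0 < \<theta>" "\<theta> \<le> 1" and t: "0 \<le> t" and A: "0 < A"
  shows "t powr \<theta> \<le> A powr \<theta> + \<theta> * A powr \<theta> / A * (t - A)"
proof -
  have key: "s powr \<theta> \<le> 1 + \<theta> * (s - 1)" if s: "0 \<le> s" for s
  proof (cases "s = 0")
    case False
    then have s: "0 < s" using s by simp
    have "exp ((1 - \<theta>) *\<^sub>R 0 + \<theta> *\<^sub>R ln s) \<le> (1 - \<theta>) * exp 0 + \<theta> * exp (ln s)"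
      using \<theta> by (intro convex_onD[OF exp_convex]) auto
    then show ?thesis using s by (simp add: powr_def algebra_simps)
  qed (use \<theta> in simp)
  have "t powr \<theta> = A powr \<theta> * (t / A) powr \<theta>" using A by (simp flip: powr_mult)
  also have "\<dots> \<le> A powr \<theta> * (1 + \<theta> * (t / A - 1))" using t A by (intro mult_left_mono key) auto
  also have "\<dots> = A powr \<theta> + \<theta> * A powr \<theta> / A * (t - A)" using A by (simp add: field_simps)
  finally show ?thesis .
qed

text \<open>As \<open>r \<le> 2\<close>, \<open>s powr r\<close> is a concave function of the square
  of \<open>s\<close> and lies below its tangent at \<open>1\<close>; the squares of
  \<open>1 + h\<close> and \<open>1 - h\<close> add up to \<open>2 + 2 * h\<^sup>2\<close>.\<close>

lemma powr_second_difference: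
  fixes h r :: real
  assumes h: "0 < h" "h < 1" and r: "0 < r" "r \<le> 2"
  shows "(1 + h) powr r + (1 - h) powr r \<le> 2 + r * h\<^sup>2"
proof -
  have sq: "(s\<^sup>2) powr (r / 2) = s powr r" if "0 < s" for s :: real
  proof -
    have "s\<^sup>2 = s powr 2" using that by (simp add: powr_numeral)
    then show ?thesis by (simp add: powr_powr)
  qed
  have t: "s powr r \<le> 1 + r / 2 * (s\<^sup>2 - 1)" if "0 < s" for s :: real
    using powr_below_tangent[of "r / 2" "s\<^sup>2" 1] r unfolding sq[OF that] by simp
  have "(1 + h) powr r + (1 - h) powr r \<le> (1 + r / 2 * ((1 + h)\<^sup>2 - 1)) + (1 + r / 2 * ((1 - h)\<^sup>2 - 1))"
    using h by (intro add_mono t) auto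
  also have "\<dots> = 2 + r * h\<^sup>2" by (simp add: power2_eq_square algebra_simps)
  finally show ?thesis .
qed

lemma le_small_power_imp_le_0:
  fixes Y C a :: real
  assumes a: "0 < a" and le: "\<And>h. 0 < h \<Longrightarrow> h < 1 \<Longrightarrow> Y \<le> C * h powr a"
  shows "Y \<le> 0"
proof -
  have "(\<lambda>n. inverse (real (Suc n)) powr a) \<longlonglongrightarrow> 0 powr a"
    using a by (intro tendsto_powr' LIMSEQ_inverse_real_of_nat tendsto_const) (auto intro!: always_eventually)
  then have "(\<lambda>n. C * inverse (real (Suc n)) powr a) \<longlonglongrightarrow> C * 0 powr a" by (rule tendsto_mult_left)
  moreover have "Y \<le> C * inverse (real (Suc n)) powr a" if "n \<ge> 1" for n
    using that by (intro le) (auto simp: field_simps)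
  ultimately have "Y \<le> C * 0 powr a" by (intro LIMSEQ_le_const[of _ _ Y]) auto
  then show ?thesis by simp
qed

context
  fixes q :: "'a::real_vector \<Rightarrow> real" and p r :: real
  assumes q: "norm_on UNIV q" and p: "1 < p" and pr: "p < r" and r: "r < 2"
begin

lemmas qs = seminorm_onD[OF norm_on_seminorm[OF q], simplified]

lemma q_eq_0: "q x = 0 \<Longrightarrow> x = 0"
  using norm_on_zero[OF q] by simp

lemma q_midpoint: "2 * q (x + y) powr p \<le> q (x + (y + z)) powr p + q (x + (y - z)) powr p"
proof -
  have "x + y = (1 / 2) *\<^sub>R ((x + (y + z)) + (x + (y - z)))"
    by (simp add: scaleR_add_left[symmetric] flip: scaleR_2)
  then have "q (x + y) = 1 / 2 * q ((x + (y + z)) + (x + (y - z)))"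
    using qs(2)[of "1 / 2" "(x + (y + z)) + (x + (y - z))"] by simp
  then have "q (x + y) \<le> (1 - 1 / 2) * q (x + (y + z)) + 1 / 2 * q (x + (y - z))"
    using qs(3)[of "x + (y + z)" "x + (y - z)"] by simp
  then have "q (x + y) powr p \<le> ((1 - 1 / 2) * q (x + (y + z)) + 1 / 2 * q (x + (y - z))) powr p"
    using p qs(6) by (intro powr_mono2) auto
  also have "\<dots> \<le> (1 - 1 / 2) * q (x + (y + z)) powr p + 1 / 2 * q (x + (y - z)) powr p"
    using p qs(6) by (intro powr_convex_combination) auto
  finally show ?thesis by simp
qed

lemma q_powr_quotient: "q x powr p = (q x powr r) powr (p / r)"
  using p pr by (simp add: powr_powr)

text \<open>
  Along the line \<open>Q x + s (x - Q x)\<close> the \<open>p\<close>-th power of the norm is twice differentiable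
  at \<open>s = 1\<close> because of \<open>Q\<close>, whereas \<open>P\<close> splits it into a convex function and a multiple of
  \<open>\<bar>1 - s\<bar> powr p\<close>, whose second difference quotient blows up since \<open>p < 2\<close>.
\<close>

lemma Lp_projections_invariant:
  assumes P: "Lp_projection p q P" and Q: "Lp_projection r q Q" and x: "P x = x"
  shows "P (Q x) = Q x"
proof (cases "x = 0")
  case True
  then show ?thesis using linear_0 Lp_projectionD(1)[OF P] Lp_projectionD(1)[OF Q] by metis
next
  case False
  note p' = Lp_projectionD[OF P] and q' = Lp_projectionD[OF Q]
  define u where "u = P (Q x)"
  define v where "v = P (x - Q x)"
  \<comment> \<open>The part of \<open>Q x\<close> outside the range of \<open>P\<close>; the claim
    is \<open>y = 0\<close>.\<close>
  define y where "y = Q x - u"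
  define \<alpha> where "\<alpha> = q (Q x) powr r"
  define \<beta> where "\<beta> = q (x - Q x) powr r"
  define A where "A = \<alpha> + \<beta>"
  define \<theta> where "\<theta> = p / r"
  have \<theta>: "0 < \<theta>" "\<theta> \<le> 1" using p pr by (auto simp: \<theta>_def)
  have \<beta>0: "0 \<le> \<beta>" "0 \<le> \<alpha>" by (simp_all add: \<alpha>_def \<beta>_def)
  have A: "A = q x powr r" using q'(3)[of x] by (simp add: A_def \<alpha>_def \<beta>_def)
  have "q x \<noteq> 0" using False q_eq_0 by blast
  then have A0: "0 < A" by (simp add: A)
  define w where "w s = Q x + s *\<^sub>R (x - Q x)" for s
  have uv: "u + v = x" using x by (simp add: u_def v_def flip: linear_add[OF p'(1)])
  have Pw: "P (w s) = u + s *\<^sub>R v" for s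
    by (simp add: w_def u_def v_def linear_add[OF p'(1)] linear_scale[OF p'(1)])
  \<comment> \<open>\<open>w 1\<close> is \<open>x\<close>, which \<open>P\<close> fixes, so the
    complementary part of \<open>w s\<close> vanishes at \<open>s = 1\<close>.\<close>
  have wPw: "w s - P (w s) = (1 - s) *\<^sub>R y" for s
  proof -
    have v: "v = x - u" using uv by (simp add: algebra_simps)
    show ?thesis unfolding Pw by (simp add: w_def y_def v algebra_simps)
  qed
  have Qw: "Q (w s) = Q x" for s
    by (simp add: w_def linear_add[OF q'(1)] linear_scale[OF q'(1)] linear_diff[OF q'(1)] q'(2))
  have wr: "q (w s) powr r = \<alpha> + \<bar>s\<bar> powr r * \<beta>" for s
    using q'(3)[of "w s"] unfolding Qw by (simp add: w_def \<alpha>_def \<beta>_def qs(2) powr_mult)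
  have wp: "q (w s) powr p = q (u + s *\<^sub>R v) powr p + \<bar>1 - s\<bar> powr p * q y powr p" for s
    using p'(3)[of "w s"] unfolding wPw unfolding Pw by (simp add: qs(2) powr_mult)
  define K where "K = \<theta> * A powr \<theta> / A * \<beta>"
  have K0: "0 \<le> K" using \<theta> A0 \<beta>0 by (simp add: K_def)
  \<comment> \<open>This bound comes from \<open>Q\<close>; it is attained at \<open>s = 1\<close>
    and its second difference there is of order \<open>h\<^sup>2\<close>.\<close>
  have up: "q (w s) powr p \<le> A powr \<theta> + K * (\<bar>s\<bar> powr r - 1)" for s
  proof -
    have "q (w s) powr p = (\<alpha> + \<bar>s\<bar> powr r * \<beta>) powr \<theta>" by (simp add: q_powr_quotient wr \<theta>_def)
    also have "\<dots> \<le> A powr \<theta> + \<theta> * A powr \<theta> / A * (\<alpha> + \<bar>s\<bar> powr r * \<beta> - A)"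
      using \<beta>0 by (intro powr_below_tangent \<theta> A0) simp
    also have "\<alpha> + \<bar>s\<bar> powr r * \<beta> - A = (\<bar>s\<bar> powr r - 1) * \<beta>" by (simp add: A_def algebra_simps)
    finally show ?thesis by (simp add: K_def mult_ac)
  qed
  have w1: "q (u + v) powr p = A powr \<theta>" using q_powr_quotient[of x] by (simp add: uv A \<theta>_def)
  define C where "C = K * r"
  have C0: "0 \<le> C" using K0 p pr by (simp add: C_def)
  have "q y powr p \<le> 0"
  \<comment> \<open>In the sum over \<open>1 + h\<close> and \<open>1 - h\<close> the convex part
    from \<open>P\<close> is at least twice its value at \<open>1\<close>, which leaves
    \<open>h powr p\<close> against \<open>h\<^sup>2\<close>.\<close>
  proof (rule le_small_power_imp_le_0[of "2 - p" _ C])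
    show "0 < 2 - p" using pr r by simp
    fix h :: real assume h: "0 < h" "h < 1"
    have "2 * q (u + v) powr p \<le> q (u + (v + h *\<^sub>R v)) powr p + q (u + (v - h *\<^sub>R v)) powr p" by (rule q_midpoint)
    then have mid: "2 * A powr \<theta> \<le> q (u + (1 + h) *\<^sub>R v) powr p + q (u + (1 - h) *\<^sub>R v) powr p"
      by (simp add: w1 scaleR_add_left scaleR_diff_left)
    have "2 * A powr \<theta> + 2 * (h powr p * q y powr p) \<le> q (w (1 + h)) powr p + q (w (1 - h)) powr p"
      using mid h by (simp add: wp)
    also have "\<dots> \<le> 2 * A powr \<theta> + K * ((1 + h) powr r + (1 - h) powr r - 2)"
      using up[of "1 + h"] up[of "1 - h"] h by (simp add: algebra_simps)
    also have "\<dots> \<le> 2 * A powr \<theta> + K * (r * h\<^sup>2)"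
      using powr_second_difference[OF h, of r] p pr r K0
      by (intro add_left_mono mult_left_mono) auto
    finally have "2 * (h powr p * q y powr p) \<le> C * h\<^sup>2" by (simp add: C_def mult.assoc)
    moreover have "0 \<le> C * h\<^sup>2" using C0 by simp
    ultimately have "h powr p * q y powr p \<le> C * h\<^sup>2" by linarith
    also have "h\<^sup>2 = h powr p * h powr (2 - p)"
      using h by (simp add: powr_numeral flip: powr_add)
    finally have "h powr p * q y powr p \<le> h powr p * (C * h powr (2 - p))" by (simp add: mult_ac)
    then show "q y powr p \<le> C * h powr (2 - p)" using h by simp
  qed
  then have "q y = 0" by (simp add: not_less[symmetric])
  then have "y = 0" by (rule q_eq_0)
  then show ?thesis by (simp add: y_def u_def)
qed

text \<open>Expand the norm at \<open>x\<close> in direction \<open>d\<close>. By \<open>Q\<close>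
  its \<open>p\<close>-th power grows by at most a multiple of \<open>\<bar>t\<bar> powr r\<close>;
  by \<open>P\<close> and convexity its average over \<open>t\<close> and \<open>- t\<close> grows
  by at least \<open>\<bar>t\<bar> powr p\<close> times that of \<open>P d\<close>. Since
  \<open>p < r\<close>, \<open>P d\<close> vanishes.\<close>

lemma Lp_projections_kernel:
  assumes P: "Lp_projection p q P" and Q: "Lp_projection r q Q"
    and x: "P x = 0" "Q x = x" "x \<noteq> 0" and d: "Q d = 0"
  shows "P d = 0"
proof -
  note p' = Lp_projectionD[OF P] and q' = Lp_projectionD[OF Q]
  define A where "A = q x powr r"
  have "q x \<noteq> 0" using x q_eq_0 by blast
  then have A0: "0 < A" by (simp add: A_def)
  define \<theta> where "\<theta> = p / r"
  have \<theta>: "0 < \<theta>" "\<theta> \<le> 1" using p pr by (auto simp: \<theta>_def)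
  have xp: "q x powr p = A powr \<theta>" by (simp add: q_powr_quotient A_def \<theta>_def)
  define C where "C = \<theta> * A powr \<theta> / A * q d powr r"
  have key: "q (x + t *\<^sub>R d) powr p \<le> A powr \<theta> + C * \<bar>t\<bar> powr r" for t
  proof -
    have "Q (x + t *\<^sub>R d) = x" by (simp add: linear_add[OF q'(1)] linear_scale[OF q'(1)] x d)
    then have "q (x + t *\<^sub>R d) powr r = A + \<bar>t\<bar> powr r * q d powr r"
      using q'(3)[of "x + t *\<^sub>R d"] by (simp add: A_def qs(2) powr_mult)
    then have "q (x + t *\<^sub>R d) powr p = (A + \<bar>t\<bar> powr r * q d powr r) powr \<theta>" by (simp add: q_powr_quotient \<theta>_def)
    also have "\<dots> \<le> A powr \<theta> + \<theta> * A powr \<theta> / A * (A + \<bar>t\<bar> powr r * q d powr r - A)"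
      using A0 by (intro powr_below_tangent \<theta> A0) simp
    finally show ?thesis by (simp add: C_def mult_ac)
  qed
  have split: "q (x + t *\<^sub>R d) powr p = \<bar>t\<bar> powr p * q (P d) powr p + q (x + t *\<^sub>R (d - P d)) powr p" for t
  proof -
    have 1: "P (x + t *\<^sub>R d) = t *\<^sub>R P d" by (simp add: linear_add[OF p'(1)] linear_scale[OF p'(1)] x)
    have 2: "x + t *\<^sub>R d - t *\<^sub>R P d = x + t *\<^sub>R (d - P d)" by (simp add: scaleR_diff_right)
    show ?thesis using p'(3)[of "x + t *\<^sub>R d"] unfolding 1 2 by (simp add: qs(2) powr_mult)
  qed
  have "q (P d) powr p \<le> 0"
  proof (rule le_small_power_imp_le_0[of "r - p" _ C])
    show "0 < r - p" using pr by simp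
    fix h :: real assume h: "0 < h" "h < 1"
    have "2 * q (x + 0) powr p \<le> q (x + (0 + h *\<^sub>R (d - P d))) powr p + q (x + (0 - h *\<^sub>R (d - P d))) powr p"
      by (rule q_midpoint)
    then have "2 * A powr \<theta> + 2 * (h powr p * q (P d) powr p) \<le> q (x + h *\<^sub>R d) powr p + q (x + (- h) *\<^sub>R d) powr p"
      using h by (simp only: split) (simp add: xp)
    also have "\<dots> \<le> 2 * A powr \<theta> + 2 * (C * h powr r)" using key[of h] key[of "- h"] h by simp
    finally have "h powr p * q (P d) powr p \<le> C * h powr r" by simp
    also have "h powr r = h powr p * h powr (r - p)" by (simp flip: powr_add)
    finally have "h powr p * q (P d) powr p \<le> h powr p * (C * h powr (r - p))" by (simp add: mult_ac)
    then show "q (P d) powr p \<le> C * h powr (r - p)" using h by simp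
  qed
  then have "q (P d) = 0" by (simp add: not_less[symmetric])
  then show ?thesis by (rule q_eq_0)
qed

text \<open>A nonzero \<open>x\<close> would put the kernel of \<open>Q\<close> in the kernel of
  \<open>P\<close>. A nonzero vector of the former then plays the role of \<open>x\<close> for the
  complement of \<open>Q\<close>, so the range of \<open>Q\<close> is killed too, and
  \<open>P\<close> would be zero.\<close>

lemma Lp_projections_disjoint:
  assumes P: "Lp_projection p q P" and Q: "Lp_projection r q Q" and x: "P x = 0" "Q x = x"
  shows "x = 0"
proof (rule ccontr)
  assume x0: "x \<noteq> 0"
  note p' = Lp_projectionD[OF P] and q' = Lp_projectionD[OF Q]
  obtain z where z: "Q z \<noteq> z" using q'(5) by blast
  define d where "d = z - Q z"
  have d: "d \<noteq> 0" "Q d = 0" using z by (auto simp: d_def linear_diff[OF q'(1)] q'(2))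
  have ker: "P e = 0" if "Q e = 0" for e by (rule Lp_projections_kernel[OF P Q x x0 that])
  have ran: "P e = 0" if "Q e = e" for e
    by (rule Lp_projections_kernel[OF P Lp_projection_complement[OF Q] ker[OF d(2)] _ d(1)]) (use that d in auto)
  have "P e = 0" for e
  proof -
    have "P e = P (Q e) + P (e - Q e)" by (simp flip: linear_add[OF p'(1)])
    also have "\<dots> = 0" using ran[of "Q e"] ker[of "e - Q e"] by (simp add: q'(2) linear_diff[OF q'(1)])
    finally show ?thesis .
  qed
  then show False using p'(4) by blast
qed

text \<open>Range and kernel of \<open>P\<close> are invariant under \<open>Q\<close>, so the
  projections commute. The range of \<open>Q\<close> meets the range of \<open>P\<close> only in
  \<open>0\<close>, so \<open>P (Q x) = 0\<close>; it also meets the kernel of \<open>P\<close> only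
  in \<open>0\<close>, so \<open>Q x = 0\<close>, against nontriviality.\<close>

lemma no_two_Lp_projections:
  assumes P: "Lp_projection p q P" and Q: "Lp_projection r q Q"
  shows False
proof -
  note p' = Lp_projectionD[OF P] and q' = Lp_projectionD[OF Q]
  note P' = Lp_projection_complement[OF P]
  have commute: "P (Q x) = Q (P x)" for x
  proof -
    have 1: "P (Q (P x)) = Q (P x)" by (rule Lp_projections_invariant[OF P Q p'(2)])
    have "Q (x - P x) - P (Q (x - P x)) = Q (x - P x)"
      by (rule Lp_projections_invariant[OF P' Q]) (simp add: linear_diff[OF p'(1)] p'(2))
    then have 2: "P (Q (x - P x)) = 0" by simp
    have "P (Q x) = P (Q (P x)) + P (Q (x - P x))"
      by (simp flip: linear_add[OF p'(1)] linear_add[OF q'(1)])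
    then show ?thesis using 1 2 by simp
  qed
  have "Q x = 0" for x
  proof -
    have 1: "P (Q x) = 0"
      by (rule Lp_projections_disjoint[OF P' Q]) (simp_all add: p'(2), metis commute q'(2))
    have "Q x = 0" by (rule Lp_projections_disjoint[OF P Q 1 q'(2)])
    then show ?thesis .
  qed
  then show False using q'(4) by blast
qed

end

section \<open>Renormings\<close>

text \<open>Up to equivalence of norms the Banach space is a completion for \<open>N\<close>; the
  locale expresses this without forming one.\<close>

locale dense_embedding =
  fixes \<Theta> :: "'b::real_vector \<Rightarrow> 'a::banach" and N :: "'b \<Rightarrow> real" and c C :: real
  assumes N: "norm_on UNIV N" and lin: "linear \<Theta>" and c: "0 < c"
    and lower: "c * N f \<le> norm (\<Theta> f)" and upper: "norm (\<Theta> f) \<le> C * N f"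
    and dense_range: "closure (range \<Theta>) = UNIV"
begin

lemmas Ns = seminorm_onD[OF norm_on_seminorm[OF N], simplified]

text \<open>The infimum is the continuous extension to the whole space of the norm \<open>N\<close> transported by \<open>\<Theta>\<close>.\<close>

definition transported :: "'a \<Rightarrow> real" where
  "transported x = inf_gauge UNIV N \<Theta> (\<lambda>x. norm x / c) (\<lambda>_. 0) (\<lambda>_::real. 0) (x, 0)"

lemma scaled_norm_seminorm: "seminorm_on UNIV (\<lambda>x::'a. norm x / c)"
  unfolding seminorm_on_def using c by (simp add: norm_triangle_ineq divide_right_mono flip: add_divide_distrib)

text \<open>The second factor of the gauge is a dummy: with the zero seminorm and the zero map only
  the first component counts.\<close>

lemma zero_seminorm: "seminorm_on UNIV (\<lambda>_::real. 0)"
  by (simp add: seminorm_on_def)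

lemmas gauge = inf_gauge_facts[OF scaled_norm_seminorm zero_seminorm norm_on_seminorm[OF N] lin _ linear_zero, simplified]

lemma transported_le: "transported x \<le> norm (x - \<Theta> f) / c + N f"
  using gauge(2)[of "(x, 0)" f] by (simp add: transported_def)

lemma transported_ge: "(\<And>f. k \<le> norm (x - \<Theta> f) / c + N f) \<Longrightarrow> k \<le> transported x"
  unfolding transported_def by (rule gauge(3)) simp

lemma transported_seminorm: "seminorm_on UNIV transported"
proof -
  note g = seminorm_onD[OF gauge(1), simplified]
  have "transported (a *\<^sub>R x) = \<bar>a\<bar> * transported x" for a x
    using g(2)[of a "(x, 0)"] by (simp add: transported_def)
  moreover have "transported (x + y) \<le> transported x + transported y" for x y
    using g(3)[of "(x, 0)" "(y, 0)"] by (simp add: transported_def)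
  ultimately show ?thesis by (simp add: seminorm_on_def)
qed

lemmas ts = seminorm_onD[OF transported_seminorm, simplified]

text \<open>On the range, \<open>norm x / c\<close> dominates \<open>N\<close>, so splitting a
  vector of the range never lowers its cost.\<close>

lemma transported_\<Theta>: "transported (\<Theta> f) = N f"
proof (rule antisym)
  show "transported (\<Theta> f) \<le> N f" using transported_le[of "\<Theta> f" f] by simp
  show "N f \<le> transported (\<Theta> f)"
  proof (rule transported_ge)
    fix g
    have "N (f - g) \<le> norm (\<Theta> f - \<Theta> g) / c"
      using lower[of "f - g"] c by (simp add: linear_diff[OF lin] pos_le_divide_eq mult.commute)
    then show "N f \<le> norm (\<Theta> f - \<Theta> g) / c + N g" using Ns(8)[of f g] by simp
  qed
qed

lemma transported_upper: "transported x \<le> norm x / c"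
  using transported_le[of x 0] by (simp add: linear_0[OF lin] Ns)

lemma transported_lower: "norm x \<le> max c C * transported x"
proof -
  have m: "0 < max c C" using c by simp
  have "norm x / max c C \<le> transported x"
  proof (rule transported_ge)
    fix f
    have "norm x \<le> norm (x - \<Theta> f) + norm (\<Theta> f)" using norm_triangle_sub[of x "\<Theta> f"] by simp
    also have "norm (x - \<Theta> f) = c * (norm (x - \<Theta> f) / c)" using c by simp
    also have "\<dots> \<le> max c C * (norm (x - \<Theta> f) / c)" using c by (intro mult_right_mono) auto
    also have "norm (\<Theta> f) \<le> max c C * N f"
      using upper[of f] mult_right_mono[of C "max c C" "N f"] Ns(6)[of f] by simp
    finally show "norm x / max c C \<le> norm (x - \<Theta> f) / c + N f"
      using m by (simp add: pos_divide_le_eq distrib_left mult.commute)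
  qed
  then show ?thesis using m by (simp add: pos_divide_le_eq mult.commute)
qed

lemma transported_norm: "norm_on UNIV transported"
proof -
  have "x = 0" if "transported x = 0" for x using transported_lower[of x] that by simp
  then show ?thesis using ts by (auto simp: norm_on_def)
qed

lemma transported_equivalent: "equivalent_norm transported"
  unfolding equivalent_norm_def
proof (rule conjI[OF transported_norm], rule exI[of _ "1 / max c C"], rule exI[of _ "1 / c"], intro conjI allI)
  have m: "0 < max c C" using c by simp
  then show "0 < 1 / max c C" "0 < 1 / c" using c by auto
  show "1 / max c C * norm x \<le> transported x" for x
    using transported_lower[of x] m by (simp add: pos_divide_le_eq mult.commute)
  show "transported x \<le> 1 / c * norm x" for x using transported_upper[of x] by simp
qed

lemma transported_continuous: "continuous_on UNIV transported"
proof (rule continuous_onI)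
  fix x :: 'a and e :: real assume e: "0 < e"
  have "dist (transported y) (transported x) \<le> e" if d: "dist y x < e * c" for y
  proof -
    have "\<bar>transported y - transported x\<bar> \<le> transported (y - x)"
      using ts(8)[of y x] ts(8)[of x y] ts(9)[of x y] by linarith
    also have "\<dots> \<le> norm (y - x) / c" by (rule transported_upper)
    also have "\<dots> \<le> e" using d c by (simp add: dist_norm pos_divide_le_eq)
    finally show ?thesis by (simp add: dist_real_def)
  qed
  then show "\<exists>d>0. \<forall>x'\<in>UNIV. dist x' x < d \<longrightarrow> dist (transported x') (transported x) \<le> e"
    using e c by (intro exI[of _ "e * c"]) auto
qed

lemma eq_by_density:
  fixes F G :: "'a \<Rightarrow> 'z::t2_space"
  assumes "continuous_on UNIV F" "continuous_on UNIV G" "\<And>f. F (\<Theta> f) = G (\<Theta> f)"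
  shows "F x = G x"
proof -
  have "closed {x. F x = G x}" using assms(1,2) by (rule closed_Collect_eq)
  then have "closure (range \<Theta>) \<subseteq> {x. F x = G x}" using assms(3) by (intro closure_minimal) auto
  then show ?thesis using dense_range by auto
qed

lemma transported_dense:
  assumes "0 < e"
  shows "\<exists>f. transported (x - \<Theta> f) < e"
proof -
  have "0 < e * c" using assms c by simp
  then obtain f where "norm (x - \<Theta> f) < e * c" using dense_range dense_iff_norm[of x "range \<Theta>"] by auto
  then have "norm (x - \<Theta> f) / c < e" using c by (simp add: pos_divide_less_eq)
  then show ?thesis using transported_upper[of "x - \<Theta> f"] by (intro exI[of _ f]) simp
qed

lemma extend_operator:
  assumes S: "linear S" "\<And>f. N (S f) \<le> N f"
  obtains T where "bounded_linear T" "\<And>f. T (\<Theta> f) = \<Theta> (S f)"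
proof -
  define D where "D = \<bar>C\<bar> / c"
  have D: "0 \<le> D" using c by (simp add: D_def)
  have bd: "norm (\<Theta> (S f)) \<le> D * norm (\<Theta> f)" for f
  proof -
    have "norm (\<Theta> (S f)) \<le> \<bar>C\<bar> * N (S f)" 
      by (rule order_trans[OF upper mult_right_mono]) (simp_all add: Ns(6))
    also have "\<dots> \<le> \<bar>C\<bar> * N f" using S(2) by (intro mult_left_mono) auto
    also have "\<dots> \<le> \<bar>C\<bar> * (norm (\<Theta> f) / c)" using lower[of f] c by (intro mult_left_mono) (auto simp: pos_le_divide_eq mult.commute)
    finally show ?thesis by (simp add: D_def)
  qed
  have l: "lin_on UNIV (\<lambda>f. \<Theta> (S f))"
    using linear_compose[OF S(1) lin] by (intro lin_onI_linear) (simp add: o_def)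
  obtain g where g: "\<And>v. v \<in> UNIV \<Longrightarrow> g (\<Theta> v) = \<Theta> (S v)"
    "lin_on {y. \<forall>e>0. \<exists>v\<in>UNIV. norm (y - \<Theta> v) < e} g"
    "\<And>y. \<forall>e>0. \<exists>v\<in>UNIV. norm (y - \<Theta> v) < e \<Longrightarrow> norm (g y) \<le> D * norm y"
    using extend_by_density[OF subspace_UNIV lin l seminorm_on_norm bd D] by blast
  have all: "\<forall>e>0. \<exists>v\<in>UNIV. norm (y - \<Theta> v) < e" for y
    using dense_range dense_iff_norm[of y "range \<Theta>"] by auto
  show ?thesis
  proof
    show "bounded_linear g"
      using g(2,3) all unfolding lin_on_def by (intro bounded_linear_intro[of _ D]) (auto simp: mult.commute)
    show "g (\<Theta> f) = \<Theta> (S f)" for f using g(1) by simp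
  qed
qed

lemma extend_isometry:
  assumes S: "linear S" "bij S" "\<And>f. N (S f) = N f"
  obtains T where "linear T" "surj T" "\<And>x. transported (T x) = transported x" "\<And>f. T (\<Theta> f) = \<Theta> (S f)"
proof -
  have i: "inv S (S f) = f" "S (inv S f) = f" for f
    using S(2) by (simp_all add: bij_is_inj bij_is_surj surj_f_inv_f)
  have lS': "linear (inv S)"
    by (rule linearI) (metis i linear_add[OF S(1)], metis i linear_scale[OF S(1)])
  have NS': "N (inv S f) \<le> N f" for f using S(3)[of "inv S f"] i by simp
  obtain T where T: "bounded_linear T" "\<And>f. T (\<Theta> f) = \<Theta> (S f)" using extend_operator[OF S(1)] S(3) by auto
  obtain T' where T': "bounded_linear T'" "\<And>f. T' (\<Theta> f) = \<Theta> (inv S f)" using extend_operator[OF lS' NS'] by auto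
  have cT: "continuous_on UNIV T" "continuous_on UNIV T'" using T(1) T'(1) linear_continuous_on by blast+
  have "T (T' x) = x" for x
    by (rule eq_by_density[of "\<lambda>x. T (T' x)" "\<lambda>x. x"])
      (auto intro!: continuous_on_compose2[OF cT(1) cT(2)] simp: T T' i)
  then have "surj T" by (metis surjI)
  moreover have "transported (T x) = transported x" for x
    by (rule eq_by_density[of "\<lambda>x. transported (T x)" transported])
      (auto intro!: continuous_on_compose2[OF transported_continuous cT(1)] transported_continuous simp: T transported_\<Theta> S(3))
  ultimately show ?thesis using that bounded_linear.linear[OF T(1)] T(2) by blast
qed

lemma transported_unit_approx:
  assumes x: "transported x = 1" and d: "0 < d" "d \<le> 1 / 2"
  obtains f where "N f = 1" "transported (x - \<Theta> f) < 2 * d"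
proof -
  obtain g where g: "transported (x - \<Theta> g) < d" using transported_dense[OF d(1)] by blast
  have "\<bar>1 - N g\<bar> \<le> transported (x - \<Theta> g)"
    using ts(8)[of x "\<Theta> g"] ts(8)[of "\<Theta> g" x] ts(9)[of x "\<Theta> g"] x transported_\<Theta>[of g] by linarith
  then have ng: "\<bar>1 - N g\<bar> < d" "0 < N g" using g d by linarith+
  define f where "f = (1 / N g) *\<^sub>R g"
  have "N f = 1" using ng by (simp add: f_def Ns(2))
  moreover have "transported (\<Theta> g - \<Theta> f) = \<bar>1 - N g\<bar>"
  proof -
    have "g - f = (1 - 1 / N g) *\<^sub>R g" by (simp add: f_def scaleR_diff_left)
    then have "transported (\<Theta> g - \<Theta> f) = \<bar>1 - 1 / N g\<bar> * \<bar>N g\<bar>"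
      using ng by (simp add: transported_\<Theta> Ns(2) flip: linear_diff[OF lin])
    also have "\<dots> = \<bar>(1 - 1 / N g) * N g\<bar>" by (simp only: abs_mult)
    also have "(1 - 1 / N g) * N g = N g - 1" using ng by (simp add: field_simps)
    finally show ?thesis by simp
  qed
  then have "transported (x - \<Theta> f) < 2 * d"
    using ts(3)[of "x - \<Theta> g" "\<Theta> g - \<Theta> f"] g ng by simp
  ultimately show ?thesis using that by blast
qed

lemma transported_almost_transitive:
  assumes orbit: "\<And>f g e. N f = N g \<Longrightarrow> 0 < e \<Longrightarrow> \<exists>S. linear S \<and> bij S \<and> (\<forall>h. N (S h) = N h) \<and> N (S f - g) < e"
  shows "almost_transitive transported"
  unfolding almost_transitive_def
proof (intro allI impI)
  fix x y and e :: real
  assume xy: "transported x = 1" "transported y = 1" and e: "0 < e"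
  define d where "d = min (1 / 2) (e / 12)"
  have d: "0 < d" "d \<le> 1 / 2" "d \<le> e / 12" using e by (auto simp: d_def)
  obtain f where f: "N f = 1" "transported (x - \<Theta> f) < 2 * d" using transported_unit_approx[OF xy(1) d(1,2)] by blast
  obtain g where g: "N g = 1" "transported (y - \<Theta> g) < 2 * d" using transported_unit_approx[OF xy(2) d(1,2)] by blast
  have "0 < e / 3" using e by simp
  then obtain S where S: "linear S" "bij S" "\<And>h. N (S h) = N h" "N (S f - g) < e / 3"
    using orbit[of f g "e / 3"] f g by auto
  obtain T where T: "linear T" "surj T" "\<And>x. transported (T x) = transported x" "\<And>f. T (\<Theta> f) = \<Theta> (S f)"
    using extend_isometry[OF S(1-3)] by blast
  have eq: "y - T x = ((y - \<Theta> g) - \<Theta> (S f - g)) - T (x - \<Theta> f)"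
    by (simp add: linear_diff[OF T(1)] linear_diff[OF lin] T(4))
  have "transported (y - T x) \<le> (transported (y - \<Theta> g) + transported (\<Theta> (S f - g))) + transported (T (x - \<Theta> f))"
    unfolding eq using ts(7)[of "(y - \<Theta> g) - \<Theta> (S f - g)" "T (x - \<Theta> f)"] ts(7)[of "y - \<Theta> g" "\<Theta> (S f - g)"] by linarith
  also have "\<dots> \<le> e" using f g S(4) d by (simp add: transported_\<Theta> T(3))
  finally show "\<exists>T. linear T \<and> surj T \<and> (\<forall>z. transported (T z) = transported z) \<and> transported (y - T x) \<le> e"
    using T by blast
qed

text \<open>The splitting makes the projection a contraction, so it extends by density and the
  identities persist by continuity. It stays nontrivial because \<open>\<Theta>\<close> is
  injective.\<close>

lemma transported_Lp_projection:
  assumes R: "Lp_projection p N R" and p: "0 < p"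
  shows "\<exists>T. Lp_projection p transported T"
proof -
  note R' = Lp_projectionD[OF R]
  have "N (R f) \<le> N f" for f
  proof -
    have "N (R f) powr p \<le> N f powr p" using R'(3)[of f] by simp
    then show ?thesis using powr_less_mono2[OF p Ns(6), of f "N (R f)"] by linarith
  qed
  then obtain T where T: "bounded_linear T" "\<And>f. T (\<Theta> f) = \<Theta> (R f)" using extend_operator[OF R'(1)] by blast
  have cT: "continuous_on UNIV T" using T(1) linear_continuous_on by blast
  have lT: "linear T" using T(1) by (rule bounded_linear.linear)
  have inj: "\<Theta> f = \<Theta> g \<Longrightarrow> f = g" for f g
    using lower[of "f - g"] c Ns(6)[of "f - g"] norm_on_zero[OF N, of "f - g"]
    by (simp add: linear_diff[OF lin] mult_le_0_iff)
  have pow: "continuous_on UNIV (\<lambda>x. transported (h x) powr p)" if "continuous_on UNIV h" for h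
    using p ts(6) that
    by (intro continuous_on_powr' continuous_on_compose2[OF transported_continuous that] continuous_on_const) auto
  have "T (T x) = T x" for x
    by (rule eq_by_density[of "\<lambda>x. T (T x)" T])
      (auto intro!: continuous_on_compose2[OF cT cT] cT simp: T R'(2))
  moreover have "transported x powr p = transported (T x) powr p + transported (x - T x) powr p" for x
  proof (rule eq_by_density[of "\<lambda>x. transported x powr p" "\<lambda>x. transported (T x) powr p + transported (x - T x) powr p"])
    show "continuous_on UNIV (\<lambda>x. transported x powr p)" by (rule pow) (rule continuous_on_id)
    show "continuous_on UNIV (\<lambda>x. transported (T x) powr p + transported (x - T x) powr p)"
      by (intro continuous_on_add pow cT continuous_on_diff continuous_on_id)
    show "transported (\<Theta> f) powr p = transported (T (\<Theta> f)) powr p + transported (\<Theta> f - T (\<Theta> f)) powr p" for f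
      using R'(3)[of f] by (simp add: T transported_\<Theta> flip: linear_diff[OF lin])
  qed
  moreover have "\<exists>x. T x \<noteq> 0" using R'(4) T(2) inj linear_0[OF lin] by metis
  moreover have "\<exists>x. T x \<noteq> x" using R'(5) T(2) inj by metis
  ultimately show ?thesis unfolding Lp_projection_def using lT by blast
qed

end

section \<open>Embedding the step functions densely by a decomposition swindle\<close>

lemma mean_norm_le:
  assumes p: "1 < p"
  shows "norm (intg (restr 1 f)) \<le> Lp p f"
proof (rule ccontr)
  assume "\<not> ?thesis"
  then have "Lp p f powr p < norm (intg (restr 1 f)) powr p"
    using p Lp_nonneg[OF p] by (intro powr_less_mono2) auto
  also have "\<dots> \<le> pow_int p (restr 1 f)" by (rule pow_norm_mean_le[OF p])
  also have "\<dots> \<le> pow_int p f" by (rule pow_int_restr_le)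
  finally show False by (simp add: Lp_powr[OF p])
qed

lemma comp_step_shift: "G 0 = 0 \<Longrightarrow> comp_step G (shift d f) = shift d (comp_step G f)"
  by (rule stepf_eqI) (simp add: ev_comp_step)

lemma ev_avg_0: "ev (avg f) 0 = intg (restr 1 f)"
proof -
  have "shift 0 f = f" by (rule stepf_eqI) (simp add: ev_neg)
  then show ?thesis by (simp add: ev_avg)
qed

lemma restr_avg: "restr 1 (avg f) = cell 1 (ev (avg f) 0)"
proof (rule stepf_eqI)
  fix t :: real
  have "\<lfloor>t\<rfloor> = 0" if "0 \<le> t" "t < 1" using that by linarith
  then show "ev (restr 1 (avg f)) t = ev (cell 1 (ev (avg f) 0)) t" by (auto simp: ev_avg)
qed

text \<open>
  Write \<open>W\<close> for the kernel of \<open>P\<close> and \<open>Y\<close> for the completion of the step functions. Averaging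
  over unit intervals shows that \<open>Y\<close> contains the \<open>l\<^sub>p\<close>-sum of countably many copies of the
  whole space, hence of \<open>W\<close>, as a complemented subspace. Shifting these copies of \<open>W\<close> by one
  place frees one of them, so that \<open>Y\<close> is isomorphic to \<open>W \<oplus> Y\<close>, that is, to the whole space.
\<close>

lemma swindle_embedding:
  fixes J :: "'a::banach stepf \<Rightarrow> 'a"
  assumes p: "1 < p" and J: "linear J" "\<And>f. norm (J f) = Lp p f"
    and P: "bounded_linear P" "\<And>f. P (J f) = J f" "\<And>x. P x \<in> closure (range J)"
  obtains \<Theta> :: "'a stepf \<Rightarrow> 'a" and c C where "dense_embedding \<Theta> (Lp p) c C"
proof -
  have lP: "linear P" using P(1) by (rule bounded_linear.linear)
  obtain K0 where K0: "0 < K0" "\<And>x. norm (P x) \<le> norm x * K0"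
    using bounded_linear.pos_bounded[OF P(1)] by blast
  \<comment> \<open>A common bound for \<open>P\<close> and for \<open>L\<close>, the projection
    onto the kernel of \<open>P\<close>.\<close>
  define K where "K = 1 + K0"
  define L where "L x = x - P x" for x
  have K: "0 < K" "1 \<le> K" using K0 by (auto simp: K_def)
  have PK: "norm (P x) \<le> K * norm x" for x
  proof -
    have "norm (P x) \<le> K0 * norm x" using K0(2)[of x] by (simp add: mult.commute)
    also have "\<dots> \<le> K * norm x" by (intro mult_right_mono) (auto simp: K_def)
    finally show ?thesis .
  qed
  have lL: "linear L" unfolding L_def by (intro linear_compose_sub linear_ident lP)
  have LK: "norm (L x) \<le> K * norm x" for x
    using norm_triangle_ineq4[of x "P x"] K0(2)[of x] by (simp add: L_def K_def algebra_simps)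
  have PP: "P (P x) = P x" for x
  proof -
    have "closed {y. P y = y}"
      using linear_continuous_on[OF P(1)] by (intro closed_Collect_eq continuous_on_id) auto
    then have "closure (range J) \<subseteq> {y. P y = y}" using P(2) by (intro closure_minimal) auto
    then show ?thesis using P(3)[of x] by auto
  qed
  have LJ: "L (J f) = 0" for f by (simp add: L_def P(2))
  have LL: "L (L x) = L x" for x by (simp add: L_def linear_diff[OF lP] PP)
  have PL: "P (L x) = 0" for x by (simp add: L_def linear_diff[OF lP] PP)
  have L0: "L 0 = 0" by (rule linear_0[OF lL])
  define m where "m = comp_step L"
  have lm: "linear m" unfolding m_def by (rule comp_step_linear[OF lL])
  have evm: "ev (m f) t = L (ev f t)" for f t by (simp add: m_def ev_comp_step L0)
  have mm: "m (m f) = m f" for f by (rule stepf_eqI) (simp add: m_def ev_comp_step L0 LL)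
  have mcell: "m (cell b x) = cell b (L x)" for b x unfolding m_def by (rule comp_step_cell[of L, OF L0])
  have mshift: "m (shift d f) = shift d (m f)" for d f unfolding m_def by (rule comp_step_shift[of L, OF L0])
  have avgm: "avg (m f) = m (avg f)" for f unfolding m_def by (rule avg_comp[OF lL])
  have Nm: "Lp p (m f) \<le> K * Lp p f" for f
    unfolding m_def using K by (intro Lp_comp_le[OF p lL LK]) simp
  have Navg: "Lp p (avg f) \<le> Lp p f" for f :: "'a stepf" by (intro Lp_mono[OF p] pow_int_avg_le[OF p])
  note N = Lp_seminorm[OF p]
  define S where "S = (shift (- 1) :: 'a stepf \<Rightarrow> 'a stepf)"
  define R where "R = (shift 1 :: 'a stepf \<Rightarrow> 'a stepf)"
  have lS: "linear S" by (simp add: S_def shift_linear)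
  have SR: "S (R f) = f" for f unfolding S_def R_def by (rule shift_left_right) simp
  have Scell: "S (cell 1 x) = 0" for x by (simp add: S_def shift_left_cell[of 1, simplified] cell_nonpos)
  have NS: "Lp p (S f) \<le> Lp p f" for f unfolding S_def using Lp_shift_left_le[OF p, of 1 f] by simp
  have NR: "Lp p (R f) = Lp p f" for f unfolding R_def by (rule Lp_shift[OF p]) simp
  have avgS: "avg (S f) = S (avg f)" and avgR: "avg (R f) = R (avg f)" for f
    by (simp_all add: S_def R_def avg_shift_left avg_shift)
  have mS: "m (S f) = S (m f)" and mR: "m (R f) = R (m f)" for f by (simp_all add: S_def R_def mshift)
  have avgcell: "avg (cell 1 x) = cell 1 x" for x :: 'a using avg_cell_int[of 1 x] by simp
  \<comment> \<open>The projection onto the copies of the kernel of \<open>P\<close>, one for each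
    unit interval; it commutes with the unit shifts \<open>S\<close> and \<open>R\<close>.\<close>
  define h where "h f = m (avg f)" for f
  have lh: "linear h" unfolding h_def using linear_compose[OF avg_linear lm] by (simp add: o_def)
  have mh: "m (h f) = h f" and avgh: "avg (h f) = h f" for f by (simp_all add: h_def mm avgm avg_avg)
  have hh: "h (h f) = h f" for f by (simp only: h_def[of "h f"] avgh mh)
  have hS: "h (S f) = S (h f)" and hR: "h (R f) = R (h f)" for f by (simp_all add: h_def avgS avgR mS mR)
  have hcell: "h (cell 1 x) = cell 1 (L x)" for x by (simp add: h_def avgcell mcell)
  have h0: "ev (h f) 0 = L (intg (restr 1 f))" for f by (simp add: h_def m_def ev_comp_step L0 ev_avg_0)
  have Nh: "Lp p (h f) \<le> K * Lp p f" for f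
    using order_trans[OF Nm mult_left_mono[OF Navg]] K by (simp add: h_def)
  have hsplit: "h f = cell 1 (ev (h f) 0) + R (S (h f))" for f
  proof -
    have "restr 1 (h f) = m (restr 1 (avg f))"
      by (rule stepf_eqI) (simp add: h_def m_def ev_comp_step L0)
    also have "\<dots> = cell 1 (ev (h f) 0)" by (simp add: restr_avg mcell h_def evm)
    finally show ?thesis using restr_shift_split[of 1 "h f"] by (simp add: R_def S_def)
  qed
  \<comment> \<open>\<open>B\<close> keeps the complementary part \<open>f - h f\<close> and shifts
    the copies one place to the left, which loses the first copy.\<close>
  define B where "B f = f + S (h f) - h f" for f
  have lB: "linear B" unfolding B_def
    by (rule linearI) (simp_all add: linear_add[OF lh] linear_scale[OF lh] linear_add[OF lS] linear_scale[OF lS] scaleR_add_right scaleR_diff_right)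
  have hB: "h (B f) = S (h f)" for f
    by (simp add: B_def linear_add[OF lh] linear_diff[OF lh] hS hh)
  \<comment> \<open>The lost copy is recovered from its value at \<open>0\<close>, the others by
    shifting right.\<close>
  have inv: "f = B f - h (B f) + R (h (B f)) + cell 1 (ev (h f) 0)" for f
    using hsplit[of f] unfolding hB by (simp add: B_def algebra_simps)
  \<comment> \<open>The lost coordinate becomes the kernel component and \<open>J (B f)\<close> the
    component in the range of \<open>P\<close>; \<open>L\<close> and \<open>P\<close> separate the
    two.\<close>
  define \<Theta> where "\<Theta> f = ev (h f) 0 + J (B f)" for f
  have l\<Theta>: "linear \<Theta>" unfolding \<Theta>_def
    by (rule linearI) (simp_all add: linear_add[OF lh] linear_scale[OF lh] linear_add[OF lB] linear_scale[OF lB]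
        linear_add[OF J(1)] linear_scale[OF J(1)] scaleR_add_right)
  have PT: "P (\<Theta> f) = J (B f)" for f by (simp add: \<Theta>_def linear_add[OF lP] P(2) h0 PL)
  have LT: "L (\<Theta> f) = ev (h f) 0" for f by (simp add: \<Theta>_def linear_add[OF lL] LJ h0 LL)
  have upper: "norm (\<Theta> f) \<le> (1 + 3 * K) * Lp p f" for f
  proof -
    have "norm (ev (h f) 0) \<le> K * norm (intg (restr 1 f))" unfolding h0 by (rule LK)
    also have "\<dots> \<le> K * Lp p f" using K mean_norm_le[OF p] by (intro mult_left_mono) auto
    finally have 1: "norm (ev (h f) 0) \<le> K * Lp p f" .
    have "Lp p (B f) \<le> Lp p (f + S (h f)) + Lp p (h f)" unfolding B_def by (rule N(7))
    also have "Lp p (f + S (h f)) \<le> Lp p f + Lp p (S (h f))" by (rule N(3))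
    also have "Lp p (S (h f)) \<le> Lp p (h f)" by (rule NS)
    finally have "Lp p (B f) \<le> Lp p f + 2 * (K * Lp p f)" using Nh[of f] by simp
    then show ?thesis using 1 norm_triangle_ineq[of "ev (h f) 0" "J (B f)"] J(2)[of "B f"]
      by (simp add: \<Theta>_def algebra_simps)
  qed
  \<comment> \<open>In \<open>inv\<close>, the term \<open>B f\<close> and two terms of size
    \<open>h (B f)\<close> cost \<open>1 + 2 * K\<close> times \<open>norm (P (\<Theta> f))\<close>,
    and the recovered cell costs \<open>norm (L (\<Theta> f))\<close>; both projections are bounded
    by \<open>K\<close>.\<close>
  define D where "D = (1 + 2 * K) * K + K"
  have D: "0 < D" using K by (simp add: D_def add_pos_pos)
  have "Lp p f \<le> D * norm (\<Theta> f)" for f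
  proof -
    let ?g = "B f"
    have "Lp p f = Lp p (?g - h ?g + R (h ?g) + cell 1 (ev (h f) 0))" using inv[of f] by simp
    also have "\<dots> \<le> Lp p (?g - h ?g + R (h ?g)) + Lp p (cell 1 (ev (h f) 0))" by (rule N(3))
    also have "Lp p (?g - h ?g + R (h ?g)) \<le> Lp p (?g - h ?g) + Lp p (R (h ?g))" by (rule N(3))
    also have "Lp p (?g - h ?g) \<le> Lp p ?g + Lp p (h ?g)" by (rule N(7))
    also have "Lp p (R (h ?g)) = Lp p (h ?g)" by (rule NR)
    also have "Lp p (cell 1 (ev (h f) 0)) = norm (L (\<Theta> f))" by (simp add: Lp_cell[OF p] LT)
    finally have "Lp p f \<le> Lp p ?g + 2 * (K * Lp p ?g) + norm (L (\<Theta> f))" using Nh[of ?g] by simp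
    moreover have g: "Lp p ?g \<le> K * norm (\<Theta> f)" using PK[of "\<Theta> f"] by (simp add: PT J(2))
    moreover have "K * Lp p ?g \<le> K * (K * norm (\<Theta> f))" using g K by (intro mult_left_mono) auto
    ultimately have "Lp p f \<le> K * norm (\<Theta> f) + 2 * (K * (K * norm (\<Theta> f))) + K * norm (\<Theta> f)"
      using LK[of "\<Theta> f"] by linarith
    then show ?thesis by (simp add: D_def algebra_simps)
  qed
  then have lower: "1 / D * Lp p f \<le> norm (\<Theta> f)" for f using D by (simp add: pos_divide_le_eq mult.commute)
  have hit: "\<exists>f. \<Theta> f = w + J g" if w: "L w = w" for w g
  proof -
    \<comment> \<open>The formula \<open>inv\<close> with \<open>g\<close> in place of
      \<open>B f\<close> and \<open>w\<close> in place of the lost coordinate.\<close>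
    define f where "f = g - h g + R (h g) + cell 1 w"
    have hf: "h f = R (h g) + cell 1 w"
      by (simp add: f_def linear_add[OF lh] linear_diff[OF lh] hh hR hcell w)
    have Shf: "S (h f) = h g" by (simp add: hf linear_add[OF lS] SR Scell)
    have "B f = f + h g - (R (h g) + cell 1 w)" unfolding B_def Shf by (simp only: hf)
    also have "\<dots> = g" by (simp add: f_def)
    finally have "B f = g" .
    moreover have "ev (h f) 0 = w" by (simp add: hf R_def ev_neg)
    ultimately show ?thesis by (intro exI[of _ f]) (simp add: \<Theta>_def)
  qed
  have "closure (range \<Theta>) = UNIV"
  proof -
    have "x \<in> closure (range \<Theta>)" for x
      unfolding dense_iff_norm
    proof (intro allI impI)
      fix e :: real assume "0 < e"
      then obtain g where g: "norm (P x - J g) < e" using P(3)[of x] unfolding dense_iff_norm by blast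
      obtain f where f: "\<Theta> f = L x + J g" using hit[OF LL] by blast
      have "x - \<Theta> f = P x - J g" by (simp add: f L_def)
      then have "norm (x - \<Theta> f) < e" using g by simp
      then show "\<exists>v\<in>range \<Theta>. norm (x - v) < e" by blast
    qed
    then show ?thesis by blast
  qed
  then have "dense_embedding \<Theta> (Lp p) (1 / D) (1 + 3 * K)"
    using D lower upper l\<Theta> Lp_norm_on[OF p] by (intro dense_embedding.intro) auto
  then show ?thesis using that by blast
qed

text \<open>Disjoint supports make power integrals additive. Cells of length \<open>1\<close> and
  \<open>2\<close> show that the restriction is neither zero nor the identity.\<close>

lemma restr_Lp_projection:
  assumes p: "1 < p" and e: "(e :: 'a::banach) \<noteq> 0"
  shows "Lp_projection p (Lp p) (restr 1 :: 'a stepf \<Rightarrow> 'a stepf)"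
proof -
  have "f - restr 1 f = shift 1 (shift (- 1) f)" for f :: "'a stepf"
    using restr_shift_split[of 1 f] by (simp add: algebra_simps)
  then have "pow_int p (f - restr 1 f) = pow_int p (shift (- 1) f)" for f :: "'a stepf"
    by (simp add: pow_int_shift)
  then have "pow_int p f = pow_int p (restr 1 f) + pow_int p (f - restr 1 f)" for f :: "'a stepf"
    using pow_int_decompose[of 1 p f] by (simp only:)
  then have pw: "Lp p f powr p = Lp p (restr 1 f) powr p + Lp p (f - restr 1 f) powr p" for f :: "'a stepf"
    unfolding Lp_powr[OF p] .
  have idem: "restr 1 (restr 1 f) = restr 1 f" for f :: "'a stepf" by (rule stepf_eqI) simp
  have "ev (restr 1 (cell 1 e)) 0 \<noteq> ev 0 0" using e by simp
  then have 1: "restr 1 (cell 1 e) \<noteq> 0" by metis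
  have "ev (restr 1 (cell 2 e)) 1 \<noteq> ev (cell 2 e) 1" using e by simp
  then have 2: "restr 1 (cell 2 e) \<noteq> cell 2 e" by metis
  show ?thesis
    unfolding Lp_projection_def using restr_linear idem pw 1 2 by blast
qed

section \<open>From one exponent to a continuum of norms\<close>

context skeleton_space
begin

text \<open>A skeleton alone does not exclude the zero space. The amalgam of \<open>E 0\<close> with
  the real line embeds the line and so provides a nonzero vector.\<close>

lemma exists_unit_vector:
  obtains e :: 'a where "norm e = 1"
proof -
  have "(UNIV :: real set) = span {1}" by (auto simp: span_singleton)
  then have F: "fin_dim_subspace (UNIV :: real set)" unfolding fin_dim_subspace_def by (intro exI[of _ "{1}"]) simp
  have N: "norm_on (UNIV :: real set) norm" by (rule norm_on_norm) simp
  have g: "seminorm_on {0::real} (\<lambda>_. 0)" by (simp add: seminorm_on_def subspace_single_0)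
  have z: "(0::'a) \<in> E 0" by (rule subspace_0[OF E_subspace])
  obtain \<psi> :: "real \<Rightarrow> 'a" and \<sigma> where "linear \<psi>" "linear \<sigma>" "\<And>f. f \<in> UNIV \<Longrightarrow> \<sigma> (\<psi> f) = (f :: real)"
    by (rule amalgam[OF F N g, of "\<lambda>_. 0" 0 "\<lambda>_. 0" "\<lambda>_. 0" "\<lambda>_. 0" 0 1]) (use z in \<open>auto simp: linear_zero\<close>)
  then have "\<psi> 1 \<noteq> 0" by (metis UNIV_I linear_0 zero_neq_one)
  then have "norm ((1 / norm (\<psi> 1)) *\<^sub>R \<psi> 1) = 1" by simp
  then show ?thesis using that by blast
qed

lemma Lp_renorming:
  assumes p: "1 < p"
  obtains q :: "'a \<Rightarrow> real" and T where "equivalent_norm q" "almost_transitive q" "Lp_projection p q T"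
proof -
  obtain e :: 'a where e: "norm e = 1" using exists_unit_vector .
  obtain J :: "'a stepf \<Rightarrow> 'a" and P where J: "linear J" "\<And>f. norm (J f) = Lp p f" "bounded_linear P"
    "\<And>f. P (J f) = J f" "\<And>x. P x \<in> closure (range J)"
    using Lp_complemented[OF p] by blast
  obtain \<Theta> :: "'a stepf \<Rightarrow> 'a" and c C where "dense_embedding \<Theta> (Lp p) c C"
    using swindle_embedding[OF p J] by blast
  then interpret dense_embedding \<Theta> "Lp p" c C .
  have "almost_transitive transported"
  proof (rule transported_almost_transitive)
    fix f g :: "'a stepf" and d :: real
    assume fg: "Lp p f = Lp p g" and d: "0 < d"
    have "orbit_close p f g" by (rule orbit_close_same_norm[OF p almost_transitive_norm e fg])
    then obtain S where "step_iso p S" "Lp p (S f - g) < d" using d unfolding orbit_close_def[OF p] by blast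
    then show "\<exists>S. linear S \<and> bij S \<and> (\<forall>h. Lp p (S h) = Lp p h) \<and> Lp p (S f - g) < d"
      using step_iso_Lp[OF p] unfolding step_iso_def[OF p] by blast
  qed
  moreover have "e \<noteq> 0" using e by auto
  from transported_Lp_projection[OF restr_Lp_projection[OF p this]] p
  obtain T where "Lp_projection p transported T" by auto
  ultimately show ?thesis using that transported_equivalent by blast
qed

end

theorem theorem2p23:
  assumes "garbulinska_space TYPE('a::banach)"
  shows "\<exists>N :: ('a \<Rightarrow> real) set.
           N \<approx> (UNIV :: real set) \<and>
           (\<forall>p\<in>N. equivalent_norm p \<and> almost_transitive p) \<and>
           (\<forall>p\<in>N. \<forall>q\<in>N. p \<noteq> q \<longrightarrow> \<not> conjugate_norms p q)"
proof -
  obtain E :: "nat \<Rightarrow> 'a set" and pr where "skeleton_space E pr"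
    using has_skeleton_imp_skeleton_space assms unfolding garbulinska_space_def by blast
  then interpret skeleton_space E pr .
  have "\<forall>p\<in>{1<..<2::real}. \<exists>q :: 'a \<Rightarrow> real. equivalent_norm q \<and> almost_transitive q \<and> (\<exists>T. Lp_projection p q T)"
    using Lp_renorming by (metis greaterThanLessThan_iff)
  then obtain q :: "real \<Rightarrow> 'a \<Rightarrow> real" where q: "\<And>p. p \<in> {1<..<2} \<Longrightarrow> equivalent_norm (q p)"
    "\<And>p. p \<in> {1<..<2} \<Longrightarrow> almost_transitive (q p)" "\<And>p. p \<in> {1<..<2} \<Longrightarrow> \<exists>T. Lp_projection p (q p) T"
    by metis
  have norm: "norm_on UNIV (q p)" if "p \<in> {1<..<2}" for p
    using q(1)[OF that] by (simp add: equivalent_norm_def)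
  have nonconj: "\<not> conjugate_norms (q p) (q r)" if pr: "p \<in> {1<..<2}" "r \<in> {1<..<2}" "p \<noteq> r" for p r
  proof
    assume "conjugate_norms (q p) (q r)"
    then obtain T where T: "bounded_linear T" "bij T" "\<And>x. q p x = q r (T x)"
      unfolding conjugate_norms_def by blast
    obtain Q where Q: "Lp_projection r (q r) Q" using q(3)[OF pr(2)] by blast
    have 1: "Lp_projection r (q p) (\<lambda>x. inv T (Q (T x)))"
      by (rule Lp_projection_conjugate[OF Q bounded_linear.linear[OF T(1)] T(2,3)])
    obtain R where 2: "Lp_projection p (q p) R" using q(3)[OF pr(1)] by blast
    \<comment> \<open>The exclusion of two exponents is stated with the smaller one first, hence two
      instances.\<close>
    show False
      using no_two_Lp_projections[OF norm[OF pr(1)] _ _ _ 1 2] no_two_Lp_projections[OF norm[OF pr(1)] _ _ _ 2 1] pr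
      by fastforce
  qed
  \<comment> \<open>A norm shared by two exponents would be conjugate to itself, against
    \<open>nonconj\<close>; so the family is as large as the interval.\<close>
  have self: "conjugate_norms (q p) (q p)" for p
    unfolding conjugate_norms_def by (intro exI[of _ "\<lambda>x. x"]) (auto simp: bounded_linear_ident inv_id[unfolded id_def] bij_id[unfolded id_def])
  have inj: "inj_on q {1<..<2}"
    by (rule inj_onI, rule ccontr) (metis nonconj self)
  have "q ` {1<..<2} \<approx> {1<..<2::real}" using inj by (rule inj_on_image_eqpoll_self)
  also have "{1<..<2::real} \<approx> (UNIV :: real set)" by (simp add: open_interval_eqpoll_reals)
  finally have "q ` {1<..<2} \<approx> (UNIV :: real set)" .
  moreover have "\<not> conjugate_norms x y" if xy: "x \<in> q ` {1<..<2}" "y \<in> q ` {1<..<2}" "x \<noteq> y" for x y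
  proof -
    obtain p r where pr: "p \<in> {1<..<2}" "r \<in> {1<..<2}" "x = q p" "y = q r" using xy(1,2) by blast
    then have "p \<noteq> r" using xy(3) by blast
    then show ?thesis using nonconj[OF pr(1,2)] pr(3,4) by simp
  qed
  ultimately show ?thesis
    using q(1,2) by (intro exI[of _ "q ` {1<..<2}"]) blast
qed

end
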